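(* Let $X$ be a set, $H$ a complex Hilbert space, $\mathfrak{A}$ a unital $C^{*}$-algebra, and let $L\in\mathcal{M}$, with canonical factorization $L(s,t)(a)=V_{L}(s)^{*}\pi_{L}(a)V_{L}(t)$ on $H_{\tilde{L}}$. The following are equivalent: 1. $\pi_{L}$ is irreducible. 2. For every $K\in\mathcal{M}$: $K\leq L$ if and only if $K=\lambda L$ for some constant $\lambda\in\mathbb{C}$. 3. For every $K\in\mathcal{M}$ with $K\leq L$: $dK/dL=\lambda I_{H_{\tilde{L}}}$ for some constant $\lambda\in\mathbb{C}$.
   Context: Inner products are linear in the second variable. $\mathcal{B}(H)$ denotes the bounded linear operators on $H$, and $\mathcal{B}(\mathfrak{A},\mathcal{B}(H))$ the bounded linear maps from $\mathfrak{A}$ to $\mathcal{B}(H)$. $1_{\mathfrak{A}}$ is the unit of $\mathfrak{A}$. $\mathcal{M}$ is the class of generalized positive definite kernels, i.e. functions $K\colon X\times X\to \mathcal{B}(\mathfrak{A},\mathcal{B}(H))$ such that $$\sum_{i,j=1}^{N}\left\langle u_{i},K(s_{i},s_{j})(a_{i}^{*}a_{j})u_{j}\right\rangle _{H}\geq 0$$ for all $N\in\mathbb{N}$, $(u_i)_{i=1}^N\subset H$, $(s_i)_{i=1}^N\subset X$, $(a_i)_{i=1}^N\subset\mathfrak{A}$. For $K,L\in\mathcal{M}$, $K\leq L$ means $L-K\in\mathcal{M}$. For $L\in\mathcal{M}$ put $\Omega=X\times\mathfrak{A}\times H$ and define the scalar-valued positive definite kernel $\tilde{L}\colon\Omega\times\Omega\to\mathbb{C}$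 by $\tilde{L}((s,a,u),(t,b,v))=\langle u,L(s,t)(a^{*}b)v\rangle_{H}$. $H_{\tilde{L}}$ is its reproducing kernel Hilbert space, the closed linear span of the functions $\tilde{L}_{(t,b,v)}=\tilde{L}(\cdot,(t,b,v))$, with $\langle\tilde{L}_{x},\tilde{L}_{y}\rangle_{H_{\tilde{L}}}=\tilde{L}(x,y)$. The canonical factorization of $L$ is given by the bounded operators $V_{L}(t)\colon H\to H_{\tilde{L}}$, $V_{L}(t)v=\tilde{L}_{(t,1_{\mathfrak{A}},v)}$, and the $*$-representation $\pi_{L}\colon\mathfrak{A}\to \mathcal{B}(H_{\tilde{L}})$ determined by $\pi_{L}(a)\tilde{L}_{(t,b,v)}=\tilde{L}_{(t,ab,v)}$; it satisfies $L(s,t)(a)=V_{L}(s)^{*}\pi_{L}(a)V_{L}(t)$. Irreducible means that $\pi_L(\mathfrak{A})$ has no closed invariant subspaces other than $\{0\}$ and $H_{\tilde{L}}$ (equivalently, the commutant $\pi_{L}(\mathfrak{A})'$ consists of scalar multiples of the identity). Radon–Nikodym derivative: if $K\in\mathcal{M}$ and $K\leq L$, then $dK/dL$ denotes the (unique) operator $A\in\pi_{L}(\mathfrak{A})'$ with $0\leq A\leq I_{H_{\tilde{L}}}$ such that $K(s,t)(a)=V_{L}(s)^{*}\pi_{L}(a)AV_{L}(t)$ for all $s,t\in X$, $a\in\mathfrak{A}$.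
   Formalization: In condition 2 the constant λ is restricted to real 0 ≤ λ ≤ 1: with arbitrary λ ∈ ℂ the "if" half fails for every L ≠ 0, since K = 2L lies in M but K ≤ L is false. *)

theory Defs
  imports "HOL-Analysis.Analysis"
begin

class complex_normed_vector = real_normed_vector +
  fixes scaleC :: "complex \<Rightarrow> 'a \<Rightarrow> 'a"  (infixr "*\<^sub>C" 75)
  assumes scaleC_add_right: "c *\<^sub>C (x + y) = c *\<^sub>C x + c *\<^sub>C y"
    and scaleC_add_left: "(c + d) *\<^sub>C x = c *\<^sub>C x + d *\<^sub>C x"
    and scaleC_scaleC: "c *\<^sub>C (d *\<^sub>C x) = (c * d) *\<^sub>C x"
    and scaleC_of_real: "complex_of_real r *\<^sub>C x = r *\<^sub>R x"
    and norm_scaleC: "norm (c *\<^sub>C x) = cmod c * norm x"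

class complex_inner = complex_normed_vector +
  fixes cinner :: "'a \<Rightarrow> 'a \<Rightarrow> complex"
  assumes cinner_commute: "cinner x y = cnj (cinner y x)"
    and cinner_add_right: "cinner x (y + z) = cinner x y + cinner x z"
    and cinner_scaleC_right: "cinner x (c *\<^sub>C y) = c * cinner x y"
    and cinner_self_nonneg: "cinner x x \<in> \<real>\<^sub>\<ge>\<^sub>0"
    and norm_eq_sqrt_cinner: "norm x = sqrt (Re (cinner x x))"

class complex_hilbert = complex_inner + banach

class unital_cstar_algebra = complex_normed_vector + real_normed_algebra_1 + banach +
  fixes star :: "'a \<Rightarrow> 'a"
  assumes scaleC_mult_left: "(c *\<^sub>C x) * y = c *\<^sub>C (x * y)"
    and scaleC_mult_right: "x * (c *\<^sub>C y) = c *\<^sub>C (x * y)"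
    and star_star: "star (star x) = x"
    and star_add: "star (x + y) = star x + star y"
    and star_scaleC: "star (c *\<^sub>C x) = cnj c *\<^sub>C star x"
    and star_mult: "star (x * y) = star y * star x"
    and cstar_identity: "norm (star x * x) = (norm x)\<^sup>2"

instantiation complex :: complex_hilbert
begin
definition scaleC_complex :: "complex \<Rightarrow> complex \<Rightarrow> complex" where "scaleC_complex c x = c * x"
definition cinner_complex :: "complex \<Rightarrow> complex \<Rightarrow> complex" where "cinner_complex x y = cnj x * y"
instance
proof
  fix c d x y z :: complex and r :: real
  show "c *\<^sub>C (x + y) = c *\<^sub>C x + c *\<^sub>C y" "(c + d) *\<^sub>C x = c *\<^sub>C x + d *\<^sub>C x"
    "c *\<^sub>C d *\<^sub>C x = (c * d) *\<^sub>C x" "cinner x (y + z) = cinner x y + cinner x z"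
    "cinner x (c *\<^sub>C y) = c * cinner x y"
    by (simp_all add: scaleC_complex_def cinner_complex_def algebra_simps)
  show "complex_of_real r *\<^sub>C x = r *\<^sub>R x" "norm (c *\<^sub>C x) = cmod c * norm x"
    by (simp_all add: scaleC_complex_def scaleR_conv_of_real norm_mult)
  show "cinner x y = cnj (cinner y x)"
    by (simp add: cinner_complex_def mult.commute)
  show "cinner x x \<in> \<real>\<^sub>\<ge>\<^sub>0" "norm x = sqrt (Re (cinner x x))"
    by (simp_all add: cinner_complex_def complex_nonneg_Reals_iff cmod_def power2_eq_square)
qed
end

instantiation complex :: unital_cstar_algebra
begin
definition star_complex :: "complex \<Rightarrow> complex" where "star_complex = cnj"
instance
  by standard
    (auto simp: scaleC_complex_def star_complex_def norm_mult power2_eq_square)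
end

definition complex_linear :: "('a::complex_normed_vector \<Rightarrow> 'b::complex_normed_vector) \<Rightarrow> bool" where
  "complex_linear T \<longleftrightarrow> (\<forall>x y. T (x + y) = T x + T y) \<and> (\<forall>c x. T (c *\<^sub>C x) = c *\<^sub>C T x)"

definition bounded_ops :: "('h::complex_hilbert \<Rightarrow> 'h) set" where
  "bounded_ops = {T. complex_linear T \<and> bounded_linear T}"

definition bounded_op_maps ::
  "('a::unital_cstar_algebra \<Rightarrow> 'h::complex_hilbert \<Rightarrow> 'h) set" where
  "bounded_op_maps = {\<Phi>. (\<forall>a. \<Phi> a \<in> bounded_ops) \<and>
     (\<forall>a b u. \<Phi> (a + b) u = \<Phi> a u + \<Phi> b u) \<and>
     (\<forall>c a u. \<Phi> (c *\<^sub>C a) u = c *\<^sub>C \<Phi> a u) \<and>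
     (\<exists>C. \<forall>a. onorm (\<Phi> a) \<le> C * norm a)}"

type_synonym ('x, 'a, 'h) op_kernel = "'x \<Rightarrow> 'x \<Rightarrow> 'a \<Rightarrow> 'h \<Rightarrow> 'h"

definition gpd_kernels ::
  "('x, 'a::unital_cstar_algebra, 'h::complex_hilbert) op_kernel set" where
  "gpd_kernels = {K. (\<forall>s t. K s t \<in> bounded_op_maps) \<and>
     (\<forall>(N::nat) u s a.
        (\<Sum>i<N. \<Sum>j<N. cinner (u i) (K (s i) (s j) (star (a i) * a j) (u j))) \<in> \<real>\<^sub>\<ge>\<^sub>0)}"

definition kernel_le ::
  "('x, 'a::unital_cstar_algebra, 'h::complex_hilbert) op_kernel
     \<Rightarrow> ('x, 'a, 'h) op_kernel \<Rightarrow> bool"  (infix "\<unlhd>" 50) where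
  "K \<unlhd> L \<longleftrightarrow> (\<lambda>s t a u. L s t a u - K s t a u) \<in> gpd_kernels"

definition kernel_scale ::
  "complex \<Rightarrow> ('x, 'a::unital_cstar_algebra, 'h::complex_hilbert) op_kernel
     \<Rightarrow> ('x, 'a, 'h) op_kernel" where
  "kernel_scale c L = (\<lambda>s t a u. c *\<^sub>C L s t a u)"

text \<open>
  The reproducing kernel Hilbert space of a kernel depends
  on that kernel and so cannot be a type. A Hilbert space of complex
  functions on \<open>'w\<close> is given by its set of vectors, with pointwise operations, and an inner
  product whose values are relevant only on that set. Likewise, an operator on such a space is a
  HOL function whose values are relevant only on that set.
\<close>

record 'w function_space =
  vecs :: "('w \<Rightarrow> complex) set"
  ip :: "('w \<Rightarrow> complex) \<Rightarrow> ('w \<Rightarrow> complex) \<Rightarrow> complex"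

definition fnorm :: "'w function_space \<Rightarrow> ('w \<Rightarrow> complex) \<Rightarrow> real" where
  "fnorm E f = sqrt (Re (ip E f f))"

definition fdist :: "'w function_space \<Rightarrow> ('w \<Rightarrow> complex) \<Rightarrow> ('w \<Rightarrow> complex) \<Rightarrow> real" where
  "fdist E f g = fnorm E (\<lambda>x. f x - g x)"

definition fun_subspace :: "('w \<Rightarrow> complex) set \<Rightarrow> bool" where
  "fun_subspace M \<longleftrightarrow> (\<lambda>x. 0) \<in> M \<and>
     (\<forall>f\<in>M. \<forall>g\<in>M. (\<lambda>x. f x + g x) \<in> M) \<and>
     (\<forall>c. \<forall>f\<in>M. (\<lambda>x. c * f x) \<in> M)"

definition fclosure :: "'w function_space \<Rightarrow> ('w \<Rightarrow> complex) set \<Rightarrow> ('w \<Rightarrow> complex) set" where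
  "fclosure E M = {f \<in> vecs E. \<exists>F. (\<forall>n::nat. F n \<in> M) \<and> (\<lambda>n. fdist E (F n) f) \<longlonglongrightarrow> 0}"

definition hilbert_function_space :: "'w function_space \<Rightarrow> bool" where
  "hilbert_function_space E \<longleftrightarrow>
     fun_subspace (vecs E) \<and>
     (\<forall>f\<in>vecs E. \<forall>g\<in>vecs E. ip E f g = cnj (ip E g f)) \<and>
     (\<forall>f\<in>vecs E. \<forall>g\<in>vecs E. \<forall>h\<in>vecs E. ip E f (\<lambda>x. g x + h x) = ip E f g + ip E f h) \<and>
     (\<forall>c. \<forall>f\<in>vecs E. \<forall>g\<in>vecs E. ip E f (\<lambda>x. c * g x) = c * ip E f g) \<and>
     (\<forall>f\<in>vecs E. ip E f f \<in> \<real>\<^sub>\<ge>\<^sub>0) \<and>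
     (\<forall>f\<in>vecs E. ip E f f = 0 \<longrightarrow> f = (\<lambda>x. 0)) \<and>
     (\<forall>F::nat \<Rightarrow> 'w \<Rightarrow> complex. (\<forall>n. F n \<in> vecs E) \<longrightarrow>
        (\<forall>e>0. \<exists>N. \<forall>m\<ge>N. \<forall>n\<ge>N. fdist E (F m) (F n) < e) \<longrightarrow>
        (\<exists>f\<in>vecs E. (\<lambda>n. fdist E (F n) f) \<longlonglongrightarrow> 0))"

definition fun_bounded_op ::
  "'w function_space \<Rightarrow> (('w \<Rightarrow> complex) \<Rightarrow> ('w \<Rightarrow> complex)) \<Rightarrow> bool" where
  "fun_bounded_op E T \<longleftrightarrow>
     (\<forall>f\<in>vecs E. T f \<in> vecs E) \<and>
     (\<forall>f\<in>vecs E. \<forall>g\<in>vecs E. T (\<lambda>x. f x + g x) = (\<lambda>x. T f x + T g x)) \<and>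
     (\<forall>c. \<forall>f\<in>vecs E. T (\<lambda>x. c * f x) = (\<lambda>x. c * T f x)) \<and>
     (\<exists>C. \<forall>f\<in>vecs E. fnorm E (T f) \<le> C * fnorm E f)"

definition adjoint_into ::
  "'w function_space \<Rightarrow> ('h::complex_hilbert \<Rightarrow> ('w \<Rightarrow> complex)) \<Rightarrow> ('w \<Rightarrow> complex) \<Rightarrow> 'h" where
  "adjoint_into E T f = (THE u. \<forall>v. cinner u v = ip E f (T v))"

definition kfun :: "('w \<Rightarrow> 'w \<Rightarrow> complex) \<Rightarrow> 'w \<Rightarrow> ('w \<Rightarrow> complex)" where
  "kfun k y = (\<lambda>x. k x y)"

definition kspan :: "('w \<Rightarrow> 'w \<Rightarrow> complex) \<Rightarrow> ('w \<Rightarrow> complex) set" where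
  "kspan k = {(\<lambda>x. \<Sum>y\<in>Y. c y * kfun k y x) | c Y. finite Y}"

text \<open>
  The second and third conditions say that \<open>k\<close> is the reproducing kernel of \<open>E\<close>; applied to
  \<open>f = kfun k y\<close> they give \<open>ip E (kfun k x) (kfun k y) = k x y\<close>. The last one (a consequence of
  the others) says that \<open>E\<close> is the closed linear span of the kernel functions.
\<close>

definition is_rkhs :: "('w \<Rightarrow> 'w \<Rightarrow> complex) \<Rightarrow> 'w function_space \<Rightarrow> bool" where
  "is_rkhs k E \<longleftrightarrow>
     hilbert_function_space E \<and>
     (\<forall>x. kfun k x \<in> vecs E) \<and>
     (\<forall>x. \<forall>f\<in>vecs E. ip E (kfun k x) f = f x) \<and>
     vecs E = fclosure E (kspan k)"

text \<open>
  For a positive definite kernel such a space exists, and its vectors and the inner product on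
  them are unique; \<open>SOME\<close> merely fixes the irrelevant values of \<open>ip\<close> outside \<open>vecs\<close>.
\<close>

definition rkhs :: "('w \<Rightarrow> 'w \<Rightarrow> complex) \<Rightarrow> 'w function_space" where
  "rkhs k = (SOME E. is_rkhs k E)"

definition scalar_kernel ::
  "('x, 'a::unital_cstar_algebra, 'h::complex_hilbert) op_kernel
     \<Rightarrow> ('x \<times> 'a \<times> 'h) \<Rightarrow> ('x \<times> 'a \<times> 'h) \<Rightarrow> complex" where
  "scalar_kernel L = (\<lambda>(s, a, u) (t, b, v). cinner u (L s t (star a * b) v))"

definition kernel_space ::
  "('x, 'a::unital_cstar_algebra, 'h::complex_hilbert) op_kernel
     \<Rightarrow> ('x \<times> 'a \<times> 'h) function_space" where
  "kernel_space L = rkhs (scalar_kernel L)"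

definition factor_V ::
  "('x, 'a::unital_cstar_algebra, 'h::complex_hilbert) op_kernel
     \<Rightarrow> 'x \<Rightarrow> 'h \<Rightarrow> ('x \<times> 'a \<times> 'h \<Rightarrow> complex)" where
  "factor_V L t v = kfun (scalar_kernel L) (t, 1, v)"

definition factor_V_adj ::
  "('x, 'a::unital_cstar_algebra, 'h::complex_hilbert) op_kernel
     \<Rightarrow> 'x \<Rightarrow> ('x \<times> 'a \<times> 'h \<Rightarrow> complex) \<Rightarrow> 'h" where
  "factor_V_adj L t = adjoint_into (kernel_space L) (factor_V L t)"

text \<open>
  In the next definition and in that of \<open>rn_derivative\<close>, the operator is uniquely determined on
  \<open>vecs (kernel_space L)\<close>; \<open>SOME\<close> merely fixes its irrelevant values elsewhere.
\<close>

definition factor_pi ::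
  "('x, 'a::unital_cstar_algebra, 'h::complex_hilbert) op_kernel
     \<Rightarrow> 'a \<Rightarrow> ('x \<times> 'a \<times> 'h \<Rightarrow> complex) \<Rightarrow> ('x \<times> 'a \<times> 'h \<Rightarrow> complex)" where
  "factor_pi L a = (SOME T. fun_bounded_op (kernel_space L) T \<and>
     (\<forall>t b v. T (kfun (scalar_kernel L) (t, b, v)) = kfun (scalar_kernel L) (t, a * b, v)))"

definition pi_irreducible ::
  "('x, 'a::unital_cstar_algebra, 'h::complex_hilbert) op_kernel \<Rightarrow> bool" where
  "pi_irreducible L \<longleftrightarrow>
     (\<forall>M. M \<subseteq> vecs (kernel_space L) \<and> fun_subspace M \<and> fclosure (kernel_space L) M = M \<and>
          (\<forall>a. \<forall>f\<in>M. factor_pi L a f \<in> M)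
        \<longrightarrow> M = {\<lambda>x. 0} \<or> M = vecs (kernel_space L))"

definition pi_commutant ::
  "('x, 'a::unital_cstar_algebra, 'h::complex_hilbert) op_kernel
     \<Rightarrow> (('x \<times> 'a \<times> 'h \<Rightarrow> complex) \<Rightarrow> ('x \<times> 'a \<times> 'h \<Rightarrow> complex)) set" where
  "pi_commutant L = {A. fun_bounded_op (kernel_space L) A \<and>
     (\<forall>a. \<forall>f\<in>vecs (kernel_space L). A (factor_pi L a f) = factor_pi L a (A f))}"

definition is_rn_derivative ::
  "('x, 'a::unital_cstar_algebra, 'h::complex_hilbert) op_kernel \<Rightarrow> ('x, 'a, 'h) op_kernel
     \<Rightarrow> (('x \<times> 'a \<times> 'h \<Rightarrow> complex) \<Rightarrow> ('x \<times> 'a \<times> 'h \<Rightarrow> complex)) \<Rightarrow> bool" where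
  "is_rn_derivative K L A \<longleftrightarrow>
     A \<in> pi_commutant L \<and>
     (\<forall>f\<in>vecs (kernel_space L). ip (kernel_space L) f (A f) \<in> \<real>\<^sub>\<ge>\<^sub>0) \<and>
     (\<forall>f\<in>vecs (kernel_space L). ip (kernel_space L) f (\<lambda>x. f x - A f x) \<in> \<real>\<^sub>\<ge>\<^sub>0) \<and>
     (\<forall>s t a v. K s t a v = factor_V_adj L s (factor_pi L a (A (factor_V L t v))))"

definition rn_derivative ::
  "('x, 'a::unital_cstar_algebra, 'h::complex_hilbert) op_kernel \<Rightarrow> ('x, 'a, 'h) op_kernel
     \<Rightarrow> ('x \<times> 'a \<times> 'h \<Rightarrow> complex) \<Rightarrow> ('x \<times> 'a \<times> 'h \<Rightarrow> complex)" where
  "rn_derivative K L = (SOME A. is_rn_derivative K L A)"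

end

theory Submission
  imports Defs
begin

text \<open>
  By Moore and Aronszajn \<open>H\<^sub>L\<close> exists, and a function belongs to it as soon as it is bounded
  against finite combinations of kernel functions. Hence \<open>\<pi>(a)\<close> is simply
  \<open>(\<pi>(a) f)(t, b, v) = f(t, a\<^sup>* b, v)\<close>, with \<open>\<parallel>\<pi>(a)\<parallel> \<le> \<parallel>a\<parallel>\<close> by iterating Cauchy-Schwarz on
  \<open>\<parallel>\<pi>(h) f\<parallel>\<^sup>2 \<le> \<parallel>f\<parallel> \<parallel>\<pi>(h\<^sup>2) f\<parallel>\<close> for \<open>h = a\<^sup>* a\<close>. For \<open>K \<le> L\<close> the derivative is
  \<open>(A f)(x) = \<langle>K\<^sub>x, f\<rangle>\<close>; conversely each \<open>A\<close> in the commutant with \<open>0 \<le> A \<le> 1\<close> comes from a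
  kernel below \<open>L\<close>. If all these kernels are multiples of \<open>L\<close>, the projection onto a closed
  invariant subspace is scalar, so \<open>\<pi>\<close> is irreducible. If \<open>\<pi>\<close> is irreducible and \<open>A\<close> is
  self-adjoint in the commutant, let \<open>B\<close> be a multiple of \<open>A - \<lambda>\<close> and \<open>S\<close> the square root of
  \<open>B\<^sup>2\<close>, the limit of an iteration of polynomials in \<open>B\<^sup>2\<close>. The kernel of \<open>S - B\<close> is closed and
  invariant and \<open>(S - B) (S + B) = 0\<close>, so \<open>B = S \<ge> 0\<close> or \<open>B = - S \<le> 0\<close>; as this holds for
  every \<open>\<lambda>\<close>, \<open>A\<close> is scalar.
\<close>

section \<open>Pre-Hilbert spaces of functions\<close>

text \<open>Every Hilbert space here belongs to a kernel, so its vectors are functions and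
  evaluation at a point is pairing with a kernel function. Two consequences shape the proof: norm
  convergence implies pointwise convergence, so that the completion and all limits of operators can
  be written as pointwise limits, and a bounded operator is determined by its values on kernel
  functions. The shift formula for \<open>\<pi>(a)\<close> does not mention \<open>L\<close>. For
  \<open>K \<unlhd> L\<close> the actions on the two spaces therefore agree, and the derivative is
  \<open>J J*\<close> for the contractive inclusion \<open>J\<close> of the space of
  \<open>K\<close> in that of \<open>L\<close>. In the last direction no spectral measure appears.
  What is needed of the square root \<open>S\<close> is that it commutes with whatever commutes with
  \<open>B\<close>: with \<open>\<pi>(a)\<close>, for the invariance of the kernel of
  \<open>S - B\<close>, and with \<open>B\<close> itself, for the factorisation. Scalarity of
  \<open>A\<close> then follows from the supremum \<open>m\<close> of all \<open>\<lambda>\<close>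
  with \<open>\<lambda> \<le> A\<close>, because \<open>A\<close> must lie below
  \<open>m + e\<close> for every positive \<open>e\<close>. The zero space is irreducible by the
  definitions and needs separate treatment wherever a nonzero vector is used.\<close>

lemma nonneg_Reals_limit:
  fixes z :: complex
  assumes "X \<longlonglongrightarrow> z" "\<And>n. X n \<in> \<real>\<^sub>\<ge>\<^sub>0"
  shows "z \<in> \<real>\<^sub>\<ge>\<^sub>0"
  using closed_sequentially[OF closed_nonneg_Reals_complex, of X z] assms by blast

lemma fun_subspace_zero: "fun_subspace M \<Longrightarrow> (\<lambda>x. 0) \<in> M"
  and fun_subspace_add: "fun_subspace M \<Longrightarrow> f \<in> M \<Longrightarrow> g \<in> M \<Longrightarrow> (\<lambda>x. f x + g x) \<in> M"
  and fun_subspace_scale: "fun_subspace M \<Longrightarrow> f \<in> M \<Longrightarrow> (\<lambda>x. c * f x) \<in> M"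
  by (simp_all add: fun_subspace_def)

lemma fun_subspace_diff:
  assumes "fun_subspace M" "f \<in> M" "g \<in> M"
  shows "(\<lambda>x. f x - g x) \<in> M"
  using fun_subspace_add[OF assms(1,2) fun_subspace_scale[OF assms(1,3), of "-1"]] by simp

lemma fun_subspace_sum:
  assumes "fun_subspace M" "\<And>y. y \<in> Y \<Longrightarrow> F y \<in> M"
  shows "(\<lambda>x. \<Sum>y\<in>Y. F y x) \<in> M"
  using assms(2)
proof (induction Y rule: infinite_finite_induct)
  case (insert y Y)
  then show ?case
    using fun_subspace_add[OF assms(1), of "F y" "\<lambda>x. \<Sum>y\<in>Y. F y x"] by simp
qed (simp_all add: fun_subspace_zero[OF assms(1)])

text \<open>Here \<open>0 \<le> F - 2 r \<bar>z\<bar>\<^sup>2 + r\<^sup>2 \<bar>z\<bar>\<^sup>2 G\<close> is the squared norm of \<open>f - r z g\<close> for \<open>z = \<langle>g, f\<rangle>\<close>.\<close>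

lemma Cauchy_Schwarz_quadratic:
  fixes F G y :: real
  assumes "0 \<le> F" "0 \<le> G" and key: "\<And>r. 0 \<le> F - 2 * r * y\<^sup>2 + r\<^sup>2 * y\<^sup>2 * G"
  shows "y\<^sup>2 \<le> F * G"
proof (cases "G = 0")
  case True
  have "y\<^sup>2 \<le> 0"
  proof (rule ccontr)
    assume "\<not> y\<^sup>2 \<le> 0"
    then show False
      \<comment> \<open>For \<open>G = 0\<close> the quadratic is affine in \<open>r\<close>; at
        this \<open>r\<close> its value is - F - 2.\<close>
      using key[of "(F + 1) / y\<^sup>2"] assms True by simp
  qed
  then show ?thesis using assms by (simp add: True)
next
  case False
  then show ?thesis
    \<comment> \<open>The quadratic in \<open>r\<close> is minimal at 1 / G, with value F - y^2 /
      G.\<close>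
    using key[of "1 / G"] assms by (simp add: power2_eq_square field_simps)
qed

text \<open>The common ground of the span of the kernel functions, which in general is not complete,
  of its completion, and of the finished Hilbert space.\<close>

locale prehilbert_fs =
  fixes E :: "'w function_space"
  assumes subspace: "fun_subspace (vecs E)"
    and ip_cnj: "f \<in> vecs E \<Longrightarrow> g \<in> vecs E \<Longrightarrow> ip E f g = cnj (ip E g f)"
    and ip_add_right: "f \<in> vecs E \<Longrightarrow> g \<in> vecs E \<Longrightarrow> h \<in> vecs E \<Longrightarrow>
      ip E f (\<lambda>x. g x + h x) = ip E f g + ip E f h"
    and ip_scale_right: "f \<in> vecs E \<Longrightarrow> g \<in> vecs E \<Longrightarrow> ip E f (\<lambda>x. c * g x) = c * ip E f g"
    and ip_self: "f \<in> vecs E \<Longrightarrow> ip E f f \<in> \<real>\<^sub>\<ge>\<^sub>0"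
begin

lemmas zero_in [simp] = fun_subspace_zero[OF subspace]
lemmas add_in [simp] = fun_subspace_add[OF subspace]
lemmas scale_in [simp] = fun_subspace_scale[OF subspace]
lemmas diff_in [simp] = fun_subspace_diff[OF subspace]
lemmas sum_in = fun_subspace_sum[OF subspace]

lemma ip_diff_right:
  assumes "f \<in> vecs E" "g \<in> vecs E" "h \<in> vecs E"
  shows "ip E f (\<lambda>x. g x - h x) = ip E f g - ip E f h"
  using ip_add_right[OF assms(1,2) scale_in[OF assms(3), of "-1"]]
    ip_scale_right[OF assms(1,3), of "-1"] by simp

lemma ip_zero_right: "f \<in> vecs E \<Longrightarrow> ip E f (\<lambda>x. 0) = 0"
  using ip_scale_right[of f f 0] by simp

lemma ip_sum_right:
  assumes "f \<in> vecs E" "\<And>y. y \<in> Y \<Longrightarrow> F y \<in> vecs E"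
  shows "ip E f (\<lambda>x. \<Sum>y\<in>Y. F y x) = (\<Sum>y\<in>Y. ip E f (F y))"
  using assms(2)
proof (induction Y rule: infinite_finite_induct)
  case (insert y Y)
  have "(\<lambda>x. \<Sum>y\<in>Y. F y x) \<in> vecs E"
    using insert by (intro sum_in) auto
  with insert assms(1) show ?case
    by (simp add: ip_add_right)
qed (simp_all add: ip_zero_right assms(1))

lemma ip_add_left: 
  assumes "f \<in> vecs E" "g \<in> vecs E" "h \<in> vecs E"
  shows "ip E (\<lambda>x. g x + h x) f = ip E g f + ip E h f"
  using assms by (simp add: ip_cnj[of _ f] ip_add_right)

lemma ip_diff_left: 
  assumes "f \<in> vecs E" "g \<in> vecs E" "h \<in> vecs E"
  shows "ip E (\<lambda>x. g x - h x) f = ip E g f - ip E h f"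
  using assms by (simp add: ip_cnj[of _ f] ip_diff_right)

lemma ip_scale_left: 
  assumes "f \<in> vecs E" "g \<in> vecs E"
  shows "ip E (\<lambda>x. c * g x) f = cnj c * ip E g f"
  using assms by (simp add: ip_cnj[of _ f] ip_scale_right)

lemma ip_sum_left:
  assumes "f \<in> vecs E" "\<And>y. y \<in> Y \<Longrightarrow> F y \<in> vecs E"
  shows "ip E (\<lambda>x. \<Sum>y\<in>Y. F y x) f = (\<Sum>y\<in>Y. ip E (F y) f)"
  using assms sum_in[OF assms(2), of Y] by (simp add: ip_cnj[of _ f] ip_sum_right)

lemma fnorm_nonneg: "f \<in> vecs E \<Longrightarrow> 0 \<le> fnorm E f"
  using ip_self[of f] by (simp add: fnorm_def complex_nonneg_Reals_iff)

lemma ip_self_eq: "f \<in> vecs E \<Longrightarrow> ip E f f = complex_of_real ((fnorm E f)\<^sup>2)"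
  using ip_self[of f] by (simp add: fnorm_def complex_nonneg_Reals_iff complex_eq_iff)

lemma fnorm_sq: "f \<in> vecs E \<Longrightarrow> (fnorm E f)\<^sup>2 = Re (ip E f f)"
  by (simp add: ip_self_eq)

lemma fnorm_zero [simp]: "fnorm E (\<lambda>x. 0) = 0"
  by (simp add: fnorm_def ip_zero_right)

lemma fnorm_scale:
  assumes "f \<in> vecs E" shows "fnorm E (\<lambda>x. c * f x) = cmod c * fnorm E f"
proof -
  have "ip E (\<lambda>x. c * f x) (\<lambda>x. c * f x) = complex_of_real ((cmod c)\<^sup>2 * (fnorm E f)\<^sup>2)"
    using assms complex_norm_square[of c]
    by (simp add: ip_scale_left ip_scale_right ip_self_eq mult_ac)
  then show ?thesis
    using fnorm_nonneg[OF assms]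
    by (simp add: fnorm_def[of _ "\<lambda>x. c * f x"] real_sqrt_mult)
qed

lemma Cauchy_Schwarz:
  assumes f: "f \<in> vecs E" and g: "g \<in> vecs E"
  shows "cmod (ip E f g) \<le> fnorm E f * fnorm E g"
proof -
  define z where "z = ip E g f"
  define F G where "F = (fnorm E f)\<^sup>2" and "G = (fnorm E g)\<^sup>2"
  have key: "0 \<le> F - 2 * r * (cmod z)\<^sup>2 + r\<^sup>2 * (cmod z)\<^sup>2 * G" for r :: real
  proof -
    define c where "c = - of_real r * z"
    have 1: "z * cnj z = complex_of_real ((cmod z)\<^sup>2)"
      using complex_norm_square[of z] by simp
    have "ip E (\<lambda>x. f x + c * g x) (\<lambda>x. f x + c * g x)
        = ip E f f + c * ip E f g + cnj c * ip E g f + cnj c * c * ip E g g"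
      using f g by (simp add: ip_add_left ip_add_right ip_scale_left ip_scale_right algebra_simps)
    also have "\<dots> = F - of_real r * (z * cnj z) - of_real r * (z * cnj z)
                    + of_real r * of_real r * (z * cnj z) * G"
      unfolding ip_cnj[OF f g] ip_self_eq[OF f] ip_self_eq[OF g] z_def[symmetric]
      by (simp add: F_def G_def c_def algebra_simps)
    also have "\<dots> = complex_of_real (F - 2 * r * (cmod z)\<^sup>2 + r\<^sup>2 * (cmod z)\<^sup>2 * G)"
      unfolding 1 by (simp add: power2_eq_square algebra_simps)
    finally show ?thesis
      using ip_self[of "\<lambda>x. f x + c * g x"] f g by (simp add: complex_nonneg_Reals_iff)
  qed
  have "(cmod z)\<^sup>2 \<le> F * G"
    using key by (intro Cauchy_Schwarz_quadratic) (simp_all add: F_def G_def)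
  moreover have "cmod z = cmod (ip E f g)"
    using ip_cnj[OF f g] by (simp add: z_def)
  ultimately have "(cmod (ip E f g))\<^sup>2 \<le> (fnorm E f * fnorm E g)\<^sup>2"
    by (simp add: F_def G_def power_mult_distrib)
  then show ?thesis
    by (rule power2_le_imp_le) (simp add: f g fnorm_nonneg)
qed

lemma fnorm_triangle:
  assumes f: "f \<in> vecs E" and g: "g \<in> vecs E"
  shows "fnorm E (\<lambda>x. f x + g x) \<le> fnorm E f + fnorm E g"
proof -
  have "(fnorm E (\<lambda>x. f x + g x))\<^sup>2 = (fnorm E f)\<^sup>2 + (fnorm E g)\<^sup>2 + 2 * Re (ip E f g)"
    using f g ip_cnj[OF f g] by (simp add: fnorm_sq ip_add_left ip_add_right)
  also have "\<dots> \<le> (fnorm E f + fnorm E g)\<^sup>2"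
    using Cauchy_Schwarz[OF f g] abs_Re_le_cmod[of "ip E f g"]
    by (simp add: power2_sum)
  finally show ?thesis
    by (rule power2_le_imp_le) (simp add: f g fnorm_nonneg)
qed

lemma fnorm_minus_commute:
  assumes f: "f \<in> vecs E" and g: "g \<in> vecs E"
  shows "fnorm E (\<lambda>x. f x - g x) = fnorm E (\<lambda>x. g x - f x)"
  using fnorm_scale[of "\<lambda>x. f x - g x" "-1"] f g by simp

lemma fdist_commute: "f \<in> vecs E \<Longrightarrow> g \<in> vecs E \<Longrightarrow> fdist E f g = fdist E g f"
  unfolding fdist_def by (rule fnorm_minus_commute)

lemma fdist_nonneg: "f \<in> vecs E \<Longrightarrow> g \<in> vecs E \<Longrightarrow> 0 \<le> fdist E f g"
  by (simp add: fdist_def fnorm_nonneg)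

lemma fdist_triangle:
  assumes "f \<in> vecs E" "g \<in> vecs E" "h \<in> vecs E"
  shows "fdist E f h \<le> fdist E f g + fdist E g h"
  using fnorm_triangle[of "\<lambda>x. f x - g x" "\<lambda>x. g x - h x"] assms by (simp add: fdist_def)

lemma fnorm_diff_le:
  assumes "f \<in> vecs E" "g \<in> vecs E"
  shows "\<bar>fnorm E f - fnorm E g\<bar> \<le> fdist E f g"
  using fdist_triangle[of f g "\<lambda>x. 0"] fdist_triangle[of g f "\<lambda>x. 0"] fdist_commute[of f g] assms
  by (simp add: fdist_def)

lemma fnorm_sum:
  assumes "\<And>y. y \<in> Y \<Longrightarrow> F y \<in> vecs E"
  shows "fnorm E (\<lambda>x. \<Sum>y\<in>Y. F y x) \<le> (\<Sum>y\<in>Y. fnorm E (F y))"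
  using assms
proof (induction Y rule: infinite_finite_induct)
  case (insert y Y)
  have "(\<lambda>x. \<Sum>y\<in>Y. F y x) \<in> vecs E"
    using insert by (intro sum_in) auto
  with insert show ?case
    using fnorm_triangle[of "F y" "\<lambda>x. \<Sum>y\<in>Y. F y x"] by auto
qed simp_all

lemma parallelogram:
  assumes f: "f \<in> vecs E" and g: "g \<in> vecs E"
  shows "(fdist E f g)\<^sup>2 + (fnorm E (\<lambda>x. f x + g x))\<^sup>2 = 2 * (fnorm E f)\<^sup>2 + 2 * (fnorm E g)\<^sup>2"
  using f g by (simp add: fdist_def fnorm_sq ip_add_left ip_add_right ip_diff_left ip_diff_right)

lemma tendsto_ip:
  assumes F: "\<And>n. F n \<in> vecs E" and f: "f \<in> vecs E" and Ff: "(\<lambda>n. fdist E (F n) f) \<longlonglongrightarrow> 0"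
    and G: "\<And>n. G n \<in> vecs E" and g: "g \<in> vecs E" and Gg: "(\<lambda>n. fdist E (G n) g) \<longlonglongrightarrow> 0"
  shows "(\<lambda>n. ip E (F n) (G n)) \<longlonglongrightarrow> ip E f g"
proof -
  have "(\<lambda>n. ip E (F n) (G n) - ip E f g) \<longlonglongrightarrow> 0"
  proof (rule Lim_null_comparison)
    have "norm (ip E (F n) (G n) - ip E f g)
        \<le> fdist E (F n) f * (fdist E (G n) g + fnorm E g) + fnorm E f * fdist E (G n) g" for n
    proof -
      have 1: "ip E (F n) (G n) - ip E f g
        = ip E (\<lambda>x. F n x - f x) (G n) + ip E f (\<lambda>x. G n x - g x)"
        using F G f g by (simp add: ip_diff_left ip_diff_right)
      have 2: "fnorm E (G n) \<le> fdist E (G n) g + fnorm E g"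
        using fnorm_diff_le[OF G g, of n] by linarith
      have "norm (ip E (\<lambda>x. F n x - f x) (G n)) \<le> fdist E (F n) f * fnorm E (G n)"
        using Cauchy_Schwarz[of "\<lambda>x. F n x - f x" "G n"] F G f by (simp add: fdist_def)
      also have "\<dots> \<le> fdist E (F n) f * (fdist E (G n) g + fnorm E g)"
        using 2 fdist_nonneg[OF F f] by (rule mult_left_mono)
      finally show ?thesis
        unfolding 1 using Cauchy_Schwarz[of f "\<lambda>x. G n x - g x"] G f g
        by (intro order_trans[OF norm_triangle_ineq] add_mono) (simp_all add: fdist_def)
    qed
    then show "\<forall>\<^sub>F n in sequentially. norm (ip E (F n) (G n) - ip E f g)
        \<le> fdist E (F n) f * (fdist E (G n) g + fnorm E g) + fnorm E f * fdist E (G n) g"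
      by simp
    show "(\<lambda>n. fdist E (F n) f * (fdist E (G n) g + fnorm E g) + fnorm E f * fdist E (G n) g)
        \<longlonglongrightarrow> 0"
      by (rule tendsto_eq_intros Ff Gg refl)+ simp
  qed
  then show ?thesis by (simp add: LIM_zero_iff)
qed

lemma fdist_refl [simp]: "fdist E f f = 0"
  by (simp add: fdist_def)

lemma tendsto_fnorm:
  assumes F: "\<And>n. F n \<in> vecs E" and f: "f \<in> vecs E" and Ff: "(\<lambda>n. fdist E (F n) f) \<longlonglongrightarrow> 0"
  shows "(\<lambda>n. fnorm E (F n)) \<longlonglongrightarrow> fnorm E f"
  unfolding fnorm_def using tendsto_ip[OF F f Ff F f Ff]
  by (intro tendsto_intros)

lemma fconv_add:
  assumes F: "\<And>n. F n \<in> vecs E" and f: "f \<in> vecs E" and Ff: "(\<lambda>n. fdist E (F n) f) \<longlonglongrightarrow> 0"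
    and G: "\<And>n. G n \<in> vecs E" and g: "g \<in> vecs E" and Gg: "(\<lambda>n. fdist E (G n) g) \<longlonglongrightarrow> 0"
  shows "(\<lambda>n. fdist E (\<lambda>x. F n x + G n x) (\<lambda>x. f x + g x)) \<longlonglongrightarrow> 0"
proof (rule Lim_null_comparison)
  have "fdist E (\<lambda>x. F n x + G n x) (\<lambda>x. f x + g x) \<le> fdist E (F n) f + fdist E (G n) g" for n
    using fnorm_triangle[of "\<lambda>x. F n x - f x" "\<lambda>x. G n x - g x"] F f G g
    by (simp add: fdist_def algebra_simps)
  then show "\<forall>\<^sub>F n in sequentially. norm (fdist E (\<lambda>x. F n x + G n x) (\<lambda>x. f x + g x))
      \<le> fdist E (F n) f + fdist E (G n) g"
    using F f G g by (simp add: fdist_nonneg)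
  show "(\<lambda>n. fdist E (F n) f + fdist E (G n) g) \<longlonglongrightarrow> 0"
    by (rule tendsto_eq_intros Ff Gg refl)+ simp
qed

lemma fconv_scale:
  assumes F: "\<And>n. F n \<in> vecs E" and f: "f \<in> vecs E" and Ff: "(\<lambda>n. fdist E (F n) f) \<longlonglongrightarrow> 0"
  shows "(\<lambda>n. fdist E (\<lambda>x. c * F n x) (\<lambda>x. c * f x)) \<longlonglongrightarrow> 0"
proof -
  have "fdist E (\<lambda>x. c * F n x) (\<lambda>x. c * f x) = cmod c * fdist E (F n) f" for n
    using fnorm_scale[of "\<lambda>x. F n x - f x" c] F f by (simp add: fdist_def algebra_simps)
  then show ?thesis
    using Ff by (simp add: tendsto_mult_right_zero)
qed

end

section \<open>Cauchy sequences of functions\<close>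

definition fcauchy :: "'w function_space \<Rightarrow> (nat \<Rightarrow> 'w \<Rightarrow> complex) \<Rightarrow> bool" where
  "fcauchy E F \<longleftrightarrow> (\<forall>e>0. \<exists>N. \<forall>m\<ge>N. \<forall>n\<ge>N. fdist E (F m) (F n) < e)"

context prehilbert_fs
begin

lemma fcauchy_const: "fcauchy E (\<lambda>_. f)"
  by (simp add: fcauchy_def)

lemma fcauchy_bounded:
  assumes F: "\<And>n. F n \<in> vecs E" and "fcauchy E F"
  obtains C where "C > 0" "\<And>n. fnorm E (F n) \<le> C"
proof -
  obtain N where N: "\<And>m n. m \<ge> N \<Longrightarrow> n \<ge> N \<Longrightarrow> fdist E (F m) (F n) < 1"
    using assms(2) unfolding fcauchy_def by (meson zero_less_one)
  define C where "C = Max ((\<lambda>n. fnorm E (F n)) ` {..N}) + 1"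
  have le: "fnorm E (F n) \<le> C - 1" if "n \<le> N" for n
    using that by (auto simp: C_def intro!: Max_ge)
  have "fnorm E (F n) \<le> C" for n
  proof (cases "n \<le> N")
    case True
    then show ?thesis using le[of n] by simp
  next
    case False
    then show ?thesis
      using fnorm_diff_le[OF F F, of n N] N[of n N] le[of N] by simp
  qed
  moreover have "C > 0"
    using le[of N] fnorm_nonneg[OF F, of N] by linarith
  ultimately show ?thesis using that by blast
qed

lemma fcauchy_add:
  assumes F: "\<And>n. F n \<in> vecs E" "fcauchy E F" and G: "\<And>n. G n \<in> vecs E" "fcauchy E G"
  shows "fcauchy E (\<lambda>n x. F n x + G n x)"
  unfolding fcauchy_def
proof (intro allI impI)
  fix e :: real assume "e > 0"
  then obtain N1 N2 where
    N: "\<And>m n. m \<ge> N1 \<Longrightarrow> n \<ge> N1 \<Longrightarrow> fdist E (F m) (F n) < e / 2"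
       "\<And>m n. m \<ge> N2 \<Longrightarrow> n \<ge> N2 \<Longrightarrow> fdist E (G m) (G n) < e / 2"
    using F(2) G(2) unfolding fcauchy_def by (meson half_gt_zero)
  have "fdist E (\<lambda>x. F m x + G m x) (\<lambda>x. F n x + G n x) < e" if "m \<ge> max N1 N2" "n \<ge> max N1 N2" for m n
    using fnorm_triangle[of "\<lambda>x. F m x - F n x" "\<lambda>x. G m x - G n x"] F(1) G(1)
      N(1)[of m n] N(2)[of m n] that
    by (simp add: fdist_def algebra_simps)
  then show "\<exists>N. \<forall>m\<ge>N. \<forall>n\<ge>N. fdist E (\<lambda>x. F m x + G m x) (\<lambda>x. F n x + G n x) < e"
    by blast
qed

lemma fcauchy_scale:
  assumes F: "\<And>n. F n \<in> vecs E" "fcauchy E F"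
  shows "fcauchy E (\<lambda>n x. c * F n x)"
  unfolding fcauchy_def
proof (intro allI impI)
  fix e :: real assume "e > 0"
  \<comment> \<open>The summand 1 covers \<open>c = 0\<close>.\<close>
  then have "e / (cmod c + 1) > 0"
    by (simp add: add_nonneg_pos)
  then obtain N where
    N: "\<And>m n. m \<ge> N \<Longrightarrow> n \<ge> N \<Longrightarrow> fdist E (F m) (F n) < e / (cmod c + 1)"
    using F(2) unfolding fcauchy_def by meson
  have "fdist E (\<lambda>x. c * F m x) (\<lambda>x. c * F n x) < e" if "m \<ge> N" "n \<ge> N" for m n
  proof -
    have "fdist E (\<lambda>x. c * F m x) (\<lambda>x. c * F n x) = cmod c * fdist E (F m) (F n)"
      using fnorm_scale[of "\<lambda>x. F m x - F n x" c] F(1) by (simp add: fdist_def algebra_simps)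
    also have "\<dots> \<le> (cmod c + 1) * fdist E (F m) (F n)"
      using F(1) by (intro mult_right_mono) (auto simp: fdist_nonneg)
    also have "\<dots> < (cmod c + 1) * (e / (cmod c + 1))"
      using N[OF that] by (intro mult_strict_left_mono) (auto simp: add_nonneg_pos)
    also have "\<dots> = e"
      using add_nonneg_pos[OF norm_ge_zero[of c] zero_less_one] by simp
    finally show ?thesis .
  qed
  then show "\<exists>N. \<forall>m\<ge>N. \<forall>n\<ge>N. fdist E (\<lambda>x. c * F m x) (\<lambda>x. c * F n x) < e"
    by blast
qed

text \<open>Neither sequence is assumed to have a limit in the space; this is what allows the inner
  product of the completion to be defined as a limit.\<close>

lemma fcauchy_ip_convergent:
  assumes F: "\<And>n. F n \<in> vecs E" "fcauchy E F" and G: "\<And>n. G n \<in> vecs E" "fcauchy E G"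
  shows "convergent (\<lambda>n. ip E (F n) (G n))"
proof -
  obtain C1 C2 where C1: "C1 > 0" "\<And>n. fnorm E (F n) \<le> C1" and C2: "C2 > 0" "\<And>n. fnorm E (G n) \<le> C2"
    using fcauchy_bounded[OF F] fcauchy_bounded[OF G] by metis
  have "Cauchy (\<lambda>n. ip E (F n) (G n))"
    unfolding Cauchy_def
  proof (intro allI impI)
    fix e :: real assume "e > 0"
    then have "e / (2 * C1) > 0" "e / (2 * C2) > 0"
      using C1 C2 by auto
    then obtain N1 N2 where
      N: "\<And>m n. m \<ge> N1 \<Longrightarrow> n \<ge> N1 \<Longrightarrow> fdist E (F m) (F n) < e / (2 * C2)"
         "\<And>m n. m \<ge> N2 \<Longrightarrow> n \<ge> N2 \<Longrightarrow> fdist E (G m) (G n) < e / (2 * C1)"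
      using F(2) G(2) unfolding fcauchy_def by meson
    have "dist (ip E (F m) (G m)) (ip E (F n) (G n)) < e" if mn: "m \<ge> max N1 N2" "n \<ge> max N1 N2" for m n
    proof -
      have 1: "ip E (F m) (G m) - ip E (F n) (G n)
        = ip E (\<lambda>x. F m x - F n x) (G m) + ip E (F n) (\<lambda>x. G m x - G n x)"
        using F(1) G(1) by (simp add: ip_diff_left ip_diff_right)
      have "cmod (ip E (\<lambda>x. F m x - F n x) (G m)) \<le> fdist E (F m) (F n) * fnorm E (G m)"
        using Cauchy_Schwarz[of "\<lambda>x. F m x - F n x" "G m"] F(1) G(1) by (simp add: fdist_def)
      also have "\<dots> \<le> fdist E (F m) (F n) * C2"
        using C2 F(1) by (intro mult_left_mono) (auto simp: fdist_nonneg)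
      also have "\<dots> < e / (2 * C2) * C2"
        using N(1)[of m n] mn C2 by (intro mult_strict_right_mono) auto
      finally have 2: "cmod (ip E (\<lambda>x. F m x - F n x) (G m)) < e / 2"
        using C2 by simp
      have "cmod (ip E (F n) (\<lambda>x. G m x - G n x)) \<le> fnorm E (F n) * fdist E (G m) (G n)"
        using Cauchy_Schwarz[of "F n" "\<lambda>x. G m x - G n x"] F(1) G(1) by (simp add: fdist_def)
      also have "\<dots> \<le> C1 * fdist E (G m) (G n)"
        using C1 G(1) by (intro mult_right_mono) (auto simp: fdist_nonneg)
      also have "\<dots> < C1 * (e / (2 * C1))"
        using N(2)[of m n] mn C1 by (intro mult_strict_left_mono) auto
      finally have 3: "cmod (ip E (F n) (\<lambda>x. G m x - G n x)) < e / 2"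
        using C1 by simp
      show ?thesis
        unfolding dist_norm 1
        using norm_triangle_ineq[of "ip E (\<lambda>x. F m x - F n x) (G m)" "ip E (F n) (\<lambda>x. G m x - G n x)"] 2 3
        by linarith
    qed
    then show "\<exists>M. \<forall>m\<ge>M. \<forall>n\<ge>M. dist (ip E (F m) (G m)) (ip E (F n) (G n)) < e"
      by blast
  qed
  then show ?thesis
    by (simp add: Cauchy_convergent)
qed

end

section \<open>The Moore-Aronszajn theorem\<close>

text \<open>Polarisation: the first assumption compares imaginary parts, the second real parts. It
  turns reality of a quadratic form at f + g and at f + i g into symmetry of the form.\<close>

lemma complex_hermitian_pair:
  fixes p q :: complex
  assumes "p + q \<in> \<real>" "\<i> * p - \<i> * q \<in> \<real>"
  shows "p = cnj q"
  using assms by (simp add: complex_is_Real_iff complex_eq_iff)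

definition psd_kernel :: "('w \<Rightarrow> 'w \<Rightarrow> complex) \<Rightarrow> bool" where
  "psd_kernel k \<longleftrightarrow> (\<forall>c Y. finite Y \<longrightarrow> (\<Sum>y\<in>Y. \<Sum>z\<in>Y. cnj (c y) * c z * k y z) \<in> \<real>\<^sub>\<ge>\<^sub>0)"

lemma psd_kernel_hermitian:
  assumes "psd_kernel k"
  shows "k x y = cnj (k y x)"
proof -
  have real: "(\<Sum>y\<in>Y. \<Sum>z\<in>Y. cnj (c y) * c z * k y z) \<in> \<real>" if "finite Y" for c Y
    using assms that nonneg_Reals_subset_Reals unfolding psd_kernel_def by blast
  have d: "k x x \<in> \<real>" for x
    using real[of "{x}" "\<lambda>_. 1"] by simp
  show ?thesis
  proof (cases "x = y")
    case True
    then show ?thesis using d[of y] by (simp add: Reals_cnj_iff)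
  next
    case False
    show ?thesis
    proof (rule complex_hermitian_pair)
      have "(k x y + k y x) + (k x x + k y y) \<in> \<real>"
        using real[of "{x, y}" "\<lambda>_. 1"] False by (simp add: algebra_simps)
      from Reals_diff[OF this Reals_add[OF d[of x] d[of y]]]
      show "k x y + k y x \<in> \<real>" by simp
      have "(\<i> * k x y - \<i> * k y x) + (k x x + k y y) \<in> \<real>"
        \<comment> \<open>The coefficients 1 at \<open>x\<close> and i at \<open>y\<close> make the
          off-diagonal part of the sum equal to i k(x, y) - i k(y, x).\<close>
        using real[of "{x, y}" "\<lambda>z. if z = x then 1 else \<i>"] False by (simp add: algebra_simps)
      from Reals_diff[OF this Reals_add[OF d[of x] d[of y]]]
      show "\<i> * k x y - \<i> * k y x \<in> \<real>" by simp
    qed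
  qed
qed

lemma kspanE:
  assumes "f \<in> kspan k"
  obtains c Y where "finite Y" "f = (\<lambda>x. \<Sum>y\<in>Y. c y * k x y)"
  using assms by (auto simp: kspan_def kfun_def)

lemma kspanI: "finite Y \<Longrightarrow> (\<lambda>x. \<Sum>y\<in>Y. c y * k x y) \<in> kspan k"
  by (auto simp: kspan_def kfun_def)

lemma kspanE2:
  assumes "f \<in> kspan k" "g \<in> kspan k"
  obtains c d Y where "finite Y" "f = (\<lambda>x. \<Sum>y\<in>Y. c y * k x y)" "g = (\<lambda>x. \<Sum>y\<in>Y. d y * k x y)"
proof -
  obtain c Y where f: "finite Y" "f = (\<lambda>x. \<Sum>y\<in>Y. c y * k x y)"
    using assms(1) by (rule kspanE)
  obtain d Z where g: "finite Z" "g = (\<lambda>x. \<Sum>y\<in>Z. d y * k x y)"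
    using assms(2) by (rule kspanE)
  have "f = (\<lambda>x. \<Sum>y\<in>Y \<union> Z. (if y \<in> Y then c y else 0) * k x y)"
    unfolding f(2) using f(1) g(1) by (intro ext sum.mono_neutral_cong_left) auto
  moreover have "g = (\<lambda>x. \<Sum>y\<in>Y \<union> Z. (if y \<in> Z then d y else 0) * k x y)"
    unfolding g(2) using f(1) g(1) by (intro ext sum.mono_neutral_cong_left) auto
  ultimately show ?thesis
    by (rule that[OF finite_UnI[OF f(1) g(1)]])
qed

lemma kfun_in_kspan: "kfun k y \<in> kspan k"
  using kspanI[of "{y}" "\<lambda>_. 1" k] by (simp add: kfun_def)

lemma fun_subspace_kspan: "fun_subspace (kspan k)"
  unfolding fun_subspace_def
proof (intro conjI ballI allI)
  show "(\<lambda>x. 0) \<in> kspan k"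
    using kspanI[of "{}"] by simp
next
  fix f g assume "f \<in> kspan k" "g \<in> kspan k"
  then obtain c d Y where "finite Y" "f = (\<lambda>x. \<Sum>y\<in>Y. c y * k x y)" "g = (\<lambda>x. \<Sum>y\<in>Y. d y * k x y)"
    by (rule kspanE2)
  then show "(\<lambda>x. f x + g x) \<in> kspan k"
    using kspanI[of Y "\<lambda>y. c y + d y" k] by (simp add: sum.distrib algebra_simps)
next
  fix c f assume "f \<in> kspan k"
  then obtain d Y where "finite Y" "f = (\<lambda>x. \<Sum>y\<in>Y. d y * k x y)"
    by (rule kspanE)
  then show "(\<lambda>x. c * f x) \<in> kspan k"
    using kspanI[of Y "\<lambda>y. c * d y" k] by (simp add: sum_distrib_left algebra_simps)
qed

text \<open>If f is a combination of kernel functions, the reproducing property forces <f, g> to be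
  this sum of values of \<open>g\<close>. The coefficients of \<open>f\<close> are not unique, so
  one choice is made here; \<open>kspan_ip_eq\<close> shows that every choice gives the same
  value.\<close>

definition kspan_ip ::
  "('w \<Rightarrow> 'w \<Rightarrow> complex) \<Rightarrow> ('w \<Rightarrow> complex) \<Rightarrow> ('w \<Rightarrow> complex) \<Rightarrow> complex" where
  "kspan_ip k f g = (SOME z. \<exists>c Y. finite Y \<and> f = (\<lambda>x. \<Sum>y\<in>Y. c y * k x y) \<and>
     z = (\<Sum>y\<in>Y. cnj (c y) * g y))"

definition kspan_space :: "('w \<Rightarrow> 'w \<Rightarrow> complex) \<Rightarrow> 'w function_space" where
  "kspan_space k = \<lparr>vecs = kspan k, ip = kspan_ip k\<rparr>"

lemma vecs_kspan_space [simp]: "vecs (kspan_space k) = kspan k"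
  by (simp add: kspan_space_def)

locale psd_kernel_fs =
  fixes k :: "'w \<Rightarrow> 'w \<Rightarrow> complex"
  assumes psd: "psd_kernel k"
begin

lemma hermitian: "k x y = cnj (k y x)"
  using psd by (rule psd_kernel_hermitian)

text \<open>The left side does not mention \<open>d\<close> and the right side does not mention
  \<open>c\<close>. Hence the common value depends on the functions \<open>f\<close> and
  \<open>g\<close> alone, which makes \<open>kspan_ip\<close> well defined and hermitian.\<close>

lemma pairing_swap:
  assumes "f = (\<lambda>x. \<Sum>y\<in>Y. c y * k x y)" "g = (\<lambda>x. \<Sum>z\<in>Z. d z * k x z)"
  shows "(\<Sum>y\<in>Y. cnj (c y) * g y) = (\<Sum>z\<in>Z. d z * cnj (f z))"
proof -
  have "(\<Sum>y\<in>Y. cnj (c y) * g y) = (\<Sum>y\<in>Y. \<Sum>z\<in>Z. d z * (cnj (c y) * k y z))"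
    by (simp add: assms(2) sum_distrib_left algebra_simps)
  also have "\<dots> = (\<Sum>z\<in>Z. \<Sum>y\<in>Y. d z * (cnj (c y) * k y z))"
    by (rule sum.swap)
  also have "\<dots> = (\<Sum>z\<in>Z. d z * cnj (f z))"
    by (simp add: assms(1) sum_distrib_left hermitian[symmetric])
  finally show ?thesis .
qed

lemma kspan_ip_eq:
  assumes "finite Y" "f = (\<lambda>x. \<Sum>y\<in>Y. c y * k x y)" "g \<in> kspan k"
  shows "kspan_ip k f g = (\<Sum>y\<in>Y. cnj (c y) * g y)"
proof -
  obtain d Z where g: "g = (\<lambda>x. \<Sum>y\<in>Z. d y * k x y)"
    using assms(3) by (rule kspanE)
  have "\<exists>c Y. finite Y \<and> f = (\<lambda>x. \<Sum>y\<in>Y. c y * k x y) \<and>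
     kspan_ip k f g = (\<Sum>y\<in>Y. cnj (c y) * g y)"
    unfolding kspan_ip_def by (rule someI_ex) (use assms(1,2) in blast)
  then show ?thesis
    using pairing_swap[OF assms(2) g] pairing_swap[OF _ g] by metis
qed

lemma prehilbert_kspan: "prehilbert_fs (kspan_space k)"
proof
  show "fun_subspace (vecs (kspan_space k))"
    by (simp add: fun_subspace_kspan)
next
  fix f g assume "f \<in> vecs (kspan_space k)" "g \<in> vecs (kspan_space k)"
  then have f: "f \<in> kspan k" and g: "g \<in> kspan k" by simp_all
  obtain c Y where cY: "finite Y" "f = (\<lambda>x. \<Sum>y\<in>Y. c y * k x y)"
    using f by (rule kspanE)
  obtain d Z where dZ: "finite Z" "g = (\<lambda>x. \<Sum>y\<in>Z. d y * k x y)"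
    using g by (rule kspanE)
  show "ip (kspan_space k) f g = cnj (ip (kspan_space k) g f)"
    using pairing_swap[OF cY(2) dZ(2)] 
    by (simp add: kspan_space_def kspan_ip_eq[OF cY g] kspan_ip_eq[OF dZ f])
next
  fix f g h assume "f \<in> vecs (kspan_space k)" "g \<in> vecs (kspan_space k)" "h \<in> vecs (kspan_space k)"
  then have f: "f \<in> kspan k" and g: "g \<in> kspan k" "h \<in> kspan k" by simp_all
  obtain c Y where cY: "finite Y" "f = (\<lambda>x. \<Sum>y\<in>Y. c y * k x y)"
    using f by (rule kspanE)
  show "ip (kspan_space k) f (\<lambda>x. g x + h x) = ip (kspan_space k) f g + ip (kspan_space k) f h"
    using g
    by (simp add: kspan_space_def kspan_ip_eq[OF cY] fun_subspace_add[OF fun_subspace_kspan]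
         sum.distrib algebra_simps)
next
  fix c f g assume "f \<in> vecs (kspan_space k)" "g \<in> vecs (kspan_space k)"
  then have f: "f \<in> kspan k" and g: "g \<in> kspan k" by simp_all
  obtain d Y where cY: "finite Y" "f = (\<lambda>x. \<Sum>y\<in>Y. d y * k x y)"
    using f by (rule kspanE)
  show "ip (kspan_space k) f (\<lambda>x. c * g x) = c * ip (kspan_space k) f g"
    using g
    by (simp add: kspan_space_def kspan_ip_eq[OF cY] fun_subspace_scale[OF fun_subspace_kspan]
         sum_distrib_left algebra_simps)
next
  fix f assume "f \<in> vecs (kspan_space k)"
  then have f: "f \<in> kspan k" by simp
  then obtain c Y where cY: "finite Y" "f = (\<lambda>x. \<Sum>y\<in>Y. c y * k x y)"
    by (rule kspanE)
  have "ip (kspan_space k) f f = (\<Sum>y\<in>Y. \<Sum>z\<in>Y. cnj (c y) * c z * k y z)"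
    using kspan_ip_eq[OF cY f]
    by (simp add: kspan_space_def cY(2) sum_distrib_left algebra_simps)
  then show "ip (kspan_space k) f f \<in> \<real>\<^sub>\<ge>\<^sub>0"
    using psd cY(1) by (simp add: psd_kernel_def)
qed

sublocale E0: prehilbert_fs "kspan_space k"
  by (rule prehilbert_kspan)

lemma kspan_space_ip_eq:
  assumes "finite Y" "f = (\<lambda>x. \<Sum>y\<in>Y. c y * k x y)" "g \<in> kspan k"
  shows "ip (kspan_space k) f g = (\<Sum>y\<in>Y. cnj (c y) * g y)"
  using kspan_ip_eq[OF assms] by (simp add: kspan_space_def)

lemma kspan_space_reproducing: "f \<in> kspan k \<Longrightarrow> ip (kspan_space k) (kfun k x) f = f x"
  using kspan_space_ip_eq[of "{x}" "kfun k x" "\<lambda>_. 1" f] by (simp add: kfun_def)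

text \<open>The completion consists of functions instead of classes of Cauchy sequences: a vector is
  the pointwise limit of a norm-Cauchy sequence of the span. That sequences with the same pointwise
  limit are equivalent is the content of \<open>kapprox_null\<close>.\<close>

definition kapprox :: "(nat \<Rightarrow> 'w \<Rightarrow> complex) \<Rightarrow> ('w \<Rightarrow> complex) \<Rightarrow> bool" where
  "kapprox F f \<longleftrightarrow> (\<forall>n. F n \<in> kspan k) \<and> fcauchy (kspan_space k) F \<and> (\<forall>x. (\<lambda>n. F n x) \<longlonglongrightarrow> f x)"

lemma kapprox_const: "f \<in> kspan k \<Longrightarrow> kapprox (\<lambda>_. f) f"
  by (simp add: kapprox_def E0.fcauchy_const)

lemma kapprox_add: "kapprox F f \<Longrightarrow> kapprox G g \<Longrightarrow> kapprox (\<lambda>n x. F n x + G n x) (\<lambda>x. f x + g x)"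
  using E0.fcauchy_add[of F G]
  by (auto simp: kapprox_def fun_subspace_add[OF fun_subspace_kspan] intro!: tendsto_add)

lemma kapprox_scale: "kapprox F f \<Longrightarrow> kapprox (\<lambda>n x. c * F n x) (\<lambda>x. c * f x)"
  using E0.fcauchy_scale[of F c]
  by (auto simp: kapprox_def fun_subspace_scale[OF fun_subspace_kspan] intro!: tendsto_mult)

lemma kapprox_diff: "kapprox F f \<Longrightarrow> kapprox G g \<Longrightarrow> kapprox (\<lambda>n x. F n x - G n x) (\<lambda>x. f x - g x)"
  using kapprox_add[of F f "\<lambda>n x. -1 * G n x" "\<lambda>x. - 1 * g x"] kapprox_scale[of G g "-1"] by simp

lemma kapprox_convergent:
  "kapprox F f \<Longrightarrow> kapprox G g \<Longrightarrow> convergent (\<lambda>n. ip (kspan_space k) (F n) (G n))"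
  by (rule E0.fcauchy_ip_convergent) (auto simp: kapprox_def)

text \<open>The key point is that pairing with a fixed element of the span only involves finitely many
  values of a function.\<close>

lemma kapprox_null:
  assumes H: "kapprox H (\<lambda>x. 0)"
  shows "(\<lambda>n. fnorm (kspan_space k) (H n)) \<longlonglongrightarrow> 0"
proof -
  let ?E = "kspan_space k"
  have Hin: "\<And>n. H n \<in> vecs ?E" and Hc: "fcauchy ?E H" and Hx: "\<And>x. (\<lambda>n. H n x) \<longlonglongrightarrow> 0"
    using H by (auto simp: kapprox_def)
  obtain L where L: "(\<lambda>n. ip ?E (H n) (H n)) \<longlonglongrightarrow> L"
    using kapprox_convergent[OF H H] by (auto simp: convergent_def)
  obtain C where C: "C > 0" "\<And>n. fnorm ?E (H n) \<le> C"
    using E0.fcauchy_bounded[OF Hin Hc] by metis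
  have null: "(\<lambda>n. ip ?E (H m) (H n)) \<longlonglongrightarrow> 0" for m
  proof -
    obtain c Y where cY: "finite Y" "H m = (\<lambda>x. \<Sum>y\<in>Y. c y * k x y)"
      using Hin[of m] by (auto elim: kspanE)
    have "(\<lambda>n. \<Sum>y\<in>Y. cnj (c y) * H n y) \<longlonglongrightarrow> (\<Sum>y\<in>Y. cnj (c y) * 0)"
      by (intro tendsto_intros Hx)
    then show ?thesis
      using Hin by (simp add: kspan_space_ip_eq[OF cY])
  qed
  \<comment> \<open>Write <H n, H n> as <H N, H n> + <H n - H N, H n> with \<open>N\<close> fixed.
    The first summand tends to 0 by \<open>null\<close>, the second is at most (e / C) * C.\<close>
  have bound: "cmod L \<le> e" if "e > 0" for e
  proof -
    have "e / C > 0" using that C by simp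
    then obtain N where N: "\<And>m n. m \<ge> N \<Longrightarrow> n \<ge> N \<Longrightarrow> fdist ?E (H m) (H n) < e / C"
      using Hc unfolding fcauchy_def by meson
    have "cmod (ip ?E (H n) (H n)) \<le> cmod (ip ?E (H N) (H n)) + e" if n: "n \<ge> N" for n
    proof -
      have "ip ?E (H n) (H n) = ip ?E (H N) (H n) + ip ?E (\<lambda>x. H n x - H N x) (H n)"
        using Hin by (simp only: E0.ip_diff_left) simp
      moreover have "cmod (ip ?E (\<lambda>x. H n x - H N x) (H n)) \<le> fdist ?E (H n) (H N) * fnorm ?E (H n)"
        using E0.Cauchy_Schwarz[of "\<lambda>x. H n x - H N x" "H n"] Hin E0.diff_in[OF Hin Hin, of n N]
        by (simp add: fdist_def)
      moreover have "fdist ?E (H n) (H N) * fnorm ?E (H n) \<le> (e / C) * C"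
        using N[OF n order_refl] C E0.fnorm_nonneg[OF Hin] \<open>e / C > 0\<close>
        by (intro mult_mono) auto
      ultimately show ?thesis
        using norm_triangle_ineq[of "ip ?E (H N) (H n)" "ip ?E (\<lambda>x. H n x - H N x) (H n)"] C(1)
        by simp
    qed
    then have "\<exists>N. \<forall>n\<ge>N. cmod (ip ?E (H n) (H n)) \<le> cmod (ip ?E (H N) (H n)) + e"
      by blast
    then obtain N where "\<forall>n\<ge>N. cmod (ip ?E (H n) (H n)) \<le> cmod (ip ?E (H N) (H n)) + e" ..
    moreover have "(\<lambda>n. cmod (ip ?E (H N) (H n)) + e) \<longlonglongrightarrow> cmod 0 + e"
      by (intro tendsto_intros null)
    ultimately show ?thesis
      using LIMSEQ_le[OF tendsto_norm[OF L], of _ "cmod 0 + e"] by auto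
  qed
  have "L = 0"
    using bound field_le_epsilon[of "cmod L" 0] by simp
  then have "(\<lambda>n. sqrt (Re (ip ?E (H n) (H n)))) \<longlonglongrightarrow> sqrt (Re 0)"
    using L by (intro tendsto_intros) simp
  then show ?thesis
    by (simp add: fnorm_def)
qed

section \<open>The completion of the span\<close>

definition compl_ip :: "('w \<Rightarrow> complex) \<Rightarrow> ('w \<Rightarrow> complex) \<Rightarrow> complex" where
  "compl_ip f g = lim (\<lambda>n. ip (kspan_space k) ((SOME F. kapprox F f) n) ((SOME G. kapprox G g) n))"

text \<open>Two approximations of the same function differ by a norm-null sequence, by
  \<open>kapprox_null\<close>, and Cauchy sequences are bounded. So every choice of approximations
  has the same limit of inner products as the one fixed by \<open>SOME\<close>.\<close>

lemma compl_ip_lim: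
  assumes F: "kapprox F f" and G: "kapprox G g"
  shows "(\<lambda>n. ip (kspan_space k) (F n) (G n)) \<longlonglongrightarrow> compl_ip f g"
proof -
  let ?E = "kspan_space k"
  define F' G' where "F' = (SOME F. kapprox F f)" and "G' = (SOME G. kapprox G g)"
  have F': "kapprox F' f" and G': "kapprox G' g"
    unfolding F'_def G'_def using someI_ex[of "\<lambda>F. kapprox F f"] someI_ex[of "\<lambda>F. kapprox F g"] F G
    by auto
  have lim': "(\<lambda>n. ip ?E (F' n) (G' n)) \<longlonglongrightarrow> compl_ip f g"
    using kapprox_convergent[OF F' G'] unfolding compl_ip_def F'_def[symmetric] G'_def[symmetric]
    by (simp add: convergent_LIMSEQ_iff)
  have inV: "F n \<in> vecs ?E" "G n \<in> vecs ?E" "F' n \<in> vecs ?E" "G' n \<in> vecs ?E" for n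
    using F G F' G' by (simp_all add: kapprox_def)
  obtain C1 C2 where C: "\<And>n. fnorm ?E (G n) \<le> C1" "\<And>n. fnorm ?E (F' n) \<le> C2"
    using E0.fcauchy_bounded[of G] E0.fcauchy_bounded[of F'] F' G inV unfolding kapprox_def by metis
  have n1: "(\<lambda>n. fnorm ?E (\<lambda>x. F n x - F' n x)) \<longlonglongrightarrow> 0"
    using kapprox_diff[OF F F'] by (intro kapprox_null) simp
  have n2: "(\<lambda>n. fnorm ?E (\<lambda>x. G n x - G' n x)) \<longlonglongrightarrow> 0"
    using kapprox_diff[OF G G'] by (intro kapprox_null) simp
  have "(\<lambda>n. ip ?E (F n) (G n) - ip ?E (F' n) (G' n)) \<longlonglongrightarrow> 0"
  proof (rule Lim_null_comparison)
    have "norm (ip ?E (F n) (G n) - ip ?E (F' n) (G' n))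
      \<le> fnorm ?E (\<lambda>x. F n x - F' n x) * C1 + C2 * fnorm ?E (\<lambda>x. G n x - G' n x)" for n
    proof -
      have "ip ?E (F n) (G n) - ip ?E (F' n) (G' n)
        = ip ?E (\<lambda>x. F n x - F' n x) (G n) + ip ?E (F' n) (\<lambda>x. G n x - G' n x)"
        using inV by (simp only: E0.ip_diff_left E0.ip_diff_right) simp
      moreover have "cmod (ip ?E (\<lambda>x. F n x - F' n x) (G n)) \<le> fnorm ?E (\<lambda>x. F n x - F' n x) * C1"
        using E0.Cauchy_Schwarz[OF E0.diff_in[OF inV(1,3)] inV(2), of n n n] C(1)[of n]
          E0.fnorm_nonneg[OF E0.diff_in[OF inV(1,3)], of n n]
        by (meson mult_left_mono order_trans)
      moreover have "cmod (ip ?E (F' n) (\<lambda>x. G n x - G' n x)) \<le> C2 * fnorm ?E (\<lambda>x. G n x - G' n x)"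
        using E0.Cauchy_Schwarz[OF inV(3) E0.diff_in[OF inV(2,4)], of n n n] C(2)[of n]
          E0.fnorm_nonneg[OF E0.diff_in[OF inV(2,4)], of n n]
        by (meson mult_right_mono order_trans)
      ultimately show ?thesis
        by (simp only:) (rule order_trans[OF norm_triangle_ineq add_mono])
    qed
    then show "\<forall>\<^sub>F n in sequentially. norm (ip ?E (F n) (G n) - ip ?E (F' n) (G' n))
      \<le> fnorm ?E (\<lambda>x. F n x - F' n x) * C1 + C2 * fnorm ?E (\<lambda>x. G n x - G' n x)"
      by simp
    show "(\<lambda>n. fnorm ?E (\<lambda>x. F n x - F' n x) * C1 + C2 * fnorm ?E (\<lambda>x. G n x - G' n x)) \<longlonglongrightarrow> 0"
      by (rule tendsto_eq_intros n1 n2 refl)+ simp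
  qed
  from tendsto_add[OF this lim'] show ?thesis by simp
qed

definition compl_space :: "'w function_space" where
  "compl_space = \<lparr>vecs = {f. \<exists>F. kapprox F f}, ip = compl_ip\<rparr>"

lemma compl_space_simps [simp]:
  "f \<in> vecs compl_space \<longleftrightarrow> (\<exists>F. kapprox F f)" "ip compl_space = compl_ip"
  by (simp_all add: compl_space_def)

lemma kapprox_in_compl: "kapprox F f \<Longrightarrow> f \<in> vecs compl_space"
  by auto

lemma prehilbert_compl: "prehilbert_fs compl_space"
proof
  show "fun_subspace (vecs compl_space)"
    unfolding fun_subspace_def
  proof (intro conjI ballI allI)
    show "(\<lambda>x. 0) \<in> vecs compl_space"
      by (rule kapprox_in_compl[OF kapprox_const[OF fun_subspace_zero[OF fun_subspace_kspan]]])
    show "(\<lambda>x. f x + g x) \<in> vecs compl_space"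
      if fg: "f \<in> vecs compl_space" "g \<in> vecs compl_space" for f g
    proof -
      obtain F G where "kapprox F f" "kapprox G g"
        using fg by auto
      then show ?thesis
        by (rule kapprox_in_compl[OF kapprox_add])
    qed
    show "(\<lambda>x. c * f x) \<in> vecs compl_space" if f: "f \<in> vecs compl_space" for c f
    proof -
      obtain F where "kapprox F f"
        using f by auto
      then show ?thesis
        by (rule kapprox_in_compl[OF kapprox_scale])
    qed
  qed
next
  fix f g assume "f \<in> vecs compl_space" "g \<in> vecs compl_space"
  then obtain F G where F: "kapprox F f" and G: "kapprox G g" by auto
  have "(\<lambda>n. ip (kspan_space k) (F n) (G n)) = (\<lambda>n. cnj (ip (kspan_space k) (G n) (F n)))"
    using F G by (intro ext E0.ip_cnj) (simp_all add: kapprox_def)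
  then show "ip compl_space f g = cnj (ip compl_space g f)"
    using LIMSEQ_unique[OF compl_ip_lim[OF F G]] tendsto_cnj[OF compl_ip_lim[OF G F]] by simp
next
  fix f g h assume "f \<in> vecs compl_space" "g \<in> vecs compl_space" "h \<in> vecs compl_space"
  then obtain F G H where F: "kapprox F f" and G: "kapprox G g" and H: "kapprox H h" by auto
  have "(\<lambda>n. ip (kspan_space k) (F n) (\<lambda>x. G n x + H n x))
      = (\<lambda>n. ip (kspan_space k) (F n) (G n) + ip (kspan_space k) (F n) (H n))"
    using F G H by (intro ext E0.ip_add_right) (simp_all add: kapprox_def)
  then show "ip compl_space f (\<lambda>x. g x + h x) = ip compl_space f g + ip compl_space f h"
    using LIMSEQ_unique[OF compl_ip_lim[OF F kapprox_add[OF G H]]]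
      tendsto_add[OF compl_ip_lim[OF F G] compl_ip_lim[OF F H]] by simp
next
  fix c f g assume "f \<in> vecs compl_space" "g \<in> vecs compl_space"
  then obtain F G where F: "kapprox F f" and G: "kapprox G g" by auto
  have "(\<lambda>n. ip (kspan_space k) (F n) (\<lambda>x. c * G n x)) = (\<lambda>n. c * ip (kspan_space k) (F n) (G n))"
    using F G by (intro ext E0.ip_scale_right) (simp_all add: kapprox_def)
  then show "ip compl_space f (\<lambda>x. c * g x) = c * ip compl_space f g"
    using LIMSEQ_unique[OF compl_ip_lim[OF F kapprox_scale[OF G]]]
      tendsto_mult[OF tendsto_const compl_ip_lim[OF F G], of c] by simp
next
  fix f assume "f \<in> vecs compl_space"
  then obtain F where F: "kapprox F f" by auto
  show "ip compl_space f f \<in> \<real>\<^sub>\<ge>\<^sub>0"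
    using nonneg_Reals_limit[OF compl_ip_lim[OF F F]] E0.ip_self F by (simp add: kapprox_def)
qed

sublocale compl: prehilbert_fs compl_space
  by (rule prehilbert_compl)

lemma kspan_subset_compl: "kspan k \<subseteq> vecs compl_space"
  by (rule subsetI) (rule kapprox_in_compl[OF kapprox_const])

lemma compl_ip_kspan:
  assumes "f \<in> kspan k" "g \<in> kspan k"
  shows "compl_ip f g = ip (kspan_space k) f g"
  using LIMSEQ_unique[OF compl_ip_lim[OF kapprox_const[OF assms(1)] kapprox_const[OF assms(2)]] tendsto_const]
  by simp

lemma fdist_compl_kspan:
  assumes "f \<in> kspan k" "g \<in> kspan k"
  shows "fdist compl_space f g = fdist (kspan_space k) f g"
  using compl_ip_kspan[OF fun_subspace_diff[OF fun_subspace_kspan assms] fun_subspace_diff[OF fun_subspace_kspan assms]]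
  by (simp add: fdist_def fnorm_def)

lemma compl_reproducing:
  assumes "f \<in> vecs compl_space"
  shows "ip compl_space (kfun k x) f = f x"
proof -
  obtain F where F: "kapprox F f"
    using assms by auto
  have "(\<lambda>n. ip (kspan_space k) (kfun k x) (F n)) = (\<lambda>n. F n x)"
    using F by (simp add: kapprox_def kspan_space_reproducing)
  then show ?thesis
    using LIMSEQ_unique[OF compl_ip_lim[OF kapprox_const[OF kfun_in_kspan] F]] F
    by (simp add: kapprox_def)
qed

text \<open>For fixed \<open>n\<close> the sequence G n - G m approximates G n - g as m grows, so
  the distance in the completion is a limit of distances in the span, and these are small by the
  Cauchy property.\<close>

lemma kapprox_dense:
  assumes G: "kapprox G g"
  shows "(\<lambda>n. fdist compl_space (G n) g) \<longlonglongrightarrow> 0"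
proof (rule LIMSEQ_I)
  let ?E = "kspan_space k"
  fix e :: real assume "e > 0"
  then have "e / 2 > 0" by simp
  then obtain N where N: "\<And>m n. m \<ge> N \<Longrightarrow> n \<ge> N \<Longrightarrow> fdist ?E (G m) (G n) < e / 2"
    using G unfolding kapprox_def fcauchy_def by meson
  have Gin: "G n \<in> kspan k" for n using G by (simp add: kapprox_def)
  have "norm (fdist compl_space (G n) g - 0) < e" if n: "n \<ge> N" for n
  proof -
    have H: "kapprox (\<lambda>m x. G n x - G m x) (\<lambda>x. G n x - g x)"
      by (rule kapprox_diff[OF kapprox_const[OF Gin] G])
    have "(\<lambda>m. sqrt (Re (ip ?E (\<lambda>x. G n x - G m x) (\<lambda>x. G n x - G m x)))) \<longlonglongrightarrow>
        sqrt (Re (compl_ip (\<lambda>x. G n x - g x) (\<lambda>x. G n x - g x)))"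
      by (intro tendsto_intros compl_ip_lim[OF H H])
    then have "(\<lambda>m. fdist ?E (G n) (G m)) \<longlonglongrightarrow> fdist compl_space (G n) g"
      by (simp add: fdist_def fnorm_def)
    then have "fdist compl_space (G n) g \<le> e / 2"
      by (rule LIMSEQ_le_const2) (use N[OF n] in \<open>auto intro!: exI[of _ N] less_imp_le\<close>)
    then show ?thesis
      using \<open>e > 0\<close> compl.fdist_nonneg[OF kapprox_in_compl[OF kapprox_const[OF Gin]] kapprox_in_compl[OF G], of n]
      by simp
  qed
  then show "\<exists>no. \<forall>n\<ge>no. norm (fdist compl_space (G n) g - 0) < e" by blast
qed

text \<open>Each \<open>F n\<close> is replaced by an element \<open>G n\<close> of the span at
  distance below 1 / (n + 1). The sequence \<open>G\<close> is Cauchy in the span, it converges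
  pointwise because evaluation is pairing with a kernel function, and its pointwise limit is the
  limit of \<open>F\<close>.\<close>

lemma compl_complete:
  assumes F: "\<And>n. F n \<in> vecs compl_space" and "fcauchy compl_space F"
  shows "\<exists>f\<in>vecs compl_space. (\<lambda>n. fdist compl_space (F n) f) \<longlonglongrightarrow> 0"
proof -
  have "\<exists>g\<in>kspan k. fdist compl_space (F n) g < inverse (real (Suc n))" for n
  proof -
    obtain G where G: "kapprox G (F n)" using F[of n] by auto
    have "\<forall>\<^sub>F i in sequentially. fdist compl_space (G i) (F n) < inverse (real (Suc n))"
      using order_tendstoD(2)[OF kapprox_dense[OF G]] by simp
    then obtain i where i: "fdist compl_space (G i) (F n) < inverse (real (Suc n))"
      by (auto simp: eventually_sequentially)
    have Gi: "G i \<in> kspan k" using G by (simp add: kapprox_def)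
    show ?thesis
    proof (rule bexI[OF _ Gi])
      show "fdist compl_space (F n) (G i) < inverse (real (Suc n))"
        using i compl.fdist_commute[OF F, of "G i" n] subsetD[OF kspan_subset_compl Gi] by simp
    qed
  qed
  then obtain G where G: "\<And>n. G n \<in> kspan k"
    and FG: "\<And>n. fdist compl_space (F n) (G n) < inverse (real (Suc n))"
    by metis
  have Gin: "G n \<in> vecs compl_space" for n
    using G kspan_subset_compl by blast
  have Gc: "fcauchy (kspan_space k) G"
    unfolding fcauchy_def
  proof (intro allI impI)
    fix e :: real assume "e > 0"
    then have e3: "e / 3 > 0" by simp
    then obtain N where N: "\<And>m n. m \<ge> N \<Longrightarrow> n \<ge> N \<Longrightarrow> fdist compl_space (F m) (F n) < e / 3"
      using assms(2) unfolding fcauchy_def by meson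
    obtain N' where N': "inverse (real (Suc N')) < e / 3"
      using reals_Archimedean[OF e3] by blast
    have small: "fdist compl_space (F n) (G n) < e / 3" if "n \<ge> N'" for n
    proof -
      have "inverse (real (Suc n)) \<le> inverse (real (Suc N'))"
        using that by (intro le_imp_inverse_le) auto
      then show ?thesis using FG[of n] N' by linarith
    qed
    have "fdist (kspan_space k) (G m) (G n) < e" if mn: "m \<ge> max N N'" "n \<ge> max N N'" for m n
    proof -
      have "fdist compl_space (G m) (G n) \<le> fdist compl_space (G m) (F m) + fdist compl_space (F m) (G n)"
        using compl.fdist_triangle[OF Gin F Gin] .
      moreover have "fdist compl_space (F m) (G n) \<le> fdist compl_space (F m) (F n) + fdist compl_space (F n) (G n)"
        using compl.fdist_triangle[OF F F Gin] .
      moreover have "fdist compl_space (G m) (F m) < e / 3"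
        using small[of m] mn compl.fdist_commute[OF F Gin, of m m] by simp
      moreover have "fdist compl_space (F m) (F n) < e / 3" "fdist compl_space (F n) (G n) < e / 3"
        using N[of m n] small[of n] mn by simp_all
      ultimately show ?thesis
        using fdist_compl_kspan[OF G G, of m n] by linarith
    qed
    then show "\<exists>N. \<forall>m\<ge>N. \<forall>n\<ge>N. fdist (kspan_space k) (G m) (G n) < e" by blast
  qed
  have "convergent (\<lambda>n. G n x)" for x
  proof -
    have "convergent (\<lambda>n. ip (kspan_space k) (kfun k x) (G n))"
      using Gc G E0.fcauchy_const
      by (intro E0.fcauchy_ip_convergent) (simp_all add: kfun_in_kspan)
    then show ?thesis using G by (simp add: kspan_space_reproducing)
  qed
  then have "kapprox G (\<lambda>x. lim (\<lambda>n. G n x))"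
    using G Gc by (simp add: kapprox_def convergent_LIMSEQ_iff)
  then obtain g where g: "kapprox G g" by blast
  then have gin: "g \<in> vecs compl_space" by auto
  have "(\<lambda>n. fdist compl_space (F n) g) \<longlonglongrightarrow> 0"
  proof (rule Lim_null_comparison)
    have "fdist compl_space (F n) g \<le> inverse (real (Suc n)) + fdist compl_space (G n) g" for n
      using compl.fdist_triangle[OF F Gin gin, of n n] FG[of n] by linarith
    then show "\<forall>\<^sub>F n in sequentially. norm (fdist compl_space (F n) g)
        \<le> inverse (real (Suc n)) + fdist compl_space (G n) g"
      using compl.fdist_nonneg[OF F gin] by simp
    show "(\<lambda>n. inverse (real (Suc n)) + fdist compl_space (G n) g) \<longlonglongrightarrow> 0"
      using tendsto_add[OF LIMSEQ_inverse_real_of_nat kapprox_dense[OF g]] by simp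
  qed
  with gin show ?thesis by blast
qed

text \<open>Evaluation at a point is bounded by the norm, so norm zero forces all values to
  vanish.\<close>

lemma compl_definite:
  assumes f: "f \<in> vecs compl_space" and "ip compl_space f f = 0"
  shows "f = (\<lambda>x. 0)"
proof
  fix x
  have k: "kfun k x \<in> vecs compl_space"
    by (rule subsetD[OF kspan_subset_compl kfun_in_kspan])
  have "cmod (ip compl_space (kfun k x) f) \<le> fnorm compl_space (kfun k x) * fnorm compl_space f"
    using k f by (rule compl.Cauchy_Schwarz)
  moreover have "fnorm compl_space f = 0"
    using assms(2) by (simp add: fnorm_def)
  ultimately show "f x = 0"
    using compl_reproducing[OF f, of x] by simp
qed

lemma is_rkhs_compl: "is_rkhs k compl_space"
  unfolding is_rkhs_def
proof (intro conjI allI ballI)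
  show "hilbert_function_space compl_space"
    unfolding hilbert_function_space_def
    by (intro conjI ballI allI impI compl.subspace compl.ip_add_right compl.ip_scale_right compl.ip_self
       compl.ip_cnj compl_definite compl_complete[unfolded fcauchy_def]) blast+
  show "kfun k x \<in> vecs compl_space" for x
    by (rule subsetD[OF kspan_subset_compl kfun_in_kspan])
  show "ip compl_space (kfun k x) f = f x" if "f \<in> vecs compl_space" for x f
    using that by (rule compl_reproducing)
  have "f \<in> fclosure compl_space (kspan k)" if f: "f \<in> vecs compl_space" for f
  proof -
    obtain F where F: "kapprox F f"
      using f by auto
    moreover have "\<forall>n. F n \<in> kspan k"
      using F by (simp add: kapprox_def)
    ultimately show ?thesis
      unfolding fclosure_def using f kapprox_dense[OF F] by blast
  qed
  then show "vecs compl_space = fclosure compl_space (kspan k)"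
    unfolding fclosure_def by blast
qed

end

theorem Moore_Aronszajn:
  assumes "psd_kernel k"
  shows "is_rkhs k (rkhs k)"
proof -
  interpret psd_kernel_fs k by standard (rule assms)
  show ?thesis
    unfolding rkhs_def using is_rkhs_compl by (rule someI)
qed

section \<open>Riesz representation and bounded operators\<close>

lemma quadratic_nonneg_imp_linear_zero:
  fixes a b :: real
  assumes "0 \<le> a" "\<And>t. 0 \<le> t\<^sup>2 * a + 2 * t * b"
  shows "b = 0"
proof (rule ccontr)
  assume b: "b \<noteq> 0"
  \<comment> \<open>The minimiser would be - b / a; the denominator a + 1 also serves for
    \<open>a = 0\<close> and still gives a negative value.\<close>
  have "(- b / (a + 1))\<^sup>2 * a + 2 * (- b / (a + 1)) * b = - (b\<^sup>2 * (a + 2)) / (a + 1)\<^sup>2"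
    using assms(1) by (simp add: power2_eq_square divide_simps) (simp add: algebra_simps)
  moreover have "\<dots> < 0"
    using assms(1) b by (intro divide_neg_pos) auto
  ultimately show False
    using assms(2)[of "- b / (a + 1)"] by simp
qed

locale hilbert_fs = prehilbert_fs E for E :: "'w function_space" +
  assumes definite: "f \<in> vecs E \<Longrightarrow> ip E f f = 0 \<Longrightarrow> f = (\<lambda>x. 0)"
    and complete: "(\<And>n. F n \<in> vecs E) \<Longrightarrow> fcauchy E F \<Longrightarrow>
      \<exists>f\<in>vecs E. (\<lambda>n. fdist E (F n) f) \<longlonglongrightarrow> 0"
begin

lemma fnorm_eq_zero: "f \<in> vecs E \<Longrightarrow> fnorm E f = 0 \<Longrightarrow> f = (\<lambda>x. 0)"
  by (rule definite) (simp_all add: ip_self_eq)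

text \<open>Stating the Riesz representation theorem for a linear relation spares the proof that a
  functional given on linear combinations is well defined. The representing vector minimises
  \<open>\<parallel>q\<parallel>\<^sup>2 - 2 Re z\<close> over the relation.\<close>

lemma Riesz_relation:
  fixes R :: "(('w \<Rightarrow> complex) \<times> complex) set"
  assumes sub: "\<And>q z. (q, z) \<in> R \<Longrightarrow> q \<in> vecs E"
    and zero: "(\<lambda>x. 0, 0) \<in> R"
    and add: "\<And>q z r w. (q, z) \<in> R \<Longrightarrow> (r, w) \<in> R \<Longrightarrow> (\<lambda>x. q x + r x, z + w) \<in> R"
    and scale: "\<And>c q z. (q, z) \<in> R \<Longrightarrow> (\<lambda>x. c * q x, c * z) \<in> R"
    and C: "0 \<le> C" and bound: "\<And>q z. (q, z) \<in> R \<Longrightarrow> cmod z \<le> C * fnorm E q"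
  obtains h where "h \<in> fclosure E (fst ` R)" "fnorm E h \<le> C"
    "\<And>q z. (q, z) \<in> R \<Longrightarrow> ip E h q = z"
proof -
  define J where "J = (\<lambda>(q, z). (fnorm E q)\<^sup>2 - 2 * Re z)"
  define m where "m = Inf (J ` R)"
  \<comment> \<open>Completing the square: \<open>J\<close> is at least (norm q - C)^2 - C^2, so its
    infimum exists.\<close>
  have Jlow: "- C\<^sup>2 \<le> J p" if "p \<in> R" for p
  proof -
    obtain q z where p: "p = (q, z)" by fastforce
    have "Re z \<le> C * fnorm E q"
      using bound[of q z] that complex_Re_le_cmod[of z] by (simp add: p)
    moreover have "0 \<le> (fnorm E q - C)\<^sup>2" by simp
    ultimately show ?thesis
      unfolding p J_def by (simp add: power2_diff algebra_simps)
  qed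
  have bdd: "bdd_below (J ` R)"
    using Jlow by (auto intro!: bdd_belowI)
  have mJ: "m \<le> J p" if "p \<in> R" for p
    unfolding m_def using that bdd by (intro cInf_lower) auto
  have "\<exists>p\<in>R. J p < m + inverse (real (Suc n))" for n
  proof -
    have "Inf (J ` R) < m + inverse (real (Suc n))" by (simp add: m_def)
    then show ?thesis
      using cInf_less_iff[OF _ bdd] zero by auto
  qed
  then obtain p where p: "\<And>n. p n \<in> R" "\<And>n. J (p n) < m + inverse (real (Suc n))"
    by metis
  define F z where "F n = fst (p n)" and "z n = snd (p n)" for n
  have FR: "(F n, z n) \<in> R" for n
    using p(1)[of n] by (simp add: F_def z_def)
  have Fin: "F n \<in> vecs E" for n
    using FR sub by blast
  have JF: "J (F n, z n) < m + inverse (real (Suc n))" for n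
    using p(2)[of n] by (simp add: F_def z_def)
  \<comment> \<open>The midpoint of two members of \<open>R\<close> is in \<open>R\<close>, so
    \<open>J\<close> is at least \<open>m\<close> there. In the parallelogram law the linear terms
    \<open>Re (z i)\<close> and \<open>Re (z j)\<close> cancel and only the two errors above
    \<open>m\<close> remain.\<close>
  have par: "(fdist E (F i) (F j))\<^sup>2 \<le> 2 * inverse (real (Suc i)) + 2 * inverse (real (Suc j))" for i j
  proof -
    have in_R: "(\<lambda>x. (1/2) * (F i x + F j x), (1/2) * (z i + z j)) \<in> R"
      by (rule scale[OF add[OF FR FR]])
    have "(fnorm E (\<lambda>x. (1/2) * (F i x + F j x)))\<^sup>2 = (fnorm E (\<lambda>x. F i x + F j x))\<^sup>2 / 4"
      unfolding fnorm_scale[OF add_in[OF Fin Fin]] by (simp add: power_divide norm_divide)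
    then have "m \<le> (fnorm E (\<lambda>x. F i x + F j x))\<^sup>2 / 4 - Re (z i) - Re (z j)"
      using mJ[OF in_R] by (simp add: J_def add_divide_distrib)
    moreover have "(fnorm E (F i))\<^sup>2 - 2 * Re (z i) < m + inverse (real (Suc i))"
        "(fnorm E (F j))\<^sup>2 - 2 * Re (z j) < m + inverse (real (Suc j))"
      using JF[of i] JF[of j] by (simp_all add: J_def)
    ultimately show ?thesis
      using parallelogram[OF Fin Fin, of i j] by linarith
  qed
  have "fcauchy E F"
    unfolding fcauchy_def
  proof (intro allI impI)
    fix e :: real assume e: "e > 0"
    then have "e\<^sup>2 / 4 > 0" by simp
    then obtain N where N: "inverse (real (Suc N)) < e\<^sup>2 / 4"
      using reals_Archimedean by blast
    have "fdist E (F i) (F j) < e" if ij: "i \<ge> N" "j \<ge> N" for i j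
    proof -
      have "inverse (real (Suc i)) \<le> inverse (real (Suc N))" "inverse (real (Suc j)) \<le> inverse (real (Suc N))"
        using ij by (simp_all add: le_imp_inverse_le)
      then have "(fdist E (F i) (F j))\<^sup>2 < e\<^sup>2"
        using par[of i j] N by linarith
      then show ?thesis
        using e by (intro power2_less_imp_less[of _ e]) simp_all
    qed
    then show "\<exists>N. \<forall>i\<ge>N. \<forall>j\<ge>N. fdist E (F i) (F j) < e" by blast
  qed
  then obtain h where h: "h \<in> vecs E" and Fh: "(\<lambda>n. fdist E (F n) h) \<longlonglongrightarrow> 0"
    using complete[of F] Fin by blast
  have Jlim: "(\<lambda>n. J (F n, z n)) \<longlonglongrightarrow> m"
  proof (rule real_tendsto_sandwich)
    show "\<forall>\<^sub>F n in sequentially. m \<le> J (F n, z n)"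
      using mJ[OF FR] by simp
    show "\<forall>\<^sub>F n in sequentially. J (F n, z n) \<le> m + inverse (real (Suc n))"
      using JF by (simp add: less_imp_le)
    show "(\<lambda>n. m + inverse (real (Suc n))) \<longlonglongrightarrow> m"
      using LIMSEQ_inverse_real_of_nat_add by blast
  qed simp
  \<comment> \<open>First variation of \<open>J\<close> at \<open>h\<close> in the direction t q.
    Since \<open>h\<close> lies only in the closure of the domain of \<open>R\<close>, the
    inequality is taken at \<open>F n\<close> and then passed to the limit.\<close>
  have Re_eq: "Re (ip E h q) = Re w" if qw: "(q, w) \<in> R" for q w
  proof -
    have q: "q \<in> vecs E" using sub qw by blast
    have "0 \<le> t\<^sup>2 * (fnorm E q)\<^sup>2 + 2 * t * (Re (ip E h q) - Re w)" for t
    proof -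
      let ?t = "complex_of_real t"
      have "m \<le> J (F n, z n) + t\<^sup>2 * (fnorm E q)\<^sup>2 + 2 * t * (Re (ip E (F n) q) - Re w)" for n
      proof -
        have "(fnorm E (\<lambda>x. F n x + ?t * q x))\<^sup>2
            = (fnorm E (F n))\<^sup>2 + t\<^sup>2 * (fnorm E q)\<^sup>2 + 2 * t * Re (ip E (F n) q)"
          using q Fin[of n] ip_cnj[OF Fin q, of n]
          unfolding fnorm_sq[OF add_in[OF Fin scale_in[OF q]]] fnorm_sq[OF Fin] fnorm_sq[OF q]
          by (simp add: ip_add_left ip_add_right ip_scale_left ip_scale_right
              power2_eq_square algebra_simps)
        then show ?thesis
          using mJ[OF add[OF FR scale[OF qw]], of n ?t] by (simp add: J_def algebra_simps)
      qed
      moreover have "(\<lambda>n. J (F n, z n) + t\<^sup>2 * (fnorm E q)\<^sup>2 + 2 * t * (Re (ip E (F n) q) - Re w))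
        \<longlonglongrightarrow> m + t\<^sup>2 * (fnorm E q)\<^sup>2 + 2 * t * (Re (ip E h q) - Re w)"
        by (intro tendsto_intros Jlim tendsto_ip Fin h Fh q) simp
      ultimately have "m \<le> m + t\<^sup>2 * (fnorm E q)\<^sup>2 + 2 * t * (Re (ip E h q) - Re w)"
        using LIMSEQ_le_const by blast
      then show ?thesis by simp
    qed
    then show ?thesis
      using quadratic_nonneg_imp_linear_zero[of "(fnorm E q)\<^sup>2" "Re (ip E h q) - Re w"] by simp
  qed
  \<comment> \<open>The imaginary parts come from the real parts for i q.\<close>
  have eq: "ip E h q = w" if qw: "(q, w) \<in> R" for q w
    using Re_eq[OF qw] Re_eq[OF scale[OF qw, of \<i>]] ip_scale_right[OF h sub[OF qw], of \<i>]
    by (simp add: complex_eq_iff)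
  \<comment> \<open>The square of the norm is the limit of <h, F n> = z n, and \<open>z n\<close> is
    bounded by C times the norm of \<open>F n\<close>.\<close>
  have "(fnorm E h)\<^sup>2 \<le> C * fnorm E h"
  proof -
    have "(\<lambda>n. ip E h (F n)) \<longlonglongrightarrow> ip E h h"
      by (intro tendsto_ip Fin h Fh) simp
    then have "(\<lambda>n. Re (ip E h (F n))) \<longlonglongrightarrow> Re (ip E h h)"
      by (rule tendsto_Re)
    moreover have "(\<lambda>n. C * fnorm E (F n)) \<longlonglongrightarrow> C * fnorm E h"
      by (intro tendsto_intros tendsto_fnorm Fin h Fh)
    moreover have "Re (ip E h (F n)) \<le> C * fnorm E (F n)" for n
      using bound[OF FR, of n] eq[OF FR, of n] complex_Re_le_cmod[of "z n"] by simp
    ultimately have "Re (ip E h h) \<le> C * fnorm E h"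
      by (intro LIMSEQ_le[of "\<lambda>n. Re (ip E h (F n))" _ "\<lambda>n. C * fnorm E (F n)"]) auto
    then show ?thesis using h by (simp add: fnorm_sq)
  qed
  then have "fnorm E h \<le> C"
    using C fnorm_nonneg[OF h] by (cases "fnorm E h = 0") (auto simp: power2_eq_square)
  moreover have "h \<in> fclosure E (fst ` R)"
    unfolding fclosure_def using h Fh FR by force
  ultimately show ?thesis
    using that eq by blast
qed

text \<open>Riesz representation of the functional q -> <f, q> restricted to \<open>M\<close>: the
  representing vector lies in the closure of \<open>M\<close>, and \<open>f\<close> minus this
  vector is orthogonal to \<open>M\<close>.\<close>

lemma projection_exists:
  assumes M: "fun_subspace M" "M \<subseteq> vecs E" and f: "f \<in> vecs E"
  shows "\<exists>g\<in>fclosure E M. \<forall>q\<in>M. ip E g q = ip E f q"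
proof -
  obtain g where g: "g \<in> fclosure E (fst ` ((\<lambda>q. (q, ip E f q)) ` M))"
    "\<And>q z. (q, z) \<in> (\<lambda>q. (q, ip E f q)) ` M \<Longrightarrow> ip E g q = z"
  proof (rule Riesz_relation[of "(\<lambda>q. (q, ip E f q)) ` M" "fnorm E f"])
    show "q \<in> vecs E" if "(q, z) \<in> (\<lambda>q. (q, ip E f q)) ` M" for q z
      using that M by auto
    show "(\<lambda>x. 0, 0) \<in> (\<lambda>q. (q, ip E f q)) ` M"
      using fun_subspace_zero[OF M(1)] ip_zero_right[OF f] by force
    show "(\<lambda>x. q x + r x, z + w) \<in> (\<lambda>q. (q, ip E f q)) ` M"
      if "(q, z) \<in> (\<lambda>q. (q, ip E f q)) ` M" "(r, w) \<in> (\<lambda>q. (q, ip E f q)) ` M" for q z r w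
    proof -
      have qr: "q \<in> M" "r \<in> M" "z = ip E f q" "w = ip E f r" using that by auto
      then show ?thesis
        using fun_subspace_add[OF M(1) qr(1,2)] ip_add_right[OF f subsetD[OF M(2) qr(1)] subsetD[OF M(2) qr(2)]]
        by (simp add: image_iff)
    qed
    show "(\<lambda>x. c * q x, c * z) \<in> (\<lambda>q. (q, ip E f q)) ` M"
      if "(q, z) \<in> (\<lambda>q. (q, ip E f q)) ` M" for c q z
    proof -
      have q: "q \<in> M" "z = ip E f q" using that by auto
      then show ?thesis
        using fun_subspace_scale[OF M(1) q(1)] ip_scale_right[OF f subsetD[OF M(2) q(1)]]
        by (simp add: image_iff)
    qed
    show "0 \<le> fnorm E f" by (rule fnorm_nonneg[OF f])
    show "cmod z \<le> fnorm E f * fnorm E q" if "(q, z) \<in> (\<lambda>q. (q, ip E f q)) ` M" for q z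
    proof -
      have "q \<in> vecs E" "z = ip E f q" using that M by auto
      then show ?thesis using Cauchy_Schwarz[OF f] by simp
    qed
  qed blast
  have "fst ` ((\<lambda>q. (q, ip E f q)) ` M) = M"
    by (simp add: image_image)
  then show ?thesis
    using g by (intro bexI[of _ g]) auto
qed

end

section \<open>Bounded operators on a space of functions\<close>

context prehilbert_fs
begin

context
  fixes T assumes T: "fun_bounded_op E T"
begin

lemma op_in: "f \<in> vecs E \<Longrightarrow> T f \<in> vecs E"
  and op_add: "f \<in> vecs E \<Longrightarrow> g \<in> vecs E \<Longrightarrow> T (\<lambda>x. f x + g x) = (\<lambda>x. T f x + T g x)"
  and op_scale: "f \<in> vecs E \<Longrightarrow> T (\<lambda>x. c * f x) = (\<lambda>x. c * T f x)"
  using T by (simp_all add: fun_bounded_op_def)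

lemma op_diff:
  assumes "f \<in> vecs E" "g \<in> vecs E"
  shows "T (\<lambda>x. f x - g x) = (\<lambda>x. T f x - T g x)"
  using op_add[OF assms(1) scale_in[OF assms(2), of "-1"]] op_scale[OF assms(2), of "-1"] by simp

lemma op_zero: "T (\<lambda>x. 0) = (\<lambda>x. 0)"
  using op_scale[OF zero_in, of 0] by simp

lemma op_sum:
  assumes "\<And>y. y \<in> Y \<Longrightarrow> F y \<in> vecs E"
  shows "T (\<lambda>x. \<Sum>y\<in>Y. F y x) = (\<lambda>x. \<Sum>y\<in>Y. T (F y) x)"
  using assms
proof (induction Y rule: infinite_finite_induct)
  case (insert y Y)
  have "(\<lambda>x. \<Sum>y\<in>Y. F y x) \<in> vecs E"
    using insert by (intro sum_in) auto
  with insert show ?case by (simp add: op_add)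
qed (simp_all add: op_zero)

lemma op_bounded:
  obtains C where "C > 0" "\<And>f. f \<in> vecs E \<Longrightarrow> fnorm E (T f) \<le> C * fnorm E f"
proof -
  obtain C where C: "\<And>f. f \<in> vecs E \<Longrightarrow> fnorm E (T f) \<le> C * fnorm E f"
    using T unfolding fun_bounded_op_def by blast
  have "fnorm E (T f) \<le> max C 1 * fnorm E f" if "f \<in> vecs E" for f
    using C[OF that] mult_right_mono[OF max.cobounded1[of C 1] fnorm_nonneg[OF that]] by linarith
  then show ?thesis using that[of "max C 1"] by simp
qed

lemma op_fconv:
  assumes F: "\<And>n. F n \<in> vecs E" and f: "f \<in> vecs E" and Ff: "(\<lambda>n. fdist E (F n) f) \<longlonglongrightarrow> 0"
  shows "(\<lambda>n. fdist E (T (F n)) (T f)) \<longlonglongrightarrow> 0"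
proof -
  obtain C where C: "C > 0" "\<And>f. f \<in> vecs E \<Longrightarrow> fnorm E (T f) \<le> C * fnorm E f"
    using op_bounded by blast
  show ?thesis
  proof (rule Lim_null_comparison)
    have "fdist E (T (F n)) (T f) \<le> C * fdist E (F n) f" for n
      using C(2)[of "\<lambda>x. F n x - f x"] op_diff[OF F f, of n] F f by (simp add: fdist_def)
    then show "\<forall>\<^sub>F n in sequentially. norm (fdist E (T (F n)) (T f)) \<le> C * fdist E (F n) f"
      using F f by (simp add: fdist_nonneg op_in)
    show "(\<lambda>n. C * fdist E (F n) f) \<longlonglongrightarrow> 0"
      using Ff by (rule tendsto_mult_right_zero)
  qed
qed

end

lemma fun_bounded_op_scale: "fun_bounded_op E (\<lambda>f x. c * f x)"
  unfolding fun_bounded_op_def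
  by (intro conjI ballI allI exI[of _ "cmod c"]) (simp_all add: fnorm_scale distrib_left mult.left_commute)

lemma fun_bounded_op_id_minus:
  assumes T: "fun_bounded_op E T"
  shows "fun_bounded_op E (\<lambda>f x. f x - T f x)"
proof -
  obtain C where C: "C > 0" "\<And>f. f \<in> vecs E \<Longrightarrow> fnorm E (T f) \<le> C * fnorm E f"
    using op_bounded[OF T] by blast
  show ?thesis
    unfolding fun_bounded_op_def
  proof (intro conjI ballI allI exI[of _ "1 + C"])
    fix f assume f: "f \<in> vecs E"
    note Tf = op_in[OF T f]
    show "(\<lambda>x. f x - T f x) \<in> vecs E"
      using f Tf by simp
    show "fnorm E (\<lambda>x. f x - T f x) \<le> (1 + C) * fnorm E f"
      using fnorm_triangle[OF f scale_in[OF Tf], of "-1"] fnorm_scale[OF Tf, of "-1"] C(2)[OF f]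
      by (simp add: distrib_right)
  qed (simp_all add: op_add[OF T] op_scale[OF T] algebra_simps)
qed

lemma op_symmetric:
  assumes T: "fun_bounded_op E T" and real: "\<And>f. f \<in> vecs E \<Longrightarrow> ip E f (T f) \<in> \<real>"
    and f: "f \<in> vecs E" and g: "g \<in> vecs E"
  shows "ip E (T f) g = ip E f (T g)"
proof -
  note [simp] = op_in[OF T] op_add[OF T] op_scale[OF T]
  have "ip E f (T g) = cnj (ip E g (T f))"
  proof (rule complex_hermitian_pair)
    have "ip E (\<lambda>x. f x + g x) (T (\<lambda>x. f x + g x)) - ip E f (T f) - ip E g (T g) \<in> \<real>"
      by (intro Reals_diff real add_in f g)
    then show "ip E f (T g) + ip E g (T f) \<in> \<real>"
      using f g by (simp add: ip_add_left ip_add_right algebra_simps)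
    have "ip E (\<lambda>x. f x + \<i> * g x) (T (\<lambda>x. f x + \<i> * g x)) - ip E f (T f) - ip E g (T g) \<in> \<real>"
      by (intro Reals_diff real add_in scale_in f g)
    then show "\<i> * ip E f (T g) - \<i> * ip E g (T f) \<in> \<real>"
      using f g by (simp add: ip_add_left ip_add_right ip_scale_left ip_scale_right algebra_simps)
  qed
  then show ?thesis
    using f g by (simp add: ip_cnj[of "T f" g])
qed

end

section \<open>Membership and density in a reproducing kernel Hilbert space\<close>

locale rkhs_fs = hilbert_fs E for E :: "'w function_space" +
  fixes k :: "'w \<Rightarrow> 'w \<Rightarrow> complex"
  assumes kfun_in [simp]: "kfun k x \<in> vecs E"
    and reproducing: "f \<in> vecs E \<Longrightarrow> ip E (kfun k x) f = f x"
    and dense: "vecs E = fclosure E (kspan k)"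
begin

lemma kspan_sum_in: "(\<lambda>x. \<Sum>y\<in>Y. c y * k x y) \<in> vecs E"
proof -
  have "(\<lambda>x. \<Sum>y\<in>Y. (\<lambda>x. c y * kfun k y x) x) \<in> vecs E"
    by (intro sum_in scale_in kfun_in)
  then show ?thesis by (simp add: kfun_def)
qed

lemma kspan_subset: "f \<in> kspan k \<Longrightarrow> f \<in> vecs E"
  using kspan_sum_in by (auto elim!: kspanE)

lemma kspan_approx:
  assumes "f \<in> vecs E"
  obtains F where "\<And>n. F n \<in> kspan k" "\<And>n. F n \<in> vecs E" "(\<lambda>n. fdist E (F n) f) \<longlonglongrightarrow> 0"
proof -
  have "f \<in> fclosure E (kspan k)"
    using assms dense by simp
  then obtain F where "\<forall>n. F n \<in> kspan k" "(\<lambda>n. fdist E (F n) f) \<longlonglongrightarrow> 0"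
    unfolding fclosure_def by blast
  then show ?thesis
    by (intro that[of F]) (simp_all add: kspan_subset)
qed

lemma ip_kfun_kfun: "ip E (kfun k x) (kfun k y) = k x y"
  using reproducing[OF kfun_in, of x y] by (simp add: kfun_def)

lemma ip_kspan_left:
  assumes f: "f \<in> vecs E"
  shows "ip E (\<lambda>x. \<Sum>y\<in>Y. c y * k x y) f = (\<Sum>y\<in>Y. cnj (c y) * f y)"
proof -
  have "ip E (\<lambda>x. \<Sum>y\<in>Y. (\<lambda>x. c y * kfun k y x) x) f = (\<Sum>y\<in>Y. cnj (c y) * f y)"
    using f by (simp only: ip_sum_left scale_in kfun_in ip_scale_left reproducing)
  then show ?thesis by (simp add: kfun_def)
qed

lemma eval_bound: "f \<in> vecs E \<Longrightarrow> cmod (f x) \<le> fnorm E (kfun k x) * fnorm E f"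
  using Cauchy_Schwarz[OF kfun_in, of f x] reproducing[of f x] by simp

lemma fconv_pointwise:
  assumes F: "\<And>n. F n \<in> vecs E" and f: "f \<in> vecs E" and Ff: "(\<lambda>n. fdist E (F n) f) \<longlonglongrightarrow> 0"
  shows "(\<lambda>n. F n x) \<longlonglongrightarrow> f x"
  using tendsto_ip[of "\<lambda>_. kfun k x" "kfun k x" F f] F f Ff by (simp add: reproducing)

text \<open>The relation \<open>R\<close> assigns to a combination q of kernel functions the number
  <f, q> that the reproducing property would give if \<open>f\<close> were in the space. The bound
  lets Riesz represent it by a vector h, and pairing h with single kernel functions shows h =
  f.\<close>

lemma mem_criterion:
  assumes C: "0 \<le> C"
    and bound: "\<And>Y c. finite Y \<Longrightarrow>
      cmod (\<Sum>y\<in>Y. cnj (c y) * f y) \<le> C * fnorm E (\<lambda>x. \<Sum>y\<in>Y. c y * k x y)"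
  shows "f \<in> vecs E \<and> fnorm E f \<le> C"
proof -
  define R where "R = {(q, z). \<exists>c Y. finite Y \<and> q = (\<lambda>x. \<Sum>y\<in>Y. c y * k x y) \<and>
     z = (\<Sum>y\<in>Y. c y * cnj (f y))}"
  have RI: "finite Y \<Longrightarrow> (\<lambda>x. \<Sum>y\<in>Y. c y * k x y, \<Sum>y\<in>Y. c y * cnj (f y)) \<in> R" for c Y
    by (auto simp: R_def)
  obtain h where h: "h \<in> fclosure E (fst ` R)" "fnorm E h \<le> C" "\<And>q z. (q, z) \<in> R \<Longrightarrow> ip E h q = z"
  proof (rule Riesz_relation[of R C])
    show "q \<in> vecs E" if "(q, z) \<in> R" for q z
      using that kspan_sum_in by (auto simp: R_def)
    show "(\<lambda>x. 0, 0) \<in> R"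
      using RI[of "{}"] by simp
    show "(\<lambda>x. q x + r x, z + w) \<in> R" if qr: "(q, z) \<in> R" "(r, w) \<in> R" for q z r w
    proof -
      obtain c Y where 1: "finite Y" "q = (\<lambda>x. \<Sum>y\<in>Y. c y * k x y)" "z = (\<Sum>y\<in>Y. c y * cnj (f y))"
        using qr(1) unfolding R_def by blast
      obtain d Z where 2: "finite Z" "r = (\<lambda>x. \<Sum>y\<in>Z. d y * k x y)" "w = (\<Sum>y\<in>Z. d y * cnj (f y))"
        using qr(2) unfolding R_def by blast
      define e where "e y = (if y \<in> Y then c y else 0) + (if y \<in> Z then d y else 0)" for y
      have key: "(\<Sum>y\<in>Y \<union> Z. e y * \<phi> y) = (\<Sum>y\<in>Y. c y * \<phi> y) + (\<Sum>y\<in>Z. d y * \<phi> y)" for \<phi>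
      proof -
        have "(\<Sum>y\<in>Y. c y * \<phi> y) = (\<Sum>y\<in>Y \<union> Z. (if y \<in> Y then c y else 0) * \<phi> y)"
          using 1 2 by (intro sum.mono_neutral_cong_left) auto
        moreover have "(\<Sum>y\<in>Z. d y * \<phi> y) = (\<Sum>y\<in>Y \<union> Z. (if y \<in> Z then d y else 0) * \<phi> y)"
          using 1 2 by (intro sum.mono_neutral_cong_left) auto
        ultimately show ?thesis
          by (simp add: e_def sum.distrib[symmetric] distrib_right)
      qed
      show ?thesis
        using RI[OF finite_UnI[OF 1(1) 2(1)], of e] by (simp add: key 1 2)
    qed
    show "(\<lambda>x. c * q x, c * z) \<in> R" if qz: "(q, z) \<in> R" for c q z
    proof -
      obtain d Y where 1: "finite Y" "q = (\<lambda>x. \<Sum>y\<in>Y. d y * k x y)" "z = (\<Sum>y\<in>Y. d y * cnj (f y))"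
        using qz unfolding R_def by blast
      show ?thesis
        using RI[OF 1(1), of "\<lambda>y. c * d y"] by (simp add: 1 sum_distrib_left mult.assoc)
    qed
    show "0 \<le> C" by (rule C)
    show "cmod z \<le> C * fnorm E q" if qz: "(q, z) \<in> R" for q z
    proof -
      obtain d Y where 1: "finite Y" "q = (\<lambda>x. \<Sum>y\<in>Y. d y * k x y)" "z = (\<Sum>y\<in>Y. d y * cnj (f y))"
        using qz unfolding R_def by blast
      have "cmod z = cmod (cnj z)" by simp
      also have "cnj z = (\<Sum>y\<in>Y. cnj (d y) * f y)" by (simp add: 1)
      also have "cmod \<dots> \<le> C * fnorm E q" unfolding 1(2) by (rule bound[OF 1(1)])
      finally show ?thesis .
    qed
  qed blast
  have hin: "h \<in> vecs E"
    using h(1) by (simp add: fclosure_def)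
  have "h x = f x" for x
  proof -
    have "(kfun k x, cnj (f x)) \<in> R"
      using RI[of "{x}" "\<lambda>_. 1"] by (simp add: kfun_def)
    then have "ip E h (kfun k x) = cnj (f x)"
      by (rule h(3))
    then show ?thesis
      using ip_cnj[OF kfun_in hin, of x] reproducing[OF hin, of x] by simp
  qed
  then have "h = f" ..
  then show ?thesis using hin h(2) by simp
qed

text \<open>Linearity gives agreement on the span, and pointwise convergence extends it to the
  closure. This identifies operators that are fixed only by their values on kernel
  functions.\<close>

lemma op_eqI:
  assumes T: "fun_bounded_op E T" and T': "fun_bounded_op E T'"
    and eq: "\<And>y. T (kfun k y) = T' (kfun k y)" and f: "f \<in> vecs E"
  shows "T f = T' f"
proof -
  have span: "T g = T' g" if gk: "g \<in> kspan k" for g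
  proof -
    obtain c Y where "finite Y" "g = (\<lambda>x. \<Sum>y\<in>Y. c y * k x y)"
      using gk by (rule kspanE)
    then have g: "g = (\<lambda>x. \<Sum>y\<in>Y. (\<lambda>x. c y * kfun k y x) x)"
      by (simp add: kfun_def)
    show ?thesis
      unfolding g by (simp only: op_sum[OF T] op_sum[OF T'] scale_in kfun_in op_scale[OF T] op_scale[OF T'] eq)
  qed
  obtain F where F: "\<And>n. F n \<in> kspan k" "\<And>n. F n \<in> vecs E" "(\<lambda>n. fdist E (F n) f) \<longlonglongrightarrow> 0"
    using kspan_approx[OF f] by blast
  show ?thesis
  proof
    fix x
    have "(\<lambda>n. T (F n) x) \<longlonglongrightarrow> T f x"
      by (intro fconv_pointwise op_fconv[OF T] op_in[OF T] F f)
    moreover have "(\<lambda>n. T' (F n) x) \<longlonglongrightarrow> T' f x"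
      by (intro fconv_pointwise op_fconv[OF T'] op_in[OF T'] F f)
    ultimately show "T f x = T' f x"
      using span[OF F(1)] LIMSEQ_unique by simp
  qed
qed

lemma op_nonnegI:
  assumes T: "fun_bounded_op E T"
    and pos: "\<And>f. f \<in> kspan k \<Longrightarrow> ip E f (T f) \<in> \<real>\<^sub>\<ge>\<^sub>0" and f: "f \<in> vecs E"
  shows "ip E f (T f) \<in> \<real>\<^sub>\<ge>\<^sub>0"
proof -
  obtain F where F: "\<And>n. F n \<in> kspan k" "\<And>n. F n \<in> vecs E" "(\<lambda>n. fdist E (F n) f) \<longlonglongrightarrow> 0"
    using kspan_approx[OF f] by blast
  have "(\<lambda>n. ip E (F n) (T (F n))) \<longlonglongrightarrow> ip E f (T f)"
    by (intro tendsto_ip op_fconv[OF T] op_in[OF T] F f)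
  then show ?thesis
    using pos[OF F(1)] by (rule nonneg_Reals_limit)
qed

end

lemma rkhs_fsI:
  assumes "is_rkhs k E"
  shows "rkhs_fs E k"
proof -
  have H: "hilbert_function_space E"
    using assms by (simp add: is_rkhs_def)
  show ?thesis
  proof
    show "fun_subspace (vecs E)"
      and "\<And>f g. f \<in> vecs E \<Longrightarrow> g \<in> vecs E \<Longrightarrow> ip E f g = cnj (ip E g f)"
      and "\<And>f g h. f \<in> vecs E \<Longrightarrow> g \<in> vecs E \<Longrightarrow> h \<in> vecs E \<Longrightarrow>
        ip E f (\<lambda>x. g x + h x) = ip E f g + ip E f h"
      and "\<And>f g c. f \<in> vecs E \<Longrightarrow> g \<in> vecs E \<Longrightarrow> ip E f (\<lambda>x. c * g x) = c * ip E f g"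
      and "\<And>f. f \<in> vecs E \<Longrightarrow> ip E f f \<in> \<real>\<^sub>\<ge>\<^sub>0"
      and "\<And>f. f \<in> vecs E \<Longrightarrow> ip E f f = 0 \<Longrightarrow> f = (\<lambda>x. 0)"
      and "\<And>F. (\<And>n. F n \<in> vecs E) \<Longrightarrow> fcauchy E F \<Longrightarrow>
        \<exists>f\<in>vecs E. (\<lambda>n. fdist E (F n) f) \<longlonglongrightarrow> 0"
      using H unfolding hilbert_function_space_def fcauchy_def by blast+
    show "\<And>x. kfun k x \<in> vecs E"
      and "\<And>f x. f \<in> vecs E \<Longrightarrow> ip E (kfun k x) f = f x"
      and "vecs E = fclosure E (kspan k)"
      using assms unfolding is_rkhs_def by blast+
  qed
qed

section \<open>The canonical representation\<close>

context complex_inner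
begin

lemma cinner_add_left: "cinner (x + y) z = cinner x z + cinner y z"
  by (metis cinner_commute cinner_add_right complex_cnj_add)

lemma cinner_scaleC_left: "cinner (c *\<^sub>C x) y = cnj c * cinner x y"
  by (metis cinner_commute cinner_scaleC_right complex_cnj_mult)

lemma cinner_zero_right [simp]: "cinner x 0 = 0"
  using cinner_add_right[of x 0 0] by simp

lemma cinner_diff_right: "cinner x (y - z) = cinner x y - cinner x z"
  using cinner_add_right[of x "y - z" z] by simp

lemma cinner_sum_right: "cinner x (\<Sum>i\<in>I. f i) = (\<Sum>i\<in>I. cinner x (f i))"
  by (induction I rule: infinite_finite_induct) (simp_all add: cinner_add_right)

lemma cinner_self: "cinner x x = complex_of_real ((norm x)\<^sup>2)"
  using cinner_self_nonneg[of x]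
  by (simp add: norm_eq_sqrt_cinner complex_nonneg_Reals_iff complex_eq_iff)

lemma cinner_ext:
  assumes "\<And>u. cinner u x = cinner u y"
  shows "x = y"
proof -
  have "cinner (x - y) (x - y) = 0"
    using assms by (simp add: cinner_diff_right)
  then show ?thesis by (simp add: cinner_self)
qed

lemma cinner_Cauchy_Schwarz: "cmod (cinner x y) \<le> norm x * norm y"
proof -
  define z where "z = cinner y x"
  have "(cmod z)\<^sup>2 \<le> (norm x)\<^sup>2 * (norm y)\<^sup>2"
  proof (rule Cauchy_Schwarz_quadratic)
    fix r :: real
    define c where "c = - complex_of_real r * z"
    have 1: "z * cnj z = complex_of_real ((cmod z)\<^sup>2)"
      using complex_norm_square[of z] by simp
    have "complex_of_real ((norm (x + c *\<^sub>C y))\<^sup>2)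
        = cinner x x + c * cinner x y + cnj c * cinner y x + cnj c * c * cinner y y"
      unfolding cinner_self[symmetric]
      by (simp add: cinner_add_left cinner_add_right cinner_scaleC_left cinner_scaleC_right algebra_simps)
    also have "\<dots> = (norm x)\<^sup>2 - of_real r * (z * cnj z) - of_real r * (z * cnj z)
                    + of_real r * of_real r * (z * cnj z) * (norm y)\<^sup>2"
      unfolding cinner_commute[of x y] cinner_self z_def[symmetric]
      by (simp add: c_def algebra_simps)
    also have "\<dots> = complex_of_real ((norm x)\<^sup>2 - 2 * r * (cmod z)\<^sup>2 + r\<^sup>2 * (cmod z)\<^sup>2 * (norm y)\<^sup>2)"
      unfolding 1 by (simp add: power2_eq_square algebra_simps)
    finally show "0 \<le> (norm x)\<^sup>2 - 2 * r * (cmod z)\<^sup>2 + r\<^sup>2 * (cmod z)\<^sup>2 * (norm y)\<^sup>2"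
      by (metis of_real_eq_iff zero_le_power2)
  qed simp_all
  moreover have "cmod z = cmod (cinner x y)"
    unfolding z_def cinner_commute[of x y] by simp
  ultimately have "(cmod (cinner x y))\<^sup>2 \<le> (norm x * norm y)\<^sup>2"
    by (simp add: power_mult_distrib)
  then show ?thesis
    by (rule power2_le_imp_le) simp
qed

end

section \<open>The algebra and the positivity of kernels\<close>

lemma star_one: "star (1::'a::unital_cstar_algebra) = 1"
  by (metis mult_1_left mult_1_right star_mult star_star)

lemma norm_star: "norm (star x) = norm (x::'a::unital_cstar_algebra)"
proof -
  have le: "norm y \<le> norm (star y)" for y :: 'a
  proof (cases "y = 0")
    case False
    have "norm y * norm y \<le> norm (star y) * norm y"
      using norm_mult_ineq[of "star y" y] by (simp add: cstar_identity power2_eq_square)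
    then show ?thesis using False by simp
  qed simp
  show ?thesis
    using le[of x] le[of "star x"] by (simp add: star_star)
qed

lemma gpd_kernelsD:
  assumes "K \<in> gpd_kernels"
  shows gpd_add: "K s t (a + b) u = K s t a u + K s t b u"
    and gpd_scale: "K s t (c *\<^sub>C a) u = c *\<^sub>C K s t a u"
    and gpd_op_add: "K s t a (u + v) = K s t a u + K s t a v"
    and gpd_op_scale: "K s t a (c *\<^sub>C u) = c *\<^sub>C K s t a u"
    and gpd_nonneg: "(\<Sum>i<(N::nat). \<Sum>j<N. cinner (w i) (K (p i) (p j) (star (d i) * d j) (w j))) \<in> \<real>\<^sub>\<ge>\<^sub>0"
proof -
  have "K s t \<in> bounded_op_maps"
    using assms by (simp add: gpd_kernels_def)
  then show "K s t (a + b) u = K s t a u + K s t b u" "K s t (c *\<^sub>C a) u = c *\<^sub>C K s t a u"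
    "K s t a (u + v) = K s t a u + K s t a v" "K s t a (c *\<^sub>C u) = c *\<^sub>C K s t a u"
    unfolding bounded_op_maps_def bounded_ops_def complex_linear_def by auto
  show "(\<Sum>i<N. \<Sum>j<N. cinner (w i) (K (p i) (p j) (star (d i) * d j) (w j))) \<in> \<real>\<^sub>\<ge>\<^sub>0"
    using assms by (simp add: gpd_kernels_def)
qed

lemma gpd_bound:
  assumes "K \<in> gpd_kernels"
  obtains C where "0 \<le> C" "\<And>a u. norm (K s t a u) \<le> C * norm a * norm u"
proof -
  have K: "K s t \<in> bounded_op_maps"
    using assms by (simp add: gpd_kernels_def)
  then obtain C where C: "\<And>a. onorm (K s t a) \<le> C * norm a"
    unfolding bounded_op_maps_def by blast
  have "norm (K s t a u) \<le> max C 0 * norm a * norm u" for a u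
  proof -
    have "norm (K s t a u) \<le> onorm (K s t a) * norm u"
      using K by (intro onorm) (auto simp: bounded_op_maps_def bounded_ops_def)
    also have "\<dots> \<le> C * norm a * norm u"
      using C by (rule mult_right_mono) simp
    also have "\<dots> \<le> max C 0 * norm a * norm u"
      by (intro mult_right_mono) auto
    finally show ?thesis .
  qed
  then show ?thesis using that[of "max C 0"] by simp
qed

text \<open>An enumeration of \<open>Y\<close> turns the sum over a set into a sum over indices, and
  each coefficient is absorbed into the vector: c L(s, t)(a) v = L(s, t)(a) (c v).\<close>

lemma psd_scalar_kernel:
  assumes K: "K \<in> gpd_kernels"
  shows "psd_kernel (scalar_kernel K)"
  unfolding psd_kernel_def
proof (intro allI impI)
  fix c :: "_ \<Rightarrow> complex" and Y :: "('a \<times> 'b \<times> 'c) set"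
  assume "finite Y"
  then obtain h where h: "bij_betw h {..<card Y} Y"
    using ex_bij_betw_nat_finite[of Y] by (auto simp: atLeast0LessThan)
  define s a u where "s i = fst (h i)" and "a i = fst (snd (h i))" and "u i = snd (snd (h i))" for i
  have entry: "cnj (c (h i)) * c (h j) * scalar_kernel K (h i) (h j)
      = cinner (c (h i) *\<^sub>C u i) (K (s i) (s j) (star (a i) * a j) (c (h j) *\<^sub>C u j))" for i j
    by (simp add: scalar_kernel_def s_def a_def u_def gpd_op_scale[OF K] cinner_scaleC_left
        cinner_scaleC_right case_prod_beta)
  have "(\<Sum>y\<in>Y. \<Sum>z\<in>Y. cnj (c y) * c z * scalar_kernel K y z)
      = (\<Sum>i<card Y. \<Sum>z\<in>Y. cnj (c (h i)) * c z * scalar_kernel K (h i) z)"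
    using h by (rule sum.reindex_bij_betw[symmetric])
  also have "\<dots> = (\<Sum>i<card Y. \<Sum>j<card Y. cnj (c (h i)) * c (h j) * scalar_kernel K (h i) (h j))"
    by (intro sum.cong refl sum.reindex_bij_betw[OF h, symmetric])
  also have "\<dots> \<in> \<real>\<^sub>\<ge>\<^sub>0"
    unfolding entry by (rule gpd_nonneg[OF K])
  finally show "(\<Sum>y\<in>Y. \<Sum>z\<in>Y. cnj (c y) * c z * scalar_kernel K y z) \<in> \<real>\<^sub>\<ge>\<^sub>0" .
qed

text \<open>Iterated Cauchy-Schwarz inequalities yield the sharp constant from a crude bound.\<close>

lemma iterated_square_bound:
  fixes x :: "nat \<Rightarrow> real"
  assumes nonneg: "\<And>n. 0 \<le> x n" and A: "0 \<le> A" and r: "0 \<le> r"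
    and step: "\<And>n. (x n)\<^sup>2 \<le> A * x (Suc n)" and crude: "\<And>n. x n \<le> C * r ^ 2 ^ n"
  shows "x 0 \<le> A * r"
proof (cases "A = 0")
  case True
  then show ?thesis using step[of 0] by simp
next
  case False
  with A have A0: "A > 0" by simp
  \<comment> \<open>After division by \<open>A\<close> the assumption \<open>step\<close> says that
    the square of each term is at most the next term.\<close>
  have pow: "(x 0 / A) ^ 2 ^ n \<le> x n / A" for n
  proof (induction n)
    case (Suc n)
    have "(x 0 / A) ^ 2 ^ Suc n = ((x 0 / A) ^ 2 ^ n)\<^sup>2"
      by (simp add: power_mult[symmetric] mult.commute)
    also have "\<dots> \<le> (x n / A)\<^sup>2"
      using Suc nonneg A0 by (intro power_mono) auto
    also have "\<dots> \<le> x (Suc n) / A"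
      using step[of n] A0 by (simp add: power2_eq_square field_simps)
    finally show ?case .
  qed simp
  have bound: "(x 0 / A) ^ 2 ^ n \<le> (C / A) * r ^ 2 ^ n" for n
    using order_trans[OF pow[of n] divide_right_mono[OF crude[of n] A]] by simp
  show ?thesis
  proof (rule ccontr)
    assume "\<not> ?thesis"
    then have gt: "x 0 / A > r"
      using A0 by (simp add: field_simps)
    show False
    proof (cases "r = 0")
      case True
      then show False using bound[of 0] gt by simp
    next
      case False
      with r have r0: "r > 0" by simp
      \<comment> \<open>Were the claim false, \<open>q\<close> would exceed 1, while all its powers
        with exponent 2^n stay below C / A.\<close>
      define q where "q = x 0 / A / r"
      have q: "q > 1" using divide_strict_right_mono[OF gt r0] r0 by (simp add: q_def)
      have qb: "q ^ 2 ^ n \<le> C / A" for n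
        unfolding q_def power_divide[of "x 0 / A" r]
        using bound[of n] r0 by (simp only: pos_divide_le_eq zero_less_power)
      obtain m where m: "C / A < q ^ m"
        using real_arch_pow[OF q] by blast
      have "q ^ m \<le> q ^ 2 ^ m"
        using q by (intro power_increasing) (auto intro: less_imp_le)
      then show False using m qb[of m] by linarith
    qed
  qed
qed

text \<open>The star comes from passing to the adjoint: the value of \<open>\<pi>(a) f\<close> at a
  point is its pairing with the kernel function there, and \<open>\<pi>(star a)\<close> moves this
  kernel function from (t, b, v) to (t, star a * b, v). The formula makes sense for all functions
  and does not depend on a kernel.\<close>

definition left_shift :: "'a::unital_cstar_algebra \<Rightarrow> ('x \<times> 'a \<times> 'h \<Rightarrow> complex) \<Rightarrow> 'x \<times> 'a \<times> 'h \<Rightarrow> complex"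
  where "left_shift a f = (\<lambda>(t, b, v). f (t, star a * b, v))"

lemma left_shift_apply [simp]: "left_shift a f (t, b, v) = f (t, star a * b, v)"
  by (simp add: left_shift_def)

lemma left_shift_mult: "left_shift a (left_shift b f) = left_shift (a * b) f"
  by (rule ext) (auto simp: star_mult mult.assoc)

section \<open>The action of the algebra by left shifts\<close>

locale gpd_kernel =
  fixes L :: "('x, 'a::unital_cstar_algebra, 'h::complex_hilbert) op_kernel"
  assumes gpd: "L \<in> gpd_kernels"
begin

abbreviation k where "k \<equiv> scalar_kernel L"
abbreviation E where "E \<equiv> kernel_space L"

lemma rkhs_fs_kernel_space: "rkhs_fs E k"
  unfolding kernel_space_def by (intro rkhs_fsI Moore_Aronszajn psd_scalar_kernel gpd)

sublocale rkhs_fs E k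
  by (rule rkhs_fs_kernel_space)

lemma left_shift_kfun: "left_shift a (kfun k (t, b, v)) = kfun k (t, a * b, v)"
  by (rule ext) (auto simp: kfun_def scalar_kernel_def star_mult star_star mult.assoc)

lemma left_shift_kfun': "left_shift a (kfun k y) = kfun k (fst y, a * fst (snd y), snd (snd y))"
  using left_shift_kfun[of a "fst y" "fst (snd y)" "snd (snd y)"] by simp

lemma left_shift_kspan_sum:
  "left_shift a (\<lambda>x. \<Sum>y\<in>Y. c y * k x y)
    = (\<lambda>x. \<Sum>y\<in>Y. c y * kfun k (fst y, a * fst (snd y), snd (snd y)) x)"
proof
  fix x :: "'x \<times> 'a \<times> 'h"
  obtain t b v where x: "x = (t, b, v)"
    by (cases x)
  have "k (t, star a * b, v) y = kfun k (fst y, a * fst (snd y), snd (snd y)) (t, b, v)" for y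
    using fun_cong[OF left_shift_kfun'[of a y], of "(t, b, v)"] by (simp add: kfun_def)
  then show "left_shift a (\<lambda>x. \<Sum>y\<in>Y. c y * k x y) x
    = (\<Sum>y\<in>Y. c y * kfun k (fst y, a * fst (snd y), snd (snd y)) x)"
    by (simp add: x)
qed

lemma left_shift_kspan_in: "left_shift a (\<lambda>x. \<Sum>y\<in>Y. c y * k x y) \<in> vecs E"
  unfolding left_shift_kspan_sum by (intro sum_in scale_in kfun_in)

lemma left_shift_kspan:
  assumes "f \<in> kspan k"
  shows "left_shift a f \<in> vecs E"
proof -
  obtain c Y where "f = (\<lambda>x. \<Sum>y\<in>Y. c y * k x y)"
    using assms by (rule kspanE)
  then show ?thesis by (simp add: left_shift_kspan_in)
qed

lemma ip_left_shift_kspan: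
  assumes "f \<in> kspan k" "g \<in> vecs E" "left_shift (star a) g \<in> vecs E"
  shows "ip E (left_shift a f) g = ip E f (left_shift (star a) g)"
proof -
  obtain c Y where f: "f = (\<lambda>x. \<Sum>y\<in>Y. c y * k x y)"
    using assms(1) by (rule kspanE)
  have "ip E (left_shift a f) g = (\<Sum>y\<in>Y. cnj (c y) * g (fst y, a * fst (snd y), snd (snd y)))"
    unfolding f left_shift_kspan_sum using assms(2)
    by (simp only: ip_sum_left scale_in kfun_in ip_scale_left reproducing)
  also have "\<dots> = (\<Sum>y\<in>Y. cnj (c y) * left_shift (star a) g y)"
    by (intro sum.cong refl) (auto simp: left_shift_def star_star split: prod.splits)
  also have "\<dots> = ip E f (left_shift (star a) g)"
    unfolding f using assms(3) by (rule ip_kspan_left[symmetric])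
  finally show ?thesis .
qed

text \<open>The squared norm is <v, L(t, t)(star b * b) v>, whence \<open>D\<close> is the square
  root of a bound of L(t, t). It depends on \<open>t\<close> only.\<close>

lemma fnorm_kfun_bound:
  obtains D where "0 \<le> D" "\<And>b v. fnorm E (kfun k (t, b, v)) \<le> D * norm b * norm v"
proof -
  obtain C where C: "0 \<le> C" "\<And>a u. norm (L t t a u) \<le> C * norm a * norm u"
    using gpd_bound[OF gpd] by blast
  have "fnorm E (kfun k (t, b, v)) \<le> sqrt C * norm b * norm v" for b v
  proof (rule power2_le_imp_le)
    have "(fnorm E (kfun k (t, b, v)))\<^sup>2 = Re (cinner v (L t t (star b * b) v))"
      unfolding fnorm_sq[OF kfun_in] ip_kfun_kfun by (simp add: scalar_kernel_def)
    also have "\<dots> \<le> norm v * norm (L t t (star b * b) v)"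
      using cinner_Cauchy_Schwarz complex_Re_le_cmod order_trans by blast
    also have "\<dots> \<le> norm v * (C * norm (star b * b) * norm v)"
      by (intro mult_left_mono C) simp
    also have "\<dots> = (sqrt C * norm b * norm v)\<^sup>2"
      using C(1) by (simp add: cstar_identity power_mult_distrib power2_eq_square)
    finally show "(fnorm E (kfun k (t, b, v)))\<^sup>2 \<le> (sqrt C * norm b * norm v)\<^sup>2" .
  qed (simp add: C(1))
  then show ?thesis using that[of "sqrt C"] C(1) by simp
qed

text \<open>The constant depends on \<open>f\<close> and does not yet give a bounded operator. Its
  linear growth in \<open>norm a\<close> is what the iterated Cauchy-Schwarz inequality starts
  from.\<close>

lemma left_shift_crude_bound:
  assumes "f \<in> kspan k"
  obtains C where "\<And>a. fnorm E (left_shift a f) \<le> C * norm a"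
proof -
  obtain c Y where f: "f = (\<lambda>x. \<Sum>y\<in>Y. c y * k x y)"
    using assms by (rule kspanE)
  have "\<exists>D\<ge>0. \<forall>b v. fnorm E (kfun k (t, b, v)) \<le> D * norm b * norm v" for t
    using fnorm_kfun_bound by metis
  then obtain D where D: "\<And>t. 0 \<le> D t" "\<And>t b v. fnorm E (kfun k (t, b, v)) \<le> D t * norm b * norm v"
    by metis
  define C where "C = (\<Sum>y\<in>Y. cmod (c y) * (D (fst y) * norm (fst (snd y)) * norm (snd (snd y))))"
  have "fnorm E (left_shift a f) \<le> C * norm a" for a
  proof -
    let ?g = "\<lambda>y. kfun k (fst y, a * fst (snd y), snd (snd y))"
    have "fnorm E (left_shift a f) \<le> (\<Sum>y\<in>Y. fnorm E (\<lambda>x. c y * ?g y x))"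
      unfolding f left_shift_kspan_sum by (intro fnorm_sum scale_in kfun_in)
    also have "\<dots> = (\<Sum>y\<in>Y. cmod (c y) * fnorm E (?g y))"
      by (simp only: fnorm_scale kfun_in)
    also have "\<dots> \<le> (\<Sum>y\<in>Y. cmod (c y) * (D (fst y) * (norm a * norm (fst (snd y))) * norm (snd (snd y))))"
      by (intro sum_mono mult_left_mono order_trans[OF D(2)] mult_right_mono norm_mult_ineq D) simp_all
    also have "\<dots> = C * norm a"
      unfolding C_def sum_distrib_right by (intro sum.cong refl) (simp only: mult_ac)
    finally show ?thesis .
  qed
  then show ?thesis using that by blast
qed

lemma star_self_power: "star ((star a * a) ^ n) = (star a * (a::'a)) ^ n"
  by (induction n) (simp_all add: star_one star_mult star_star power_commutes)

text \<open>The usual argument takes a square root of norm(a)^2 - star a * a in the algebra. The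
  iteration gets by with submultiplicativity of the norm and the C*-identity.\<close>

lemma left_shift_bound_kspan:
  assumes f: "f \<in> kspan k"
  shows "fnorm E (left_shift a f) \<le> norm a * fnorm E f"
proof -
  define h where "h = star a * a"
  have fE: "f \<in> vecs E" by (rule kspan_subset[OF f])
  note nn = fnorm_nonneg[OF left_shift_kspan[OF f]]
  obtain C where C: "\<And>a. fnorm E (left_shift a f) \<le> C * norm a"
    using left_shift_crude_bound[OF f] by blast
  have sq: "(fnorm E (left_shift b f))\<^sup>2 \<le> fnorm E f * fnorm E (left_shift (star b * b) f)" for b
  proof -
    have "ip E (left_shift b f) (left_shift b f) = ip E f (left_shift (star b * b) f)"
      using ip_left_shift_kspan[OF f left_shift_kspan[OF f], of b b] left_shift_kspan[OF f, of "star b * b"]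
      by (simp add: left_shift_mult)
    then have "(fnorm E (left_shift b f))\<^sup>2 = Re (ip E f (left_shift (star b * b) f))"
      by (simp add: fnorm_sq left_shift_kspan[OF f])
    also have "\<dots> \<le> fnorm E f * fnorm E (left_shift (star b * b) f)"
      using Cauchy_Schwarz[OF fE left_shift_kspan[OF f]] complex_Re_le_cmod order_trans by blast
    finally show ?thesis .
  qed
  \<comment> \<open>The exponent is written as 2 ^ 0 to match the term \<open>x 0\<close>. As
    \<open>h\<close> is self-adjoint, star(h^m) * h^m = h^(2 m), so each use of \<open>sq\<close>
    doubles the exponent.\<close>
  have "fnorm E (left_shift (h ^ 2 ^ 0) f) \<le> fnorm E f * norm h"
  proof (rule iterated_square_bound[where C = "max C 0"])
    show "(fnorm E (left_shift (h ^ 2 ^ n) f))\<^sup>2 \<le> fnorm E f * fnorm E (left_shift (h ^ 2 ^ Suc n) f)" for n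
    proof -
      have "star (h ^ 2 ^ n) * h ^ 2 ^ n = h ^ 2 ^ Suc n"
        by (simp add: h_def star_self_power power_add[symmetric] mult_2)
      then show ?thesis using sq[of "h ^ 2 ^ n"] by simp
    qed
    show "fnorm E (left_shift (h ^ 2 ^ n) f) \<le> max C 0 * norm h ^ 2 ^ n" for n
    proof -
      have "fnorm E (left_shift (h ^ 2 ^ n) f) \<le> C * norm (h ^ 2 ^ n)"
        by (rule C)
      also have "\<dots> \<le> max C 0 * norm (h ^ 2 ^ n)"
        by (intro mult_right_mono) auto
      also have "\<dots> \<le> max C 0 * norm h ^ 2 ^ n"
        by (intro mult_left_mono norm_power_ineq) auto
      finally show ?thesis .
    qed
  qed (simp_all add: nn fnorm_nonneg[OF fE])
  then have h: "fnorm E (left_shift h f) \<le> fnorm E f * (norm a)\<^sup>2"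
    by (simp add: h_def cstar_identity)
  have "(fnorm E (left_shift a f))\<^sup>2 \<le> fnorm E f * fnorm E (left_shift h f)"
    unfolding h_def by (rule sq)
  also have "\<dots> \<le> fnorm E f * (fnorm E f * (norm a)\<^sup>2)"
    using h by (rule mult_left_mono) (rule fnorm_nonneg[OF fE])
  also have "\<dots> = (norm a * fnorm E f)\<^sup>2"
    by (simp add: power2_eq_square)
  finally show ?thesis
    by (rule power2_le_imp_le) (simp add: fnorm_nonneg[OF fE])
qed

text \<open>Pairing the shifted function with an element q of the span gives
  <\<open>\<pi>(star a) q\<close>, f>, and on the span the bound is already known. So
  \<open>mem_criterion\<close> yields membership and norm at once, in place of an extension by
  continuity.\<close>

lemma left_shift_bounded:
  assumes f: "f \<in> vecs E"
  shows "left_shift a f \<in> vecs E \<and> fnorm E (left_shift a f) \<le> norm a * fnorm E f"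
proof (rule mem_criterion)
  show "0 \<le> norm a * fnorm E f"
    by (simp add: fnorm_nonneg[OF f])
  fix Y :: "('x \<times> 'a \<times> 'h) set" and c
  assume "finite Y"
  then have q: "(\<lambda>x. \<Sum>y\<in>Y. c y * k x y) \<in> kspan k"
    by (rule kspanI)
  define q where "q = (\<lambda>x. \<Sum>y\<in>Y. c y * k x y)"
  have "(\<Sum>y\<in>Y. cnj (c y) * left_shift a f y) 
      = (\<Sum>y\<in>Y. cnj (c y) * f (fst y, star a * fst (snd y), snd (snd y)))"
    by (intro sum.cong refl) (auto simp: left_shift_def split: prod.splits)
  also have "\<dots> = ip E (left_shift (star a) q) f"
    unfolding q_def left_shift_kspan_sum using f
    by (simp only: ip_sum_left scale_in kfun_in ip_scale_left reproducing)
  finally have "cmod (\<Sum>y\<in>Y. cnj (c y) * left_shift a f y) \<le> fnorm E (left_shift (star a) q) * fnorm E f"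
    using Cauchy_Schwarz[OF left_shift_kspan[OF q] f] by (simp add: q_def)
  also have "\<dots> \<le> (norm (star a) * fnorm E q) * fnorm E f"
    unfolding q_def by (intro mult_right_mono left_shift_bound_kspan q fnorm_nonneg f)
  finally show "cmod (\<Sum>y\<in>Y. cnj (c y) * left_shift a f y)
      \<le> norm a * fnorm E f * fnorm E (\<lambda>x. \<Sum>y\<in>Y. c y * k x y)"
    by (simp add: norm_star q_def mult_ac)
qed

lemmas left_shift_in [simp] = left_shift_bounded[THEN conjunct1]
  and fnorm_left_shift = left_shift_bounded[THEN conjunct2]

lemma fun_bounded_op_left_shift: "fun_bounded_op E (left_shift a)"
  unfolding fun_bounded_op_def
  by (intro conjI exI[of _ "norm a"] ballI allI fnorm_left_shift left_shift_in)
    (auto simp: left_shift_def fun_eq_iff)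

lemma ip_left_shift:
  assumes f: "f \<in> vecs E" and g: "g \<in> vecs E"
  shows "ip E (left_shift a f) g = ip E f (left_shift (star a) g)"
proof -
  obtain F where F: "\<And>n. F n \<in> kspan k" "\<And>n. F n \<in> vecs E" "(\<lambda>n. fdist E (F n) f) \<longlonglongrightarrow> 0"
    using kspan_approx[OF f] by blast
  have "(\<lambda>n. ip E (left_shift a (F n)) g) \<longlonglongrightarrow> ip E (left_shift a f) g"
    by (intro tendsto_ip op_fconv[OF fun_bounded_op_left_shift] left_shift_in F f g) simp
  moreover have "(\<lambda>n. ip E (F n) (left_shift (star a) g)) \<longlonglongrightarrow> ip E f (left_shift (star a) g)"
    by (intro tendsto_ip left_shift_in F f g) simp
  ultimately show ?thesis
    using ip_left_shift_kspan[OF F(1) g left_shift_in[OF g]] LIMSEQ_unique by simp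
qed

text \<open>The shift witnesses the choice in \<open>factor_pi\<close>, and by \<open>op_eqI\<close>
  any other admissible choice agrees with it on the space.\<close>

lemma factor_pi_eq:
  assumes "f \<in> vecs E"
  shows "factor_pi L a f = left_shift a f"
proof -
  have *: "fun_bounded_op E (factor_pi L a) \<and>
     (\<forall>t b v. factor_pi L a (kfun k (t, b, v)) = kfun k (t, a * b, v))"
    unfolding factor_pi_def
    by (rule someI[of _ "left_shift a"]) (simp add: fun_bounded_op_left_shift left_shift_kfun)
  show ?thesis
  proof (rule op_eqI[OF conjunct1[OF *] fun_bounded_op_left_shift _ assms])
    show "factor_pi L a (kfun k y) = left_shift a (kfun k y)" for y
      using * left_shift_kfun by (cases y) simp
  qed
qed

text \<open>This is the existence of V(s)* g. For g in the span the vector is the explicit sum of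
  c_y L(s, t_y)(b_y) v_y; in general such vectors for an approximating sequence form a Cauchy
  sequence in \<open>'h\<close>, whose completeness gives the limit.\<close>

lemma adjoint_vector_exists:
  assumes g: "g \<in> vecs E"
  shows "\<exists>w. \<forall>u. cinner u w = g (s, 1, u)"
proof -
  have span: "\<exists>w. \<forall>u. cinner u w = f (s, 1, u)" if fk: "f \<in> kspan k" for f
  proof -
    obtain c Y where f: "f = (\<lambda>x. \<Sum>y\<in>Y. c y * k x y)"
      using fk by (rule kspanE)
    have "cinner u (\<Sum>y\<in>Y. c y *\<^sub>C L s (fst y) (fst (snd y)) (snd (snd y))) = f (s, 1, u)" for u
      by (simp add: f cinner_sum_right cinner_scaleC_right scalar_kernel_def star_one case_prod_beta)
    then show ?thesis by blast
  qed
  obtain F where F: "\<And>n. F n \<in> kspan k" "\<And>n. F n \<in> vecs E" "(\<lambda>n. fdist E (F n) g) \<longlonglongrightarrow> 0"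
    using kspan_approx[OF g] by blast
  obtain W where W: "\<And>n u. cinner u (W n) = F n (s, 1, u)"
    using span[OF F(1)] by metis
  obtain D where D: "0 \<le> D" "\<And>b v. fnorm E (kfun k (s, b, v)) \<le> D * norm b * norm v"
    using fnorm_kfun_bound by blast
  have dist: "norm (W m - W n) \<le> D * fdist E (F m) (F n)" for m n
  proof (cases "W m - W n = 0")
    case True
    then show ?thesis using D(1) fdist_nonneg[OF F(2) F(2), of m n] by simp
  next
    case False
    \<comment> \<open>Testing with the difference itself gives norm(w)^2 on the left and a factor
      norm(w) on the right, which cancels.\<close>
    let ?w = "W m - W n"
    have "(norm ?w)\<^sup>2 = cmod (cinner ?w ?w)"
      by (simp add: cinner_self norm_power)
    also have "cinner ?w ?w = F m (s, 1, ?w) - F n (s, 1, ?w)"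
      by (simp only: cinner_diff_right[of ?w] W)
    also have "cmod \<dots> \<le> fnorm E (kfun k (s, 1, ?w)) * fdist E (F m) (F n)"
      using eval_bound[OF diff_in[OF F(2)[of m] F(2)[of n]], of "(s, 1, ?w)"] by (simp add: fdist_def)
    also have "\<dots> \<le> (D * norm (1::'a) * norm ?w) * fdist E (F m) (F n)"
      by (intro mult_right_mono D fdist_nonneg F)
    finally have "norm ?w * norm ?w \<le> norm ?w * (D * fdist E (F m) (F n))"
      by (simp add: power2_eq_square mult_ac)
    then show ?thesis using False by simp
  qed
  have "Cauchy W"
    unfolding Cauchy_def
  proof (intro allI impI)
    fix e :: real assume "e > 0"
    \<comment> \<open>The half pays for the detour through \<open>g\<close>, and D + 1 avoids
      division by zero.\<close>
    then have e: "e / (D + 1) / 2 > 0" using D(1) by simp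
    then obtain N where N: "\<And>n. n \<ge> N \<Longrightarrow> fdist E (F n) g < e / (D + 1) / 2"
      using order_tendstoD(2)[OF F(3) e] by (auto simp: eventually_sequentially)
    have "dist (W m) (W n) < e" if mn: "m \<ge> N" "n \<ge> N" for m n
    proof -
      have "fdist E (F m) (F n) < e / (D + 1)"
        using fdist_triangle[OF F(2) g F(2), of m n] fdist_commute[OF F(2) g, of n] N[OF mn(1)] N[OF mn(2)]
        by linarith
      then have "(D + 1) * fdist E (F m) (F n) < (D + 1) * (e / (D + 1))"
        using D(1) by (intro mult_strict_left_mono) auto
      moreover have "dist (W m) (W n) \<le> (D + 1) * fdist E (F m) (F n)"
        using dist[of m n] fdist_nonneg[OF F(2) F(2), of m n] by (simp add: dist_norm distrib_right)
      ultimately show ?thesis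
        using D(1) by simp
    qed
    then show "\<exists>M. \<forall>m\<ge>M. \<forall>n\<ge>M. dist (W m) (W n) < e" by blast
  qed
  then obtain w where w: "W \<longlonglongrightarrow> w"
    using Cauchy_convergent convergent_def by blast
  have "cinner u w = g (s, 1, u)" for u
  proof -
    have "(\<lambda>n. cinner u (W n) - cinner u w) \<longlonglongrightarrow> 0"
    proof (rule Lim_null_comparison)
      show "\<forall>\<^sub>F n in sequentially. norm (cinner u (W n) - cinner u w) \<le> norm u * norm (W n - w)"
        by (simp add: cinner_diff_right[symmetric] cinner_Cauchy_Schwarz)
      show "(\<lambda>n. norm u * norm (W n - w)) \<longlonglongrightarrow> 0"
        using w by (intro tendsto_mult_right_zero tendsto_norm_zero) (simp add: LIM_zero)
    qed
    then have "(\<lambda>n. cinner u (W n)) \<longlonglongrightarrow> cinner u w"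
      by (simp add: LIM_zero_iff)
    moreover have "(\<lambda>n. cinner u (W n)) \<longlonglongrightarrow> g (s, 1, u)"
      unfolding W by (rule fconv_pointwise[OF F(2) g F(3)])
    ultimately show ?thesis by (rule LIMSEQ_unique)
  qed
  then show ?thesis by blast
qed

text \<open>Formally <u, V(s)* g> = <V(s) u, g>, and V(s) u is the kernel function at (s, 1, u). The
  definite description in \<open>adjoint_into\<close> asks for uniqueness too, which is
  \<open>cinner_ext\<close>.\<close>

lemma cinner_factor_V_adj:
  assumes g: "g \<in> vecs E"
  shows "cinner u (factor_V_adj L s g) = g (s, 1, u)"
proof -
  obtain w where w: "\<And>u. cinner u w = g (s, 1, u)"
    using adjoint_vector_exists[OF g] by blast
  have ipg: "ip E g (factor_V L s v) = cnj (g (s, 1, v))" for v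
    using ip_cnj[OF g kfun_in] reproducing[OF g] by (simp add: factor_V_def)
  have w': "cinner w v = ip E g (factor_V L s v)" for v
    unfolding ipg w[symmetric] by (rule cinner_commute)
  have "factor_V_adj L s g = w"
    unfolding factor_V_adj_def adjoint_into_def
  proof (rule the_equality)
    show "\<forall>v. cinner w v = ip E g (factor_V L s v)" using w' by simp
    fix w2 assume w2: "\<forall>v. cinner w2 v = ip E g (factor_V L s v)"
    show "w2 = w"
    proof (rule cinner_ext)
      fix u
      show "cinner u w2 = cinner u w"
        unfolding cinner_commute[of u w2] cinner_commute[of u w] using w2 w' by simp
    qed
  qed
  then show ?thesis by (simp add: w)
qed

lemma factor_V_adj_eqI:
  assumes "g \<in> vecs E" "\<And>u. cinner u w = g (s, 1, u)"
  shows "factor_V_adj L s g = w"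
  by (rule cinner_ext) (simp add: cinner_factor_V_adj assms)

end

section \<open>Radon-Nikodym derivatives\<close>

lemma scalar_kernel_diff:
  "scalar_kernel (\<lambda>s t a u. L s t a u - K s t a u) x y = scalar_kernel L x y - scalar_kernel K x y"
  by (simp add: scalar_kernel_def cinner_diff_right case_prod_beta)

context gpd_kernel
begin

lemma pi_commutant_iff:
  "A \<in> pi_commutant L \<longleftrightarrow> fun_bounded_op E A \<and>
     (\<forall>a. \<forall>f\<in>vecs E. A (left_shift a f) = left_shift a (A f))"
proof -
  have "A (factor_pi L a f) = A (left_shift a f)" "factor_pi L a (A f) = left_shift a (A f)"
    if "fun_bounded_op E A" "f \<in> vecs E" for a f
    using that op_in[OF that] by (simp_all add: factor_pi_eq)
  then show ?thesis
    unfolding pi_commutant_def by auto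
qed

lemma fnorm_kspan_sum_sq:
  "(\<Sum>y\<in>Y. \<Sum>z\<in>Y. cnj (c y) * c z * k y z) = complex_of_real ((fnorm E (\<lambda>x. \<Sum>y\<in>Y. c y * k x y))\<^sup>2)"
proof -
  have "ip E (\<lambda>x. \<Sum>y\<in>Y. c y * k x y) (\<lambda>x. \<Sum>y\<in>Y. c y * k x y)
      = (\<Sum>y\<in>Y. cnj (c y) * (\<Sum>z\<in>Y. c z * k y z))"
    by (rule ip_kspan_left[OF kspan_sum_in])
  then show ?thesis
    by (simp add: ip_self_eq[OF kspan_sum_in] sum_distrib_left mult.assoc)
qed

end

text \<open>The difference of the squared norms is the Gram sum of L - K with the same
  coefficients.\<close>

lemma dominated_fnorm_kspan_sum:
  assumes "K \<in> gpd_kernels" "L \<in> gpd_kernels" "K \<unlhd> L" "finite Y"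
  shows "fnorm (kernel_space K) (\<lambda>x. \<Sum>y\<in>Y. c y * scalar_kernel K x y)
    \<le> fnorm (kernel_space L) (\<lambda>x. \<Sum>y\<in>Y. c y * scalar_kernel L x y)"
proof -
  interpret K: gpd_kernel K by standard (rule assms)
  interpret L: gpd_kernel L by standard (rule assms)
  have "psd_kernel (scalar_kernel (\<lambda>s t a u. L s t a u - K s t a u))"
    using assms(3) by (intro psd_scalar_kernel) (simp add: kernel_le_def)
  then have "(\<Sum>y\<in>Y. \<Sum>z\<in>Y. cnj (c y) * c z * scalar_kernel (\<lambda>s t a u. L s t a u - K s t a u) y z) \<in> \<real>\<^sub>\<ge>\<^sub>0"
    using assms(4) by (simp add: psd_kernel_def)
  also have "(\<Sum>y\<in>Y. \<Sum>z\<in>Y. cnj (c y) * c z * scalar_kernel (\<lambda>s t a u. L s t a u - K s t a u) y z)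
      = (\<Sum>y\<in>Y. \<Sum>z\<in>Y. cnj (c y) * c z * scalar_kernel L y z)
        - (\<Sum>y\<in>Y. \<Sum>z\<in>Y. cnj (c y) * c z * scalar_kernel K y z)"
    by (simp add: scalar_kernel_diff right_diff_distrib sum_subtractf)
  finally have "(fnorm (kernel_space K) (\<lambda>x. \<Sum>y\<in>Y. c y * scalar_kernel K x y))\<^sup>2
    \<le> (fnorm (kernel_space L) (\<lambda>x. \<Sum>y\<in>Y. c y * scalar_kernel L x y))\<^sup>2"
    unfolding K.fnorm_kspan_sum_sq L.fnorm_kspan_sum_sq
    by (simp add: complex_nonneg_Reals_iff)
  then show ?thesis
    by (rule power2_le_imp_le) (rule L.fnorm_nonneg[OF L.kspan_sum_in])
qed

text \<open>Contractive inclusion of one space in the other: pairing \<open>g\<close> with a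
  combination of kernel functions involves only coefficients and values of \<open>g\<close>, hence
  is the same sum for \<open>K\<close> and \<open>L\<close>, and passing from \<open>K\<close> to
  \<open>L\<close> can only increase the norm of the combination.\<close>

lemma dominated_kernel_space_subset:
  assumes "K \<in> gpd_kernels" "L \<in> gpd_kernels" "K \<unlhd> L" "g \<in> vecs (kernel_space K)"
  shows "g \<in> vecs (kernel_space L) \<and> fnorm (kernel_space L) g \<le> fnorm (kernel_space K) g"
proof -
  interpret K: gpd_kernel K by standard (rule assms)
  interpret L: gpd_kernel L by standard (rule assms)
  show ?thesis
  proof (rule L.mem_criterion)
    show "0 \<le> fnorm K.E g"
      by (rule K.fnorm_nonneg[OF assms(4)])
    fix Y :: "('a \<times> 'b \<times> 'c) set" and c
    assume Y: "finite Y"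
    have "cmod (\<Sum>y\<in>Y. cnj (c y) * g y) \<le> fnorm K.E (\<lambda>x. \<Sum>y\<in>Y. c y * K.k x y) * fnorm K.E g"
      unfolding K.ip_kspan_left[OF assms(4), symmetric]
      by (rule K.Cauchy_Schwarz[OF K.kspan_sum_in assms(4)])
    also have "\<dots> \<le> fnorm L.E (\<lambda>x. \<Sum>y\<in>Y. c y * L.k x y) * fnorm K.E g"
      by (intro mult_right_mono dominated_fnorm_kspan_sum assms Y K.fnorm_nonneg)
    finally show "cmod (\<Sum>y\<in>Y. cnj (c y) * g y) \<le> fnorm K.E g * fnorm L.E (\<lambda>x. \<Sum>y\<in>Y. c y * L.k x y)"
      by (simp add: mult.commute)
  qed
qed

text \<open>For the inclusion \<open>J\<close> of the space of \<open>K\<close> in that of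
  \<open>L\<close>, J* f has at x the value of the pairing of K_x with f taken in the space of
  \<open>L\<close>. So the operator \<open>A\<close> below is \<open>J J*\<close>, and it maps each
  kernel function of \<open>L\<close> to the one of \<open>K\<close> at the same point.\<close>

lemma rn_derivative_exists:
  assumes K: "K \<in> gpd_kernels" and L: "L \<in> gpd_kernels" and KL: "K \<unlhd> L"
  shows "\<exists>A. is_rn_derivative K L A"
proof -
  interpret K: gpd_kernel K by standard (rule K)
  interpret L: gpd_kernel L by standard (rule L)
  define \<kappa> where "\<kappa> = kfun K.k"
  have \<kappa>in [simp]: "\<kappa> x \<in> vecs L.E" for x
    using dominated_kernel_space_subset[OF K L KL K.kfun_in] by (simp add: \<kappa>_def)
  define A where "A f = (\<lambda>x. ip L.E (\<kappa> x) f)" for f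
  have \<kappa>sum: "(\<lambda>x. \<Sum>y\<in>Y. c y * \<kappa> y x) = (\<lambda>x. \<Sum>y\<in>Y. c y * K.k x y)" for c Y
    by (simp add: \<kappa>_def kfun_def)
  have A_in: "A f \<in> vecs L.E \<and> fnorm L.E (A f) \<le> fnorm L.E f" if f: "f \<in> vecs L.E" for f
  proof (rule L.mem_criterion)
    show "0 \<le> fnorm L.E f" by (rule L.fnorm_nonneg[OF f])
    fix Y :: "('a \<times> 'b \<times> 'c) set" and c
    assume Y: "finite Y"
    have in1: "(\<lambda>x. \<Sum>y\<in>Y. c y * \<kappa> y x) \<in> vecs L.E"
      by (intro L.sum_in L.scale_in \<kappa>in)
    have "(\<Sum>y\<in>Y. cnj (c y) * A f y) = ip L.E (\<lambda>x. \<Sum>y\<in>Y. (\<lambda>x. c y * \<kappa> y x) x) f"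
      using f by (simp only: A_def L.ip_sum_left L.scale_in \<kappa>in L.ip_scale_left)
    then have "cmod (\<Sum>y\<in>Y. cnj (c y) * A f y) \<le> fnorm L.E (\<lambda>x. \<Sum>y\<in>Y. c y * \<kappa> y x) * fnorm L.E f"
      using L.Cauchy_Schwarz[OF in1 f] by simp
    \<comment> \<open>Domination enters twice: the inclusion is contractive on the combination of
      the K_y, and the norm of this combination is at most that of the same combination of the
      L_y.\<close>
    also have "\<dots> \<le> fnorm K.E (\<lambda>x. \<Sum>y\<in>Y. c y * \<kappa> y x) * fnorm L.E f"
      unfolding \<kappa>sum using dominated_kernel_space_subset[OF K L KL K.kspan_sum_in]
      by (intro mult_right_mono L.fnorm_nonneg f) simp
    also have "\<dots> \<le> fnorm L.E (\<lambda>x. \<Sum>y\<in>Y. c y * L.k x y) * fnorm L.E f"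
      unfolding \<kappa>sum by (intro mult_right_mono dominated_fnorm_kspan_sum L.fnorm_nonneg f K L KL Y)
    finally show "cmod (\<Sum>y\<in>Y. cnj (c y) * A f y) \<le> fnorm L.E f * fnorm L.E (\<lambda>x. \<Sum>y\<in>Y. c y * L.k x y)"
      by (simp add: mult.commute)
  qed
  have A: "fun_bounded_op L.E A"
    unfolding fun_bounded_op_def
  proof (intro conjI ballI allI exI[of _ 1])
    show "A f \<in> vecs L.E" "fnorm L.E (A f) \<le> 1 * fnorm L.E f" if "f \<in> vecs L.E" for f
      using A_in[OF that] by simp_all
    show "A (\<lambda>x. f x + g x) = (\<lambda>x. A f x + A g x)" if "f \<in> vecs L.E" "g \<in> vecs L.E" for f g
      using that by (simp add: A_def L.ip_add_right)
    show "A (\<lambda>x. c * f x) = (\<lambda>x. c * A f x)" if "f \<in> vecs L.E" for c f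
      using that by (simp add: A_def L.ip_scale_right)
  qed
  have A_kfun: "A (kfun L.k y) = \<kappa> y" for y
  proof
    fix x
    have "A (kfun L.k y) x = cnj (\<kappa> x y)"
      using L.ip_cnj[OF \<kappa>in L.kfun_in, of x y] L.reproducing[OF \<kappa>in, of y x] by (simp add: A_def)
    also have "\<dots> = \<kappa> y x"
      using psd_kernel_hermitian[OF psd_scalar_kernel[OF K], of x y] by (simp add: \<kappa>_def kfun_def)
    finally show "A (kfun L.k y) x = \<kappa> y x" .
  qed
  have A_sum: "A (\<lambda>x. \<Sum>y\<in>Y. c y * L.k x y) = (\<lambda>x. \<Sum>y\<in>Y. c y * K.k x y)" for c Y
  proof -
    have "(\<lambda>x. \<Sum>y\<in>Y. c y * L.k x y) = (\<lambda>x. \<Sum>y\<in>Y. (\<lambda>x. c y * kfun L.k y x) x)"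
      by (simp add: kfun_def)
    then have "A (\<lambda>x. \<Sum>y\<in>Y. c y * L.k x y) = (\<lambda>x. \<Sum>y\<in>Y. c y * \<kappa> y x)"
      by (simp only: L.op_sum[OF A] L.op_scale[OF A] L.scale_in L.kfun_in A_kfun)
    then show ?thesis by (simp add: \<kappa>sum)
  qed
  \<comment> \<open>The adjoint shift is taken in the space of \<open>L\<close> but acts on a kernel
    function of \<open>K\<close>; since the shift does not depend on the kernel, it moves that
    function as in the space of \<open>K\<close>.\<close>
  have commute: "A (left_shift a f) = left_shift a (A f)" if f: "f \<in> vecs L.E" for a f
  proof
    fix x :: "'a \<times> 'b \<times> 'c"
    obtain t b v where x: "x = (t, b, v)" by (cases x)
    have "ip L.E (\<kappa> (t, b, v)) (left_shift a f) = ip L.E (left_shift (star a) (\<kappa> (t, b, v))) f"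
      using L.ip_left_shift[OF \<kappa>in f, of "star a"] by (simp add: star_star)
    also have "left_shift (star a) (\<kappa> (t, b, v)) = \<kappa> (t, star a * b, v)"
      unfolding \<kappa>_def by (rule K.left_shift_kfun)
    finally show "A (left_shift a f) x = left_shift a (A f) x"
      by (simp add: x A_def)
  qed
  have id_A: "fun_bounded_op L.E (\<lambda>f x. f x - A f x)"
    by (rule L.fun_bounded_op_id_minus[OF A])
  have "is_rn_derivative K L A"
    unfolding is_rn_derivative_def
  proof (intro conjI ballI allI)
    show "A \<in> pi_commutant L"
      using A commute by (simp add: L.pi_commutant_iff)
    show "ip L.E f (A f) \<in> \<real>\<^sub>\<ge>\<^sub>0" if "f \<in> vecs L.E" for f
    proof (rule L.op_nonnegI[OF A _ that])
      fix q assume "q \<in> kspan L.k"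
      then obtain c Y where q: "finite Y" "q = (\<lambda>x. \<Sum>y\<in>Y. c y * L.k x y)"
        by (rule kspanE)
      have qin: "q \<in> vecs L.E" unfolding q by (rule L.kspan_sum_in)
      have "ip L.E q (A q) = (\<Sum>y\<in>Y. cnj (c y) * A q y)"
        using L.ip_kspan_left[OF L.op_in[OF A qin], where c=c and Y=Y] by (simp add: q(2))
      also have "\<dots> = (\<Sum>y\<in>Y. \<Sum>z\<in>Y. cnj (c y) * c z * K.k y z)"
        by (simp add: q(2) A_sum sum_distrib_left mult.assoc)
      finally show "ip L.E q (A q) \<in> \<real>\<^sub>\<ge>\<^sub>0"
        by (simp only: K.fnorm_kspan_sum_sq nonneg_Reals_of_real_iff zero_le_power2)
    qed
    show "ip L.E f (\<lambda>x. f x - A f x) \<in> \<real>\<^sub>\<ge>\<^sub>0" if "f \<in> vecs L.E" for f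
    proof (rule L.op_nonnegI[OF id_A _ that])
      fix q assume "q \<in> kspan L.k"
      then obtain c Y where q: "finite Y" "q = (\<lambda>x. \<Sum>y\<in>Y. c y * L.k x y)"
        by (rule kspanE)
      have qin: "q \<in> vecs L.E" unfolding q by (rule L.kspan_sum_in)
      have "ip L.E q (\<lambda>x. q x - A q x) = ip L.E q q - ip L.E q (A q)"
        by (intro L.ip_diff_right qin L.op_in[OF A])
      also have "ip L.E q (A q) = (\<Sum>y\<in>Y. cnj (c y) * A q y)"
        using L.ip_kspan_left[OF L.op_in[OF A qin], where c=c and Y=Y] by (simp add: q(2))
      also have "\<dots> = (\<Sum>y\<in>Y. \<Sum>z\<in>Y. cnj (c y) * c z * K.k y z)"
        by (simp add: q(2) A_sum sum_distrib_left mult.assoc)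
      also have "\<dots> = complex_of_real ((fnorm K.E (\<lambda>x. \<Sum>y\<in>Y. c y * K.k x y))\<^sup>2)"
        by (rule K.fnorm_kspan_sum_sq)
      also have "ip L.E q q = complex_of_real ((fnorm L.E (\<lambda>x. \<Sum>y\<in>Y. c y * L.k x y))\<^sup>2)"
        using L.ip_self_eq[OF qin] by (simp add: q(2))
      finally have eq: "ip L.E q (\<lambda>x. q x - A q x)
        = complex_of_real ((fnorm L.E (\<lambda>x. \<Sum>y\<in>Y. c y * L.k x y))\<^sup>2
            - (fnorm K.E (\<lambda>x. \<Sum>y\<in>Y. c y * K.k x y))\<^sup>2)"
        by simp
      have "(fnorm K.E (\<lambda>x. \<Sum>y\<in>Y. c y * K.k x y))\<^sup>2 \<le> (fnorm L.E (\<lambda>x. \<Sum>y\<in>Y. c y * L.k x y))\<^sup>2"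
        by (intro power_mono dominated_fnorm_kspan_sum K L KL q(1) K.fnorm_nonneg[OF K.kspan_sum_in])
      then show "ip L.E q (\<lambda>x. q x - A q x) \<in> \<real>\<^sub>\<ge>\<^sub>0"
        unfolding eq by (subst nonneg_Reals_of_real_iff) simp
    qed
    show "K s t a v = factor_V_adj L s (factor_pi L a (A (factor_V L t v)))" for s t a v
    proof -
      have 1: "A (factor_V L t v) = \<kappa> (t, 1, v)"
        unfolding factor_V_def by (rule A_kfun)
      have 2: "factor_pi L a (\<kappa> (t, 1, v)) = \<kappa> (t, a, v)"
        using K.left_shift_kfun[of a t 1 v] by (simp add: L.factor_pi_eq) (simp add: \<kappa>_def)
      have "factor_V_adj L s (\<kappa> (t, a, v)) = K s t a v"
        by (rule L.factor_V_adj_eqI) (simp_all, simp add: \<kappa>_def kfun_def scalar_kernel_def star_one)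
      then show ?thesis by (simp add: 1 2)
    qed
  qed
  then show ?thesis by (rule exI[of "is_rn_derivative K L" A])
qed

section \<open>Kernels attached to operators in the commutant\<close>

context gpd_kernel
begin

definition op_kernel where
  "op_kernel A = (\<lambda>s t a v. factor_V_adj L s (factor_pi L a (A (factor_V L t v))))"

text \<open>\<open>A\<close> may be moved past \<open>\<pi>(a)\<close>, and
  \<open>\<pi>(a) V(t) v\<close> is the kernel function at (t, a, v).\<close>

lemma cinner_op_kernel:
  assumes A: "A \<in> pi_commutant L"
  shows "cinner u (op_kernel A s t a v) = A (kfun k (t, a, v)) (s, 1, u)"
proof -
  have bA: "fun_bounded_op E A" and com: "\<And>a f. f \<in> vecs E \<Longrightarrow> A (left_shift a f) = left_shift a (A f)"
    using A by (simp_all add: pi_commutant_iff)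
  have "factor_pi L a (A (factor_V L t v)) = A (kfun k (t, a, v))"
    using com[OF kfun_in, of a "(t, 1, v)"] left_shift_kfun[of a t 1 v]
    by (simp add: factor_V_def factor_pi_eq op_in[OF bA])
  then show ?thesis
    by (simp add: op_kernel_def cinner_factor_V_adj op_in[OF bA])
qed

text \<open>In other words, the scalar kernel of \<open>op_kernel A\<close> at x, y is <k_x, A k_y>.
  Its Gram sums are thus values of the quadratic form of \<open>A\<close>.\<close>

lemma op_kfun_eval:
  assumes A: "A \<in> pi_commutant L"
  shows "A (kfun k (t, a, v)) (s, b, u) = cinner u (op_kernel A s t (star b * a) v)"
proof -
  have com: "\<And>a f. f \<in> vecs E \<Longrightarrow> A (left_shift a f) = left_shift a (A f)"
    using A by (simp add: pi_commutant_iff)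
  show ?thesis
    unfolding cinner_op_kernel[OF A] left_shift_kfun[symmetric] com[OF kfun_in]
    by (simp add: star_star)
qed

lemma kfun_add_alg: "kfun k (t, a + b, v) = (\<lambda>x. kfun k (t, a, v) x + kfun k (t, b, v) x)"
  by (rule ext) (simp add: kfun_def scalar_kernel_def case_prod_beta distrib_left gpd_add[OF gpd] cinner_add_right)

lemma kfun_scale_alg: "kfun k (t, c *\<^sub>C a, v) = (\<lambda>x. c * kfun k (t, a, v) x)"
  by (rule ext) (simp add: kfun_def scalar_kernel_def case_prod_beta scaleC_mult_right gpd_scale[OF gpd] cinner_scaleC_right)

lemma kfun_add_vec: "kfun k (t, a, u + v) = (\<lambda>x. kfun k (t, a, u) x + kfun k (t, a, v) x)"
  by (rule ext) (simp add: kfun_def scalar_kernel_def case_prod_beta gpd_op_add[OF gpd] cinner_add_right)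

lemma kfun_scale_vec: "kfun k (t, a, c *\<^sub>C v) = (\<lambda>x. c * kfun k (t, a, v) x)"
  by (rule ext) (simp add: kfun_def scalar_kernel_def case_prod_beta gpd_op_scale[OF gpd] cinner_scaleC_right)

lemma op_kernel_bounded_op_maps:
  assumes A: "A \<in> pi_commutant L"
  shows "op_kernel A s t \<in> bounded_op_maps"
proof -
  have bA: "fun_bounded_op E A"
    using A by (simp add: pi_commutant_iff)
  note lin = kfun_add_alg kfun_scale_alg kfun_add_vec kfun_scale_vec op_add[OF bA] op_scale[OF bA]
    cinner_op_kernel[OF A] cinner_add_right cinner_scaleC_right
  have l1: "op_kernel A s t (a + b) u = op_kernel A s t a u + op_kernel A s t b u" for a b u
    by (rule cinner_ext) (simp add: lin)
  have l2: "op_kernel A s t (c *\<^sub>C a) u = c *\<^sub>C op_kernel A s t a u" for c a u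
    by (rule cinner_ext) (simp add: lin)
  have l3: "op_kernel A s t a (u + v) = op_kernel A s t a u + op_kernel A s t a v" for a u v
    by (rule cinner_ext) (simp add: lin)
  have l4: "op_kernel A s t a (c *\<^sub>C u) = c *\<^sub>C op_kernel A s t a u" for c a u
    by (rule cinner_ext) (simp add: lin)
  obtain C where C: "C > 0" "\<And>f. f \<in> vecs E \<Longrightarrow> fnorm E (A f) \<le> C * fnorm E f"
    using op_bounded[OF bA] by blast
  obtain D1 where D1: "0 \<le> D1" "\<And>b v. fnorm E (kfun k (s, b, v)) \<le> D1 * norm b * norm v"
    using fnorm_kfun_bound by blast
  obtain D2 where D2: "0 \<le> D2" "\<And>b v. fnorm E (kfun k (t, b, v)) \<le> D2 * norm b * norm v"
    using fnorm_kfun_bound by blast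
  define M where "M = D1 * (C * D2)"
  have M: "0 \<le> M" using C D1 D2 by (simp add: M_def)
  have bound: "norm (op_kernel A s t a u) \<le> M * norm a * norm u" for a u
  proof (cases "op_kernel A s t a u = 0")
    case True
    then show ?thesis using M by simp
  next
    case False
    let ?w = "op_kernel A s t a u"
    have "(norm ?w)\<^sup>2 = cmod (cinner ?w ?w)"
      by (simp add: cinner_self norm_power)
    also have "cinner ?w ?w = A (kfun k (t, a, u)) (s, 1, ?w)"
      by (rule cinner_op_kernel[OF A])
    also have "cmod \<dots> \<le> fnorm E (kfun k (s, 1, ?w)) * fnorm E (A (kfun k (t, a, u)))"
      by (rule eval_bound[OF op_in[OF bA kfun_in]])
    also have "\<dots> \<le> (D1 * norm (1::'a) * norm ?w) * (C * (D2 * norm a * norm u))"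
      using C D1 D2 
      by (intro mult_mono D1(2) order_trans[OF C(2)[OF kfun_in]] mult_left_mono D2(2)
          fnorm_nonneg op_in[OF bA] kfun_in) simp_all
    finally have "norm ?w * norm ?w \<le> (M * norm a * norm u) * norm ?w"
      by (simp add: M_def power2_eq_square mult_ac)
    then show ?thesis using False by simp
  qed
  have "op_kernel A s t a \<in> bounded_ops" for a
  proof -
    have "bounded_linear (op_kernel A s t a)"
      by (rule bounded_linear_intro[of _ "M * norm a"])
        (use l3 l4 bound in \<open>simp_all flip: scaleC_of_real add: mult.commute\<close>)
    then show ?thesis
      using l3 l4 by (simp add: bounded_ops_def complex_linear_def)
  qed
  moreover have "onorm (op_kernel A s t a) \<le> M * norm a" for a
    using bound M by (intro onorm_bound) simp_all
  ultimately show ?thesis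
    unfolding bounded_op_maps_def using l1 l2 by blast
qed

lemma op_kernel_gpd:
  assumes A: "A \<in> pi_commutant L" and pos: "\<And>f. f \<in> vecs E \<Longrightarrow> ip E f (A f) \<in> \<real>\<^sub>\<ge>\<^sub>0"
  shows "op_kernel A \<in> gpd_kernels"
proof -
  have bA: "fun_bounded_op E A"
    using A by (simp add: pi_commutant_iff)
  have "(\<Sum>i<N. \<Sum>j<N. cinner (u i) (op_kernel A (s i) (s j) (star (a i) * a j) (u j))) \<in> \<real>\<^sub>\<ge>\<^sub>0"
    for N :: nat and u s a
  proof -
    define p where "p i = kfun k (s i, a i, u i)" for i
    have "cinner (u i) (op_kernel A (s i) (s j) (star (a i) * a j) (u j)) = ip E (p i) (A (p j))" for i j
      unfolding op_kfun_eval[OF A, symmetric] p_def by (rule reproducing[OF op_in[OF bA kfun_in], symmetric])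
    moreover have "ip E (\<lambda>x. \<Sum>i<N. p i x) (A (\<lambda>x. \<Sum>i<N. p i x)) = (\<Sum>i<N. \<Sum>j<N. ip E (p i) (A (p j)))"
    proof -
      have p: "p i \<in> vecs E" for i by (simp add: p_def)
      have S: "(\<lambda>x. \<Sum>j<N. A (p j) x) \<in> vecs E"
        by (intro sum_in op_in[OF bA] p)
      have "ip E (\<lambda>x. \<Sum>i<N. p i x) (A (\<lambda>x. \<Sum>i<N. p i x)) 
          = ip E (\<lambda>x. \<Sum>i<N. p i x) (\<lambda>x. \<Sum>j<N. A (p j) x)"
        by (subst op_sum[OF bA p]) simp
      also have "\<dots> = (\<Sum>i<N. ip E (p i) (\<lambda>x. \<Sum>j<N. A (p j) x))"
        by (rule ip_sum_left[OF S p])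
      also have "\<dots> = (\<Sum>i<N. \<Sum>j<N. ip E (p i) (A (p j)))"
        by (intro sum.cong refl ip_sum_right p op_in[OF bA])
      finally show ?thesis .
    qed
    moreover have "(\<lambda>x. \<Sum>i<N. p i x) \<in> vecs E"
      unfolding p_def by (intro sum_in kfun_in)
    ultimately show ?thesis
      using pos[of "\<lambda>x. \<Sum>i<N. p i x"] by simp
  qed
  then show ?thesis
    unfolding gpd_kernels_def using op_kernel_bounded_op_maps[OF A] by simp
qed

text \<open>The difference of \<open>L\<close> and the kernel of \<open>A\<close> is the kernel of 1
  - A, which is again in the commutant.\<close>

lemma op_kernel_le:
  assumes A: "A \<in> pi_commutant L" and le: "\<And>f. f \<in> vecs E \<Longrightarrow> ip E f (\<lambda>x. f x - A f x) \<in> \<real>\<^sub>\<ge>\<^sub>0"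
  shows "op_kernel A \<unlhd> L"
proof -
  have bA: "fun_bounded_op E A" and com: "\<And>a f. f \<in> vecs E \<Longrightarrow> A (left_shift a f) = left_shift a (A f)"
    using A by (simp_all add: pi_commutant_iff)
  have B: "(\<lambda>f x. f x - A f x) \<in> pi_commutant L"
    unfolding pi_commutant_iff by (auto simp: fun_bounded_op_id_minus[OF bA] com fun_eq_iff)
  have "(\<lambda>s t a u. L s t a u - op_kernel A s t a u) = op_kernel (\<lambda>f x. f x - A f x)"
  proof (intro ext)
    fix s t a v
    show "L s t a v - op_kernel A s t a v = op_kernel (\<lambda>f x. f x - A f x) s t a v"
      by (rule cinner_ext)
        (simp add: cinner_op_kernel[OF A] cinner_op_kernel[OF B] cinner_diff_right,
         simp add: kfun_def scalar_kernel_def star_one)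
  qed
  then show ?thesis
    unfolding kernel_le_def using op_kernel_gpd[OF B le] by simp
qed

lemma op_scalar_if_kernel_scale:
  assumes A: "A \<in> pi_commutant L" and eq: "op_kernel A = kernel_scale c L" and f: "f \<in> vecs E"
  shows "A f = (\<lambda>x. c * f x)"
proof -
  have bA: "fun_bounded_op E A"
    using A by (simp add: pi_commutant_iff)
  have bc: "fun_bounded_op E (\<lambda>f x. c * f x)"
    by (rule fun_bounded_op_scale)
  show ?thesis
  proof (rule op_eqI[OF bA bc _ f])
    fix y :: "'x \<times> 'a \<times> 'h"
    obtain t a v where y: "y = (t, a, v)" by (cases y)
    show "A (kfun k y) = (\<lambda>x. c * kfun k y x)"
    proof
      fix x :: "'x \<times> 'a \<times> 'h"
      obtain s b u where x: "x = (s, b, u)" by (cases x)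
      show "A (kfun k y) x = c * kfun k y x"
        unfolding x y op_kfun_eval[OF A] eq
        by (simp add: kernel_scale_def cinner_scaleC_right kfun_def scalar_kernel_def)
    qed
  qed
qed

text \<open>Any complex constant is allowed here, so that both the condition on kernels and the one
  on derivatives lead to this statement.\<close>

lemma irreducible_if_scalar_kernels:
  assumes scalar: "\<And>K. K \<in> gpd_kernels \<Longrightarrow> K \<unlhd> L \<Longrightarrow> \<exists>c. K = kernel_scale c L"
  shows "pi_irreducible L"
  unfolding pi_irreducible_def
proof (intro allI impI, elim conjE)
  fix M assume sub: "M \<subseteq> vecs E" and M: "fun_subspace M" and cl: "fclosure E M = M"
    and inv: "\<forall>a. \<forall>f\<in>M. factor_pi L a f \<in> M"
  have inv': "left_shift a f \<in> M" if f: "f \<in> M" for a f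
  proof -
    have "factor_pi L a f \<in> M"
      using inv f by blast
    then show ?thesis
      by (simp add: factor_pi_eq[OF subsetD[OF sub f]])
  qed
  define P where "P f = (SOME g. g \<in> M \<and> (\<forall>q\<in>M. ip E g q = ip E f q))" for f
  have P: "P f \<in> M \<and> (\<forall>q\<in>M. ip E (P f) q = ip E f q)" if f: "f \<in> vecs E" for f
  proof -
    have "\<exists>g. g \<in> M \<and> (\<forall>q\<in>M. ip E g q = ip E f q)"
      using projection_exists[OF M sub f] cl by auto
    then show ?thesis
      unfolding P_def by (rule someI_ex)
  qed
  have Pin: "P f \<in> vecs E" if "f \<in> vecs E" for f
    using P[OF that] sub by blast
  \<comment> \<open>Uniqueness of the projection. Linearity of \<open>P\<close> and its commutation
    with the shifts are obtained by checking that the expected vector lies in \<open>M\<close> and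
    has the right pairings with \<open>M\<close>.\<close>
  have P_eqI: "P f = g" if f: "f \<in> vecs E" and g: "g \<in> M" and eq: "\<And>q. q \<in> M \<Longrightarrow> ip E g q = ip E f q" for f g
  proof -
    have gE: "g \<in> vecs E" using g sub by blast
    have d: "(\<lambda>x. P f x - g x) \<in> M"
      using P[OF f] g by (intro fun_subspace_diff M) auto
    have "ip E (P f) (\<lambda>x. P f x - g x) = ip E g (\<lambda>x. P f x - g x)"
      using P[OF f] d eq[OF d] by simp
    then have "ip E (\<lambda>x. P f x - g x) (\<lambda>x. P f x - g x) = 0"
      using ip_diff_left[OF diff_in[OF Pin[OF f] gE] Pin[OF f] gE] by simp
    then have "(\<lambda>x. P f x - g x) = (\<lambda>x. 0)"
      by (rule definite[OF diff_in[OF Pin[OF f] gE]])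
    then show ?thesis by (simp add: fun_eq_iff)
  qed
  have P_ip: "ip E f (P f) = ip E (P f) (P f)" if "f \<in> vecs E" for f
    using P[OF that] by simp
  have bP: "fun_bounded_op E P"
    unfolding fun_bounded_op_def
  proof (intro conjI ballI allI exI[of _ 1])
    show "P f \<in> vecs E" if "f \<in> vecs E" for f
      by (rule Pin[OF that])
    show "P (\<lambda>x. f x + g x) = (\<lambda>x. P f x + P g x)" if fg: "f \<in> vecs E" "g \<in> vecs E" for f g
    proof (rule P_eqI)
      show "(\<lambda>x. P f x + P g x) \<in> M"
        using P fg by (intro fun_subspace_add M) auto
      show "ip E (\<lambda>x. P f x + P g x) q = ip E (\<lambda>x. f x + g x) q" if "q \<in> M" for q
        using P fg that sub Pin by (simp add: ip_add_left subsetD)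
    qed (simp add: fg)
    show "P (\<lambda>x. c * f x) = (\<lambda>x. c * P f x)" if f: "f \<in> vecs E" for c f
    proof (rule P_eqI)
      show "(\<lambda>x. c * P f x) \<in> M"
        using P f by (intro fun_subspace_scale M) auto
      show "ip E (\<lambda>x. c * P f x) q = ip E (\<lambda>x. c * f x) q" if "q \<in> M" for q
        using P f that sub Pin by (simp add: ip_scale_left subsetD)
    qed (simp add: f)
    show "fnorm E (P f) \<le> 1 * fnorm E f" if f: "f \<in> vecs E" for f
    proof -
      have "(fnorm E (P f))\<^sup>2 = Re (ip E f (P f))"
        by (simp add: fnorm_sq Pin f P_ip)
      also have "\<dots> \<le> fnorm E f * fnorm E (P f)"
        using Cauchy_Schwarz[OF f Pin[OF f]] complex_Re_le_cmod order_trans by blast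
      finally show ?thesis
        using fnorm_nonneg[OF Pin[OF f]] fnorm_nonneg[OF f]
        by (cases "fnorm E (P f) = 0") (auto simp: power2_eq_square)
    qed
  qed
  have PC: "P \<in> pi_commutant L"
    unfolding pi_commutant_iff
  proof (intro conjI bP allI ballI)
    fix a f assume f: "f \<in> vecs E"
    show "P (left_shift a f) = left_shift a (P f)"
    proof (rule P_eqI)
      show "left_shift a f \<in> vecs E" using f by simp
      show "left_shift a (P f) \<in> M"
        using P[OF f] by (intro inv') auto
      fix q assume q: "q \<in> M"
      then have qE: "q \<in> vecs E" using sub by blast
      \<comment> \<open>Moved to the other side, the shift becomes the one by \<open>star a\<close>,
        and it maps \<open>q\<close> into \<open>M\<close> again.\<close>
      show "ip E (left_shift a (P f)) q = ip E (left_shift a f) q"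
        using P[OF f] inv'[OF q] by (simp add: ip_left_shift[OF _ qE] f Pin)
    qed
  qed
  have pos: "ip E f (P f) \<in> \<real>\<^sub>\<ge>\<^sub>0" if "f \<in> vecs E" for f
    unfolding P_ip[OF that] by (rule ip_self[OF Pin[OF that]])
  have le: "ip E f (\<lambda>x. f x - P f x) \<in> \<real>\<^sub>\<ge>\<^sub>0" if f: "f \<in> vecs E" for f
  proof -
    have "ip E (P f) f = ip E (P f) (P f)"
      using ip_cnj[OF Pin[OF f] f] ip_cnj[OF Pin[OF f] Pin[OF f]] P_ip[OF f] by simp
    then have "ip E (P f) (\<lambda>x. f x - P f x) = 0"
      by (simp add: ip_diff_right f Pin)
    then have "ip E f (\<lambda>x. f x - P f x) = ip E (\<lambda>x. f x - P f x) (\<lambda>x. f x - P f x)"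
      by (simp add: ip_diff_left f Pin)
    then show ?thesis
      using ip_self[OF diff_in[OF f Pin[OF f]]] by simp
  qed
  obtain c where "op_kernel P = kernel_scale c L"
    using scalar[OF op_kernel_gpd[OF PC pos] op_kernel_le[OF PC le]] by blast
  then have Pc: "P f = (\<lambda>x. c * f x)" if "f \<in> vecs E" for f
    using op_scalar_if_kernel_scale[OF PC _ that] by blast
  show "M = {\<lambda>x. 0} \<or> M = vecs E"
  \<comment> \<open>As P f = c f, either every element of \<open>M\<close> is 0, or every f equals P
    f / c and lies in \<open>M\<close>; that c is 0 or 1 need not be shown.\<close>
  proof (cases "c = 0")
    case True
    have "f = (\<lambda>x. 0)" if "f \<in> M" for f
    proof -
      have "f \<in> vecs E" using that sub by blast
      then show ?thesis
        using Pc[of f] P_eqI[of f f] that True by simp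
    qed
    then show ?thesis
      using fun_subspace_zero[OF M] by blast
  next
    case False
    have "f \<in> M" if f: "f \<in> vecs E" for f
    proof -
      have "(\<lambda>x. inverse c * P f x) \<in> M"
        using P[OF f] by (intro fun_subspace_scale M) auto
      then show ?thesis
        using False by (simp add: Pc[OF f] mult.assoc[symmetric])
    qed
    then show ?thesis using sub by blast
  qed
qed

end

section \<open>Square roots and irreducibility\<close>

text \<open>The scalar iteration v -> (1 + v^2) / 2, which is the operator iteration for
  \<open>X = 1\<close>. It increases, stays below 1, and majorises both the norms and the increments
  of the operators.\<close>

primrec sqrt_iter_bound :: "nat \<Rightarrow> real" where
  "sqrt_iter_bound 0 = 0"
| "sqrt_iter_bound (Suc n) = (1 + (sqrt_iter_bound n)\<^sup>2) / 2"

lemma sqrt_iter_bound_range: "0 \<le> sqrt_iter_bound n \<and> sqrt_iter_bound n \<le> 1"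
proof (induction n)
  case (Suc n)
  then have "(sqrt_iter_bound n)\<^sup>2 \<le> 1"
    by (simp add: power_le_one)
  then show ?case by simp
qed simp

lemma sqrt_iter_bound_Suc_le: "sqrt_iter_bound n \<le> sqrt_iter_bound (Suc n)"
proof -
  have "0 \<le> (sqrt_iter_bound n - 1)\<^sup>2" by simp
  then show ?thesis by (simp add: power2_diff)
qed

lemma Cauchy_sqrt_iter_bound: "Cauchy sqrt_iter_bound"
proof -
  have "incseq sqrt_iter_bound"
    by (rule incseq_SucI) (rule sqrt_iter_bound_Suc_le)
  then show ?thesis
    by (rule incseq_convergent[of _ 1, THEN exE])
      (use sqrt_iter_bound_range in \<open>auto intro: LIMSEQ_imp_Cauchy\<close>)
qed

text \<open>The iteration V -> (X + V^2) / 2 started at 0. At a fixed point (1 - V)^2 = 1 - X, so 1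
  - V is a square root of 1 - X.\<close>

primrec sqrt_iter :: "(('w \<Rightarrow> complex) \<Rightarrow> ('w \<Rightarrow> complex)) \<Rightarrow> nat \<Rightarrow> ('w \<Rightarrow> complex) \<Rightarrow> ('w \<Rightarrow> complex)"
  where
  "sqrt_iter X 0 f = (\<lambda>x. 0)"
| "sqrt_iter X (Suc n) f = (\<lambda>x. 1/2 * (X f x + sqrt_iter X n (sqrt_iter X n f) x))"

text \<open>Norm limits are pointwise limits in these spaces, so the limit operator can be written
  down without a choice.\<close>

definition sqrt_iter_limit :: "(('w \<Rightarrow> complex) \<Rightarrow> ('w \<Rightarrow> complex)) \<Rightarrow> ('w \<Rightarrow> complex) \<Rightarrow> ('w \<Rightarrow> complex)"
  where "sqrt_iter_limit X f = (\<lambda>x. lim (\<lambda>n. sqrt_iter X n f x))"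

section \<open>Convergence of the square root iteration\<close>

context rkhs_fs
begin

lemma fconv_unique:
  assumes "\<And>n. F n \<in> vecs E" "f \<in> vecs E" "g \<in> vecs E"
    "(\<lambda>n. fdist E (F n) f) \<longlonglongrightarrow> 0" "(\<lambda>n. fdist E (F n) g) \<longlonglongrightarrow> 0"
  shows "f = g"
proof
  fix x
  show "f x = g x"
    using fconv_pointwise[OF assms(1,2,4), of x] fconv_pointwise[OF assms(1,3,5), of x]
    by (rule LIMSEQ_unique)
qed

context
  fixes X
  assumes X: "fun_bounded_op E X" and contraction: "\<And>f. f \<in> vecs E \<Longrightarrow> fnorm E (X f) \<le> fnorm E f"
begin

lemma sqrt_iter_in: "f \<in> vecs E \<Longrightarrow> sqrt_iter X n f \<in> vecs E"
proof (induction n arbitrary: f)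
  case (Suc n)
  show ?case
    unfolding sqrt_iter.simps using Suc by (intro scale_in add_in op_in[OF X]) auto
qed simp

lemma sqrt_iter_norm: "f \<in> vecs E \<Longrightarrow> fnorm E (sqrt_iter X n f) \<le> sqrt_iter_bound n * fnorm E f"
proof (induction n arbitrary: f)
  case (Suc n)
  note f = Suc.prems
  have i1: "X f \<in> vecs E" and i2: "sqrt_iter X n (sqrt_iter X n f) \<in> vecs E"
    using op_in[OF X f] sqrt_iter_in[OF sqrt_iter_in[OF f]] by auto
  have "fnorm E (sqrt_iter X (Suc n) f) = 1/2 * fnorm E (\<lambda>x. X f x + sqrt_iter X n (sqrt_iter X n f) x)"
    using fnorm_scale[OF add_in[OF i1 i2], of "1/2"] by (simp add: norm_divide)
  also have "\<dots> \<le> 1/2 * (fnorm E (X f) + fnorm E (sqrt_iter X n (sqrt_iter X n f)))"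
    by (intro mult_left_mono fnorm_triangle i1 i2) simp
  also have "\<dots> \<le> 1/2 * (fnorm E f + sqrt_iter_bound n * (sqrt_iter_bound n * fnorm E f))"
    using sqrt_iter_bound_range[of n]
    by (intro mult_left_mono add_mono contraction f order_trans[OF Suc.IH[OF sqrt_iter_in[OF f]]] Suc.IH) simp_all
  also have "\<dots> = sqrt_iter_bound (Suc n) * fnorm E f"
    by (simp add: power2_eq_square algebra_simps add_divide_distrib)
  finally show ?case .
qed simp

lemma sqrt_iter_op: "fun_bounded_op E (sqrt_iter X n)"
proof -
  have add: "f \<in> vecs E \<Longrightarrow> g \<in> vecs E \<Longrightarrow> sqrt_iter X n (\<lambda>x. f x + g x) = (\<lambda>x. sqrt_iter X n f x + sqrt_iter X n g x)" for f g
    by (induction n arbitrary: f g) (simp_all add: op_add[OF X] sqrt_iter_in algebra_simps)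
  have scale: "f \<in> vecs E \<Longrightarrow> sqrt_iter X n (\<lambda>x. c * f x) = (\<lambda>x. c * sqrt_iter X n f x)" for c f
    by (induction n arbitrary: f) (simp_all add: op_scale[OF X] sqrt_iter_in algebra_simps)
  show ?thesis
    unfolding fun_bounded_op_def
    by (intro conjI ballI allI exI[of _ "sqrt_iter_bound n"] add scale sqrt_iter_norm sqrt_iter_in)
qed

text \<open>The increments of the operator iteration are dominated by those of the scalar one:
  \<open>V\<^sub>n\<^sub>+\<^sub>2 - V\<^sub>n\<^sub>+\<^sub>1 = (V\<^sub>n\<^sub>+\<^sub>1 (V\<^sub>n\<^sub>+\<^sub>1 - V\<^sub>n) + (V\<^sub>n\<^sub>+\<^sub>1 - V\<^sub>n) V\<^sub>n) / 2\<close>.\<close>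

lemma sqrt_iter_increment:
  "f \<in> vecs E \<Longrightarrow> fdist E (sqrt_iter X (Suc n) f) (sqrt_iter X n f)
    \<le> (sqrt_iter_bound (Suc n) - sqrt_iter_bound n) * fnorm E f"
proof (induction n arbitrary: f)
  case 0
  have "fdist E (sqrt_iter X (Suc 0) f) (sqrt_iter X 0 f) = 1/2 * fnorm E (X f)"
    using fnorm_scale[OF op_in[OF X 0], of "1/2"] by (simp add: fdist_def norm_divide)
  then show ?case using contraction[OF 0] by simp
next
  case (Suc n)
  note f = Suc.prems
  let ?V = "sqrt_iter X"
  let ?d = "\<lambda>x. ?V (Suc n) f x - ?V n f x"
  let ?a = "?V (Suc n) ?d" and ?b = "\<lambda>x. ?V (Suc n) (?V n f) x - ?V n (?V n f) x"
  have d: "?d \<in> vecs E" by (intro diff_in sqrt_iter_in f)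
  have a: "?a \<in> vecs E" by (rule sqrt_iter_in[OF d])
  have b: "?b \<in> vecs E" by (intro diff_in sqrt_iter_in f)
  have a_eq: "?a = (\<lambda>x. ?V (Suc n) (?V (Suc n) f) x - ?V (Suc n) (?V n f) x)"
    by (rule op_diff[OF sqrt_iter_op sqrt_iter_in[OF f] sqrt_iter_in[OF f]])
  have "(\<lambda>x. ?V (Suc (Suc n)) f x - ?V (Suc n) f x) = (\<lambda>x. 1/2 * (?a x + ?b x))"
    unfolding a_eq sqrt_iter.simps(2)[of X "Suc n" f] by (subst (5) sqrt_iter.simps(2)) (simp add: algebra_simps)
  then have "fdist E (?V (Suc (Suc n)) f) (?V (Suc n) f) = 1/2 * fnorm E (\<lambda>x. ?a x + ?b x)"
    using fnorm_scale[OF add_in[OF a b], of "1/2"] by (simp add: fdist_def norm_divide)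
  also have "\<dots> \<le> 1/2 * (fnorm E ?a + fnorm E ?b)"
    by (intro mult_left_mono fnorm_triangle a b) simp
  also have "\<dots> \<le> 1/2 * (sqrt_iter_bound (Suc n) * ((sqrt_iter_bound (Suc n) - sqrt_iter_bound n) * fnorm E f)
      + (sqrt_iter_bound (Suc n) - sqrt_iter_bound n) * (sqrt_iter_bound n * fnorm E f))"
  proof (intro mult_left_mono add_mono)
    have "fnorm E ?a \<le> sqrt_iter_bound (Suc n) * fnorm E ?d"
      by (rule sqrt_iter_norm[OF d])
    also have "\<dots> \<le> sqrt_iter_bound (Suc n) * ((sqrt_iter_bound (Suc n) - sqrt_iter_bound n) * fnorm E f)"
      using Suc.IH[OF f] sqrt_iter_bound_range[of "Suc n"] unfolding fdist_def by (intro mult_left_mono) simp_all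
    finally show "fnorm E ?a \<le> sqrt_iter_bound (Suc n) * ((sqrt_iter_bound (Suc n) - sqrt_iter_bound n) * fnorm E f)" .
    have "fnorm E ?b \<le> (sqrt_iter_bound (Suc n) - sqrt_iter_bound n) * fnorm E (?V n f)"
      using Suc.IH[OF sqrt_iter_in[OF f]] unfolding fdist_def .
    also have "\<dots> \<le> (sqrt_iter_bound (Suc n) - sqrt_iter_bound n) * (sqrt_iter_bound n * fnorm E f)"
      using sqrt_iter_bound_Suc_le[of n] by (intro mult_left_mono sqrt_iter_norm f) simp
    finally show "fnorm E ?b \<le> (sqrt_iter_bound (Suc n) - sqrt_iter_bound n) * (sqrt_iter_bound n * fnorm E f)" .
  qed simp
  \<comment> \<open>With v = \<open>sqrt_iter_bound n\<close> and w =
    \<open>sqrt_iter_bound (Suc n)\<close>, w (w - v) + (w - v) v = w^2 - v^2, which is twice the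
    next scalar increment; so the induction closes exactly.\<close>
  also have "\<dots> = 1/2 * ((sqrt_iter_bound (Suc n))\<^sup>2 - (sqrt_iter_bound n)\<^sup>2) * fnorm E f"
    by (simp only: power2_eq_square algebra_simps)
  also have "1/2 * ((sqrt_iter_bound (Suc n))\<^sup>2 - (sqrt_iter_bound n)\<^sup>2) = sqrt_iter_bound (Suc (Suc n)) - sqrt_iter_bound (Suc n)"
    unfolding sqrt_iter_bound.simps(2)[of "Suc n"] sqrt_iter_bound.simps(2)[of n] by (simp add: field_simps)
  finally show ?case .
qed

lemma sqrt_iter_fdist:
  assumes f: "f \<in> vecs E" and "n \<le> m"
  shows "fdist E (sqrt_iter X m f) (sqrt_iter X n f) \<le> (sqrt_iter_bound m - sqrt_iter_bound n) * fnorm E f"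
  using assms(2)
proof (induction m rule: dec_induct)
  case (step m)
  have "fdist E (sqrt_iter X (Suc m) f) (sqrt_iter X n f)
      \<le> fdist E (sqrt_iter X (Suc m) f) (sqrt_iter X m f) + fdist E (sqrt_iter X m f) (sqrt_iter X n f)"
    by (intro fdist_triangle sqrt_iter_in f)
  also have "\<dots> \<le> (sqrt_iter_bound (Suc m) - sqrt_iter_bound m) * fnorm E f + (sqrt_iter_bound m - sqrt_iter_bound n) * fnorm E f"
    by (intro add_mono sqrt_iter_increment f step.IH)
  finally show ?case by (simp add: algebra_simps)
qed simp

lemma sqrt_iter_fcauchy:
  assumes f: "f \<in> vecs E"
  shows "fcauchy E (\<lambda>n. sqrt_iter X n f)"
  unfolding fcauchy_def
proof (intro allI impI)
  fix e :: real assume "e > 0"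
  define c where "c = fnorm E f + 1"
  have c: "c > 0" using fnorm_nonneg[OF f] by (simp add: c_def)
  then have "e / c > 0" using \<open>e > 0\<close> by simp
  then obtain N where N: "\<And>m n. m \<ge> N \<Longrightarrow> n \<ge> N \<Longrightarrow> dist (sqrt_iter_bound m) (sqrt_iter_bound n) < e / c"
    using Cauchy_sqrt_iter_bound unfolding Cauchy_def by meson
  have le: "fdist E (sqrt_iter X m f) (sqrt_iter X n f) < e" if mn: "n \<ge> N" "n \<le> m" for m n
  proof -
    have inc: "sqrt_iter_bound n \<le> sqrt_iter_bound m"
      using mn(2) by (rule lift_Suc_mono_le[of sqrt_iter_bound, OF sqrt_iter_bound_Suc_le])
    have "fdist E (sqrt_iter X m f) (sqrt_iter X n f) \<le> (sqrt_iter_bound m - sqrt_iter_bound n) * fnorm E f"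
      by (rule sqrt_iter_fdist[OF f mn(2)])
    also have "\<dots> \<le> (sqrt_iter_bound m - sqrt_iter_bound n) * c"
      using inc by (intro mult_left_mono) (simp_all add: c_def)
    also have "\<dots> < e / c * c"
      using N[of m n] mn inc c by (intro mult_strict_right_mono) (simp_all add: dist_real_def)
    finally show ?thesis using c by simp
  qed
  have "fdist E (sqrt_iter X m f) (sqrt_iter X n f) < e" if "m \<ge> N" "n \<ge> N" for m n
    using le[of n m] le[of m n] that fdist_commute[OF sqrt_iter_in[OF f] sqrt_iter_in[OF f], of m n]
    by (cases "n \<le> m") auto
  then show "\<exists>N. \<forall>m\<ge>N. \<forall>n\<ge>N. fdist E (sqrt_iter X m f) (sqrt_iter X n f) < e" by blast
qed

lemma sqrt_iter_limit:
  assumes f: "f \<in> vecs E"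
  shows sqrt_iter_limit_in: "sqrt_iter_limit X f \<in> vecs E"
    and sqrt_iter_limit_fconv: "(\<lambda>n. fdist E (sqrt_iter X n f) (sqrt_iter_limit X f)) \<longlonglongrightarrow> 0"
proof -
  obtain g where g: "g \<in> vecs E" "(\<lambda>n. fdist E (sqrt_iter X n f) g) \<longlonglongrightarrow> 0"
    using complete[of "\<lambda>n. sqrt_iter X n f"] sqrt_iter_in[OF f] sqrt_iter_fcauchy[OF f] by blast
  have "sqrt_iter_limit X f = g"
    unfolding sqrt_iter_limit_def
    by (rule ext) (rule limI[OF fconv_pointwise[OF sqrt_iter_in[OF f] g]])
  then show "sqrt_iter_limit X f \<in> vecs E" "(\<lambda>n. fdist E (sqrt_iter X n f) (sqrt_iter_limit X f)) \<longlonglongrightarrow> 0"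
    using g by simp_all
qed

lemma sqrt_iter_limit_norm:
  assumes f: "f \<in> vecs E"
  shows "fnorm E (sqrt_iter_limit X f) \<le> fnorm E f"
proof (rule LIMSEQ_le_const2)
  show "(\<lambda>n. fnorm E (sqrt_iter X n f)) \<longlonglongrightarrow> fnorm E (sqrt_iter_limit X f)"
    by (intro tendsto_fnorm sqrt_iter_in sqrt_iter_limit_in sqrt_iter_limit_fconv f)
  have "fnorm E (sqrt_iter X n f) \<le> fnorm E f" for n
    using sqrt_iter_norm[OF f, of n] sqrt_iter_bound_range[of n]
      mult_right_mono[of "sqrt_iter_bound n" 1 "fnorm E f"] fnorm_nonneg[OF f] by simp
  then show "\<exists>N. \<forall>n\<ge>N. fnorm E (sqrt_iter X n f) \<le> fnorm E f" by blast
qed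

lemma sqrt_iter_limit_op: "fun_bounded_op E (sqrt_iter_limit X)"
  unfolding fun_bounded_op_def
proof (intro conjI ballI allI exI[of _ 1])
  show "sqrt_iter_limit X f \<in> vecs E" "fnorm E (sqrt_iter_limit X f) \<le> 1 * fnorm E f" if "f \<in> vecs E" for f
    using sqrt_iter_limit_in[OF that] sqrt_iter_limit_norm[OF that] by simp_all
  show "sqrt_iter_limit X (\<lambda>x. f x + g x) = (\<lambda>x. sqrt_iter_limit X f x + sqrt_iter_limit X g x)"
    if fg: "f \<in> vecs E" "g \<in> vecs E" for f g
  proof (rule fconv_unique)
    show "(\<lambda>n. fdist E (sqrt_iter X n (\<lambda>x. f x + g x)) (sqrt_iter_limit X (\<lambda>x. f x + g x))) \<longlonglongrightarrow> 0"
      by (intro sqrt_iter_limit_fconv add_in fg)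
    show "(\<lambda>n. fdist E (sqrt_iter X n (\<lambda>x. f x + g x)) (\<lambda>x. sqrt_iter_limit X f x + sqrt_iter_limit X g x)) \<longlonglongrightarrow> 0"
      unfolding op_add[OF sqrt_iter_op fg]
      by (intro fconv_add sqrt_iter_in sqrt_iter_limit_in sqrt_iter_limit_fconv fg)
  qed (simp_all add: sqrt_iter_in sqrt_iter_limit_in fg)
  show "sqrt_iter_limit X (\<lambda>x. c * f x) = (\<lambda>x. c * sqrt_iter_limit X f x)" if f: "f \<in> vecs E" for c f
  proof (rule fconv_unique)
    show "(\<lambda>n. fdist E (sqrt_iter X n (\<lambda>x. c * f x)) (sqrt_iter_limit X (\<lambda>x. c * f x))) \<longlonglongrightarrow> 0"
      by (intro sqrt_iter_limit_fconv scale_in f)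
    show "(\<lambda>n. fdist E (sqrt_iter X n (\<lambda>x. c * f x)) (\<lambda>x. c * sqrt_iter_limit X f x)) \<longlonglongrightarrow> 0"
      unfolding op_scale[OF sqrt_iter_op f]
      by (intro fconv_scale sqrt_iter_in sqrt_iter_limit_in sqrt_iter_limit_fconv f)
  qed (simp_all add: sqrt_iter_in sqrt_iter_limit_in f)
qed

text \<open>Both sides are limits of the iterates with index n + 1. For the quadratic term V_n V_n f
  is compared with V_n V f, and \<open>V_n\<close>, being a contraction, does not increase the
  distance of V_n f and V f.\<close>

lemma sqrt_iter_limit_fixpoint:
  assumes f: "f \<in> vecs E"
  shows "sqrt_iter_limit X f = (\<lambda>x. 1/2 * (X f x + sqrt_iter_limit X (sqrt_iter_limit X f) x))"
proof (rule fconv_unique)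
  let ?V = "sqrt_iter_limit X"
  show "(\<lambda>n. fdist E (sqrt_iter X (Suc n) f) (?V f)) \<longlonglongrightarrow> 0"
    using sqrt_iter_limit_fconv[OF f] by (rule LIMSEQ_Suc)
  have "(\<lambda>n. fdist E (sqrt_iter X n (sqrt_iter X n f)) (?V (?V f))) \<longlonglongrightarrow> 0"
  proof (rule Lim_null_comparison)
    have "fdist E (sqrt_iter X n (sqrt_iter X n f)) (?V (?V f))
        \<le> fdist E (sqrt_iter X n f) (?V f) + fdist E (sqrt_iter X n (?V f)) (?V (?V f))" for n
    proof -
      have d: "(\<lambda>x. sqrt_iter X n f x - ?V f x) \<in> vecs E"
        by (intro diff_in sqrt_iter_in sqrt_iter_limit_in f)
      have "fdist E (sqrt_iter X n (sqrt_iter X n f)) (sqrt_iter X n (?V f))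
          = fnorm E (sqrt_iter X n (\<lambda>x. sqrt_iter X n f x - ?V f x))"
        by (simp add: fdist_def op_diff[OF sqrt_iter_op sqrt_iter_in[OF f] sqrt_iter_limit_in[OF f]])
      also have "\<dots> \<le> sqrt_iter_bound n * fdist E (sqrt_iter X n f) (?V f)"
        unfolding fdist_def by (rule sqrt_iter_norm[OF d])
      also have "\<dots> \<le> 1 * fdist E (sqrt_iter X n f) (?V f)"
        using sqrt_iter_bound_range[of n] by (intro mult_right_mono fdist_nonneg sqrt_iter_in sqrt_iter_limit_in f) simp
      finally show ?thesis
        using fdist_triangle[OF sqrt_iter_in[OF sqrt_iter_in[OF f]] sqrt_iter_in[OF sqrt_iter_limit_in[OF f]]
            sqrt_iter_limit_in[OF sqrt_iter_limit_in[OF f]], of n n n] by simp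
    qed
    then show "\<forall>\<^sub>F n in sequentially. norm (fdist E (sqrt_iter X n (sqrt_iter X n f)) (?V (?V f)))
        \<le> fdist E (sqrt_iter X n f) (?V f) + fdist E (sqrt_iter X n (?V f)) (?V (?V f))"
      by (simp add: fdist_nonneg sqrt_iter_in sqrt_iter_limit_in f)
    show "(\<lambda>n. fdist E (sqrt_iter X n f) (?V f) + fdist E (sqrt_iter X n (?V f)) (?V (?V f))) \<longlonglongrightarrow> 0"
      using tendsto_add[OF sqrt_iter_limit_fconv[OF f] sqrt_iter_limit_fconv[OF sqrt_iter_limit_in[OF f]]] by simp
  qed
  then show "(\<lambda>n. fdist E (sqrt_iter X (Suc n) f) (\<lambda>x. 1/2 * (X f x + ?V (?V f) x))) \<longlonglongrightarrow> 0"
    unfolding sqrt_iter.simps(2)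
    by (intro fconv_scale fconv_add add_in sqrt_iter_in sqrt_iter_limit_in op_in[OF X] f) simp_all
qed (intro scale_in add_in sqrt_iter_in sqrt_iter_limit_in op_in[OF X] f)+

text \<open>Each iterate is a polynomial in \<open>X\<close>, so \<open>T\<close> commutes with it,
  and boundedness of \<open>T\<close> carries this over to the limit.\<close>

lemma sqrt_iter_limit_commute:
  assumes T: "fun_bounded_op E T" and TX: "\<And>f. f \<in> vecs E \<Longrightarrow> T (X f) = X (T f)" and f: "f \<in> vecs E"
  shows "T (sqrt_iter_limit X f) = sqrt_iter_limit X (T f)"
proof (rule fconv_unique)
  have comm: "g \<in> vecs E \<Longrightarrow> T (sqrt_iter X n g) = sqrt_iter X n (T g)" for n g
  proof (induction n arbitrary: g)
    case (Suc n)
    have in1: "X g \<in> vecs E" "sqrt_iter X n (sqrt_iter X n g) \<in> vecs E"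
      by (intro op_in[OF X] sqrt_iter_in Suc.prems)+
    show ?case
      unfolding sqrt_iter.simps op_scale[OF T add_in[OF in1]] op_add[OF T in1] TX[OF Suc.prems]
        Suc.IH[OF sqrt_iter_in[OF Suc.prems]] Suc.IH[OF Suc.prems] ..
  qed (simp add: op_zero[OF T])
  show "(\<lambda>n. fdist E (T (sqrt_iter X n f)) (T (sqrt_iter_limit X f))) \<longlonglongrightarrow> 0"
    by (intro op_fconv[OF T] sqrt_iter_in sqrt_iter_limit_in sqrt_iter_limit_fconv f)
  show "(\<lambda>n. fdist E (T (sqrt_iter X n f)) (sqrt_iter_limit X (T f))) \<longlonglongrightarrow> 0"
    unfolding comm[OF f] by (intro sqrt_iter_limit_fconv op_in[OF T] f)
qed (intro op_in[OF T] sqrt_iter_in sqrt_iter_limit_in f)+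

end

text \<open>With \<open>X = 1 - B\<^sup>2\<close> the limit \<open>V\<close> of the iteration satisfies \<open>2 V = X + V\<^sup>2\<close>, that is
  \<open>(1 - V)\<^sup>2 = B\<^sup>2\<close>.\<close>

lemma abs_op_exists:
  assumes B: "fun_bounded_op E B" and contr: "\<And>f. f \<in> vecs E \<Longrightarrow> fnorm E (B f) \<le> fnorm E f"
    and sym: "\<And>f g. f \<in> vecs E \<Longrightarrow> g \<in> vecs E \<Longrightarrow> ip E (B f) g = ip E f (B g)"
  shows "\<exists>S. fun_bounded_op E S \<and> (\<forall>f\<in>vecs E. S (S f) = B (B f)) \<and>
    (\<forall>f\<in>vecs E. 0 \<le> Re (ip E f (S f))) \<and>
    (\<forall>T. fun_bounded_op E T \<longrightarrow> (\<forall>f\<in>vecs E. T (B f) = B (T f)) \<longrightarrow> (\<forall>f\<in>vecs E. T (S f) = S (T f)))"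
proof -
  note [simp] = op_in[OF B]
  define X where "X f = (\<lambda>x. f x - B (B f) x)" for f
  have X_apply: "X f x = f x - B (B f) x" for f x
    by (simp add: X_def)
  have X_norm: "fnorm E (X f) \<le> fnorm E f" if f: "f \<in> vecs E" for f
  proof (rule power2_le_imp_le)
    have BBf: "B (B f) \<in> vecs E" using f by simp
    have "ip E f (B (B f)) = ip E (B f) (B f)"
      using sym[of f "B f"] f by simp
    moreover have "ip E (B (B f)) f = ip E (B f) (B f)"
      using sym[of "B f" f] f by simp
    ultimately have "(fnorm E (X f))\<^sup>2 = (fnorm E f)\<^sup>2 - 2 * (fnorm E (B f))\<^sup>2 + (fnorm E (B (B f)))\<^sup>2"
      using f by (simp add: X_def fnorm_sq ip_diff_left ip_diff_right)
    \<comment> \<open>The norm of \<open>B (B f)\<close> is at most that of \<open>B f\<close>, so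
      the last term is absorbed by the middle one.\<close>
    also have "\<dots> \<le> (fnorm E f)\<^sup>2"
      using power_mono[OF contr[OF op_in[OF B f]] fnorm_nonneg[OF BBf], of 2] zero_le_power2[of "fnorm E (B f)"]
      by linarith
    finally show "(fnorm E (X f))\<^sup>2 \<le> (fnorm E f)\<^sup>2" .
  qed (rule fnorm_nonneg[OF that])
  have X: "fun_bounded_op E X"
    unfolding fun_bounded_op_def
  proof (intro conjI ballI allI exI[of _ 1])
    show "fnorm E (X f) \<le> 1 * fnorm E f" if "f \<in> vecs E" for f
      using X_norm[OF that] by simp
  qed (simp_all add: X_def op_add[OF B] op_scale[OF B] algebra_simps)
  let ?V = "sqrt_iter_limit X"
  note V = sqrt_iter_limit_op[OF X X_norm]
  define S where "S f = (\<lambda>x. f x - ?V f x)" for f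
  have Vin [simp]: "?V f \<in> vecs E" if "f \<in> vecs E" for f
    using op_in[OF V that] .
  have S: "fun_bounded_op E S"
    unfolding S_def by (rule fun_bounded_op_id_minus[OF V])
  show ?thesis
  proof (intro exI[of _ S] conjI ballI allI impI S)
    show "S (S f) = B (B f)" if f: "f \<in> vecs E" for f
    proof
      fix x
      have "2 * ?V f x = f x - B (B f) x + ?V (?V f) x"
        using fun_cong[OF sqrt_iter_limit_fixpoint[OF X X_norm f], of x]
        by (simp add: X_apply mult.commute)
      then show "S (S f) x = B (B f) x"
        by (simp add: S_def op_diff[OF V f Vin[OF f]])
    qed
    show "0 \<le> Re (ip E f (S f))" if f: "f \<in> vecs E" for f
    proof -
      \<comment> \<open>Positivity of S = 1 - V needs only that \<open>V\<close> is a contraction;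
        the real part suffices, so self-adjointness of \<open>V\<close> need not be
        established.\<close>
      have "Re (ip E f (?V f)) \<le> fnorm E f * fnorm E (?V f)"
        using Cauchy_Schwarz[OF f Vin[OF f]] complex_Re_le_cmod order_trans by blast
      also have "\<dots> \<le> fnorm E f * fnorm E f"
        by (intro mult_left_mono sqrt_iter_limit_norm[OF X X_norm] f fnorm_nonneg)
      finally show ?thesis
        using f by (simp add: S_def ip_diff_right fnorm_sq[symmetric] power2_eq_square)
    qed
    show "T (S f) = S (T f)"
      if T: "fun_bounded_op E T" and TB: "\<forall>f\<in>vecs E. T (B f) = B (T f)" and f: "f \<in> vecs E" for T f
    proof -
      have TX: "T (X g) = X (T g)" if g: "g \<in> vecs E" for g
        using g op_in[OF T g] by (simp add: X_def op_diff[OF T] TB)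
      have "T (?V f) = ?V (T f)"
        by (rule sqrt_iter_limit_commute[OF X _ T _ f]) (simp_all add: X_norm TX)
      then show ?thesis
        using f by (simp add: S_def op_diff[OF T])
    qed
  qed
qed

end

section \<open>The commutant of an irreducible representation\<close>

context gpd_kernel
begin

text \<open>Irreducibility lets no number split the numerical range of \<open>A\<close>: the
  quadratic form of A - l has one sign on the whole space.\<close>

lemma irreducible_dichotomy:
  fixes l :: real
  assumes irr: "pi_irreducible L" and A: "A \<in> pi_commutant L"
    and sym: "\<And>f g. f \<in> vecs E \<Longrightarrow> g \<in> vecs E \<Longrightarrow> ip E (A f) g = ip E f (A g)"
  shows "(\<forall>f\<in>vecs E. l * (fnorm E f)\<^sup>2 \<le> Re (ip E f (A f))) \<or>
    (\<forall>f\<in>vecs E. Re (ip E f (A f)) \<le> l * (fnorm E f)\<^sup>2)"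
proof -
  have bA: "fun_bounded_op E A" and com: "\<And>a f. f \<in> vecs E \<Longrightarrow> A (left_shift a f) = left_shift a (A f)"
    using A by (simp_all add: pi_commutant_iff)
  note [simp] = op_in[OF bA]
  obtain C where C: "C > 0" "\<And>f. f \<in> vecs E \<Longrightarrow> fnorm E (A f) \<le> C * fnorm E f"
    using op_bounded[OF bA] by blast
  \<comment> \<open>The norm of A - l is at most C + |l|, so \<open>B\<close> becomes a contraction,
    as the square root iteration demands, and the sign of the form is kept.\<close>
  define r where "r = inverse (C + \<bar>l\<bar>)"
  have r: "r > 0" using C by (simp add: r_def)
  define B where "B f = (\<lambda>x. complex_of_real r * (A f x - complex_of_real l * f x))" for f
  have Bin [simp]: "B f \<in> vecs E" if "f \<in> vecs E" for f
    using that by (simp add: B_def)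
  have B_norm: "fnorm E (B f) \<le> fnorm E f" if f: "f \<in> vecs E" for f
  proof -
    have "fnorm E (B f) = r * fnorm E (\<lambda>x. A f x - complex_of_real l * f x)"
      unfolding B_def using r f by (subst fnorm_scale) simp_all
    also have "fnorm E (\<lambda>x. A f x - complex_of_real l * f x) \<le> fnorm E (A f) + \<bar>l\<bar> * fnorm E f"
      using fnorm_triangle[of "A f" "\<lambda>x. complex_of_real (- l) * f x"] fnorm_scale[OF f, of "complex_of_real (- l)"] 
        scale_in[OF f, of "complex_of_real (- l)"] f
      by simp
    also have "\<dots> \<le> (C + \<bar>l\<bar>) * fnorm E f"
      using C(2)[OF f] by (simp add: distrib_right)
    finally show ?thesis
      using r C by (simp add: r_def mult_left_mono mult.assoc[symmetric])
  qed
  have B: "fun_bounded_op E B"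
    unfolding fun_bounded_op_def
  proof (intro conjI ballI allI exI[of _ 1])
    show "fnorm E (B f) \<le> 1 * fnorm E f" if "f \<in> vecs E" for f
      using B_norm[OF that] by simp
    show "B f \<in> vecs E" if "f \<in> vecs E" for f
      by (rule Bin[OF that])
  qed (simp_all add: B_def op_add[OF bA] op_scale[OF bA] algebra_simps)
  have B_sym: "ip E (B f) g = ip E f (B g)" if "f \<in> vecs E" "g \<in> vecs E" for f g
    using that by (simp add: B_def ip_scale_left ip_scale_right ip_diff_left ip_diff_right sym)
  have B_com: "left_shift a (B f) = B (left_shift a f)" if "f \<in> vecs E" for a f
    using com[OF that, of a] by (auto simp: B_def fun_eq_iff)
  have B_ip: "Re (ip E f (B f)) = r * (Re (ip E f (A f)) - l * (fnorm E f)\<^sup>2)" if "f \<in> vecs E" for f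
    using that by (simp add: B_def ip_scale_right ip_diff_right fnorm_sq)
  have "\<exists>S. fun_bounded_op E S \<and> (\<forall>f\<in>vecs E. S (S f) = B (B f)) \<and>
    (\<forall>f\<in>vecs E. 0 \<le> Re (ip E f (S f))) \<and>
    (\<forall>T. fun_bounded_op E T \<longrightarrow> (\<forall>f\<in>vecs E. T (B f) = B (T f)) \<longrightarrow> (\<forall>f\<in>vecs E. T (S f) = S (T f)))"
    by (rule abs_op_exists[OF B]) (simp_all add: B_norm B_sym)
  then obtain S where S: "fun_bounded_op E S" and S_sq: "\<And>f. f \<in> vecs E \<Longrightarrow> S (S f) = B (B f)"
    and S_pos: "\<And>f. f \<in> vecs E \<Longrightarrow> 0 \<le> Re (ip E f (S f))"
    and S_all: "\<forall>T. fun_bounded_op E T \<longrightarrow> (\<forall>f\<in>vecs E. T (B f) = B (T f)) \<longrightarrow>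
      (\<forall>f\<in>vecs E. T (S f) = S (T f))"
    by blast
  \<comment> \<open>Used with \<open>T\<close> a left shift, to make the subspace \<open>M\<close>
    invariant, and with \<open>T = B\<close>, to factor S^2 - B^2.\<close>
  have S_com: "T (S f) = S (T f)"
    if "fun_bounded_op E T" "\<And>f. f \<in> vecs E \<Longrightarrow> T (B f) = B (T f)" "f \<in> vecs E" for T f
    using S_all that by simp
  note [simp] = op_in[OF S]
  define M where "M = {f \<in> vecs E. S f = B f}"
  have M_sub: "M \<subseteq> vecs E" by (auto simp: M_def)
  have M_space: "fun_subspace M"
    unfolding fun_subspace_def M_def
    by (simp add: op_zero[OF S] op_zero[OF B] op_add[OF S] op_add[OF B] op_scale[OF S] op_scale[OF B])
  have M_closed: "fclosure E M = M"
  proof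
    show "fclosure E M \<subseteq> M"
    proof
      fix f assume "f \<in> fclosure E M"
      then obtain F where f: "f \<in> vecs E" and F: "\<And>n. F n \<in> M" "(\<lambda>n. fdist E (F n) f) \<longlonglongrightarrow> 0"
        unfolding fclosure_def by blast
      have Fin: "F n \<in> vecs E" and FS: "S (F n) = B (F n)" for n
        using F(1)[of n] by (simp_all add: M_def)
      have "S f = B f"
      proof (rule fconv_unique)
        show "(\<lambda>n. fdist E (S (F n)) (S f)) \<longlonglongrightarrow> 0"
          by (rule op_fconv[OF S Fin f F(2)])
        show "(\<lambda>n. fdist E (S (F n)) (B f)) \<longlonglongrightarrow> 0"
          unfolding FS by (rule op_fconv[OF B Fin f F(2)])
      qed (simp_all add: Fin f)
      then show "f \<in> M" using f by (simp add: M_def)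
    qed
    show "M \<subseteq> fclosure E M"
    proof
      fix f assume "f \<in> M"
      then show "f \<in> fclosure E M"
        using M_sub by (auto simp: fclosure_def intro!: exI[of _ "\<lambda>_. f"])
    qed
  qed
  have M_inv: "\<forall>a. \<forall>f\<in>M. factor_pi L a f \<in> M"
  proof (intro allI ballI)
    fix a f assume "f \<in> M"
    then have f: "f \<in> vecs E" "S f = B f" by (simp_all add: M_def)
    have "S (left_shift a f) = left_shift a (S f)"
      using S_com[OF fun_bounded_op_left_shift B_com f(1)] by simp
    then show "factor_pi L a f \<in> M"
      using f by (simp add: M_def factor_pi_eq B_com)
  qed
  have "M = {\<lambda>x. 0} \<or> M = vecs E"
    using irr M_sub M_space M_closed M_inv unfolding pi_irreducible_def by blast
  then show ?thesis
  proof
    assume M: "M = vecs E"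
    have "l * (fnorm E f)\<^sup>2 \<le> Re (ip E f (A f))" if f: "f \<in> vecs E" for f
    proof -
      have "S f = B f" using f M by (auto simp: M_def)
      then have "0 \<le> r * (Re (ip E f (A f)) - l * (fnorm E f)\<^sup>2)"
        using S_pos[OF f] B_ip[OF f] by simp
      then show ?thesis using r by (simp add: zero_le_mult_iff)
    qed
    then show ?thesis by blast
  next
    assume M: "M = {\<lambda>x. 0}"
    have "Re (ip E f (A f)) \<le> l * (fnorm E f)\<^sup>2" if f: "f \<in> vecs E" for f
    proof -
      have BS: "B (S f) = S (B f)"
        using f by (intro S_com[OF B]) simp_all
      \<comment> \<open>The range of S + B lies in \<open>M\<close>, which is zero in this case, so
        B = - S.\<close>
      have "S (\<lambda>x. S f x + B f x) = B (\<lambda>x. S f x + B f x)"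
        using f by (simp add: op_add[OF S] op_add[OF B] S_sq BS add.commute)
      then have "(\<lambda>x. S f x + B f x) \<in> M"
        using f by (simp add: M_def)
      then have "S f x + B f x = 0" for x
        unfolding M by (auto dest: fun_cong)
      then have "B f = (\<lambda>x. -1 * S f x)"
        by (auto simp: add_eq_0_iff)
      then have "ip E f (B f) = -1 * ip E f (S f)"
        using f by (simp only: ip_scale_right op_in[OF S])
      then have "0 \<le> - (r * (Re (ip E f (A f)) - l * (fnorm E f)\<^sup>2))"
        using S_pos[OF f] B_ip[OF f] by simp
      then show ?thesis using r by (simp add: mult_le_0_iff)
    qed
    then show ?thesis by blast
  qed
qed

lemma irreducible_commutant_scalar:
  assumes irr: "pi_irreducible L" and A: "A \<in> pi_commutant L"
    and real: "\<And>f. f \<in> vecs E \<Longrightarrow> ip E f (A f) \<in> \<real>"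
  shows "\<exists>l::real. \<forall>f\<in>vecs E. A f = (\<lambda>x. complex_of_real l * f x)"
\<comment> \<open>Only a nonzero vector bounds the set of lower bounds of the form from above, so
  that its supremum is meaningful.\<close>
proof (cases "\<exists>f0\<in>vecs E. fnorm E f0 \<noteq> 0")
  case False
  have bA: "fun_bounded_op E A"
    using A by (simp add: pi_commutant_iff)
  have zero: "f = (\<lambda>x. 0)" if "f \<in> vecs E" for f
    using False that fnorm_eq_zero by blast
  have "A f = (\<lambda>x. complex_of_real 0 * f x)" if "f \<in> vecs E" for f
    using zero[OF op_in[OF bA that]] by simp
  then show ?thesis by blast
next
  case True
  then obtain f0 where f0: "f0 \<in> vecs E" "fnorm E f0 \<noteq> 0" by blast
  have bA: "fun_bounded_op E A"
    using A by (simp add: pi_commutant_iff)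
  note [simp] = op_in[OF bA]
  have sym: "ip E (A f) g = ip E f (A g)" if "f \<in> vecs E" "g \<in> vecs E" for f g
    by (rule op_symmetric[OF bA real that])
  define R where "R f = Re (ip E f (A f))" for f
  \<comment> \<open>The lower bounds of \<open>A\<close>; their supremum \<open>m\<close> is the
    infimum of the numerical range, and the dichotomy will show it to be the supremum as
    well.\<close>
  define \<Lambda> where "\<Lambda> = {l. \<forall>f\<in>vecs E. l * (fnorm E f)\<^sup>2 \<le> R f}"
  define m where "m = Sup \<Lambda>"
  obtain C where C: "C > 0" "\<And>f. f \<in> vecs E \<Longrightarrow> fnorm E (A f) \<le> C * fnorm E f"
    using op_bounded[OF bA] by blast
  have "- C * (fnorm E f)\<^sup>2 \<le> R f" if f: "f \<in> vecs E" for f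
  proof -
    have "\<bar>R f\<bar> \<le> fnorm E f * fnorm E (A f)"
      unfolding R_def using Cauchy_Schwarz[OF f op_in[OF bA f]] abs_Re_le_cmod order_trans by blast
    also have "\<dots> \<le> fnorm E f * (C * fnorm E f)"
      by (intro mult_left_mono C(2) f fnorm_nonneg)
    also have "\<dots> = C * (fnorm E f)\<^sup>2"
      by (simp add: power2_eq_square)
    finally show ?thesis by simp
  qed
  then have "- C \<in> \<Lambda>" by (simp add: \<Lambda>_def)
  then have ne: "\<Lambda> \<noteq> {}" by blast
  have le: "l \<le> R f / (fnorm E f)\<^sup>2" if "l \<in> \<Lambda>" "f \<in> vecs E" "fnorm E f \<noteq> 0" for l f
    using that by (simp add: \<Lambda>_def pos_le_divide_eq)
  then have bdd: "bdd_above \<Lambda>"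
    using f0 by (intro bdd_aboveI[of _ "R f0 / (fnorm E f0)\<^sup>2"]) auto
  have lower: "m * (fnorm E f)\<^sup>2 \<le> R f" if f: "f \<in> vecs E" for f
  proof (cases "fnorm E f = 0")
    case True
    then have "f = (\<lambda>x. 0)"
      by (rule fnorm_eq_zero[OF f])
    then show ?thesis
      by (simp add: True R_def op_zero[OF bA] ip_zero_right)
  next
    case False
    have "m \<le> R f / (fnorm E f)\<^sup>2"
      unfolding m_def by (rule cSup_least[OF ne]) (rule le[OF _ f False])
    then show ?thesis
      using False by (simp add: pos_le_divide_eq)
  qed
  have upper: "R f \<le> m * (fnorm E f)\<^sup>2" if f: "f \<in> vecs E" for f
  proof -
    \<comment> \<open>Above the supremum the first alternative of the dichotomy is excluded, so the
      second holds.\<close>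
    have step: "R f \<le> (m + e) * (fnorm E f)\<^sup>2" if "e > 0" for e
    proof -
      have "m + e \<notin> \<Lambda>"
      proof
        assume "m + e \<in> \<Lambda>"
        then have "m + e \<le> m"
          unfolding m_def using bdd by (rule cSup_upper)
        then show False using that by simp
      qed
      then have "\<not> (\<forall>f\<in>vecs E. (m + e) * (fnorm E f)\<^sup>2 \<le> Re (ip E f (A f)))"
        by (simp add: \<Lambda>_def R_def)
      then have "\<forall>f\<in>vecs E. Re (ip E f (A f)) \<le> (m + e) * (fnorm E f)\<^sup>2"
        using irreducible_dichotomy[OF irr A sym, of "m + e"] by blast
      then show ?thesis
        using f by (simp add: R_def)
    qed
    have "(\<lambda>n. (m + inverse (real (Suc n))) * (fnorm E f)\<^sup>2) \<longlonglongrightarrow> (m + 0) * (fnorm E f)\<^sup>2"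
      by (intro tendsto_intros LIMSEQ_inverse_real_of_nat)
    then have "R f \<le> (m + 0) * (fnorm E f)\<^sup>2"
      by (rule LIMSEQ_le_const) (auto intro!: step)
    then show ?thesis by simp
  qed
  define D where "D f = (\<lambda>x. A f x - complex_of_real m * f x)" for f
  have Din [simp]: "D f \<in> vecs E" if "f \<in> vecs E" for f
    using that by (simp add: D_def)
  have D_sym: "ip E (D f) g = ip E f (D g)" if "f \<in> vecs E" "g \<in> vecs E" for f g
    using that by (simp add: D_def ip_scale_left ip_scale_right ip_diff_left ip_diff_right sym)
  have D_add: "D (\<lambda>x. f x + g x) = (\<lambda>x. D f x + D g x)" if "f \<in> vecs E" "g \<in> vecs E" for f g
    using that by (simp add: D_def op_add[OF bA] algebra_simps)
  have D_zero: "Re (ip E f (D f)) = 0" if f: "f \<in> vecs E" for f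
    using lower[OF f] upper[OF f] f
    by (simp add: D_def ip_diff_right ip_scale_right fnorm_sq R_def)
  \<comment> \<open>The form of D = A - m vanishes identically. Its value at f + D f has the cross
    terms <f, D D f> + <D f, D f>, which by symmetry equal twice the squared norm of D f.\<close>
  have "D f = (\<lambda>x. 0)" if f: "f \<in> vecs E" for f
  proof -
    let ?g = "D f"
    have "Re (ip E (\<lambda>x. f x + ?g x) (D (\<lambda>x. f x + ?g x)))
        = Re (ip E f (D f)) + Re (ip E ?g (D ?g)) + Re (ip E f (D ?g)) + Re (ip E ?g (D f))"
      using f by (simp add: D_add ip_add_left ip_add_right)
    then have "Re (ip E f (D ?g)) + Re (ip E ?g (D f)) = 0"
      using f by (simp add: D_zero)
    then have "(fnorm E ?g)\<^sup>2 = 0"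
      using D_sym[OF f, of ?g] f by (simp add: fnorm_sq)
    then show ?thesis
      using fnorm_eq_zero[of ?g] f by simp
  qed
  then have "A f = (\<lambda>x. complex_of_real m * f x)" if "f \<in> vecs E" for f
    using that by (simp add: D_def fun_eq_iff)
  then show ?thesis by blast
qed

section \<open>Scalar derivatives and multiples of \<open>L\<close>\<close>

lemma kernel_scale_if_op_scalar:
  assumes K: "is_rn_derivative K L A" and A: "\<And>f. f \<in> vecs E \<Longrightarrow> A f = (\<lambda>x. c * f x)"
  shows "K = kernel_scale c L"
proof (intro ext)
  fix s t a v
  have AC: "A \<in> pi_commutant L"
    using K by (simp add: is_rn_derivative_def)
  have "K s t a v = op_kernel A s t a v"
    using K by (simp add: is_rn_derivative_def op_kernel_def)
  also have "\<dots> = kernel_scale c L s t a v"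
    by (rule cinner_ext) (simp add: cinner_op_kernel[OF AC] A kernel_scale_def cinner_scaleC_right,
      simp add: kfun_def scalar_kernel_def star_one)
  finally show "K s t a v = kernel_scale c L s t a v" .
qed

text \<open>\<open>K\<close> is the operator kernel of r times the identity, which lies in the
  commutant, and 1 - r is nonnegative.\<close>

lemma kernel_scale_le:
  assumes "K \<in> gpd_kernels" "K = kernel_scale (complex_of_real r) L" "0 \<le> r" "r \<le> 1"
  shows "K \<unlhd> L"
proof -
  let ?A = "\<lambda>f x. complex_of_real r * f x"
  have A: "?A \<in> pi_commutant L"
    unfolding pi_commutant_iff by (auto simp: fun_bounded_op_scale fun_eq_iff)
  have le: "ip E f (\<lambda>x. f x - complex_of_real r * f x) \<in> \<real>\<^sub>\<ge>\<^sub>0" if f: "f \<in> vecs E" for f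
  proof -
    have "ip E f (\<lambda>x. f x - complex_of_real r * f x) = complex_of_real ((1 - r) * (fnorm E f)\<^sup>2)"
      using f by (simp add: ip_diff_right ip_scale_right ip_self_eq algebra_simps)
    then show ?thesis
      using assms(4) by (simp only: nonneg_Reals_of_real_iff) simp
  qed
  have "op_kernel ?A = K"
  proof (intro ext)
    fix s t a v
    show "op_kernel ?A s t a v = K s t a v"
      by (rule cinner_ext) (simp add: cinner_op_kernel[OF A] assms(2) kernel_scale_def cinner_scaleC_right,
        simp add: kfun_def scalar_kernel_def star_one)
  qed
  then show ?thesis
    using op_kernel_le[OF A le] by simp
qed

lemma rn_derivative_is:
  assumes "K \<in> gpd_kernels" "K \<unlhd> L"
  shows "is_rn_derivative K L (rn_derivative K L)"
  unfolding rn_derivative_def using rn_derivative_exists[OF assms(1) gpd assms(2)] by (rule someI_ex)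

lemma irreducible_rn_derivative_scalar:
  assumes irr: "pi_irreducible L" and K: "K \<in> gpd_kernels" "K \<unlhd> L"
  shows "\<exists>r::real. 0 \<le> r \<and> r \<le> 1 \<and> (\<forall>f\<in>vecs E. rn_derivative K L f = (\<lambda>x. complex_of_real r * f x))"
proof -
  let ?A = "rn_derivative K L"
  have A: "?A \<in> pi_commutant L"
    and pos: "\<And>f. f \<in> vecs E \<Longrightarrow> ip E f (?A f) \<in> \<real>\<^sub>\<ge>\<^sub>0"
    and le: "\<And>f. f \<in> vecs E \<Longrightarrow> ip E f (\<lambda>x. f x - ?A f x) \<in> \<real>\<^sub>\<ge>\<^sub>0"
    using rn_derivative_is[OF K] by (simp_all add: is_rn_derivative_def)
  have "\<And>f. f \<in> vecs E \<Longrightarrow> ip E f (?A f) \<in> \<real>"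
    using pos nonneg_Reals_subset_Reals by blast
  then obtain l where l: "\<And>f. f \<in> vecs E \<Longrightarrow> ?A f = (\<lambda>x. complex_of_real l * f x)"
    using irreducible_commutant_scalar[OF irr A] by blast
  show ?thesis
  proof (cases "\<exists>f\<in>vecs E. fnorm E f \<noteq> 0")
    case True
    then obtain f where f: "f \<in> vecs E" "fnorm E f \<noteq> 0" by blast
    have n: "(fnorm E f)\<^sup>2 > 0" using f by simp
    have "ip E f (?A f) = complex_of_real (l * (fnorm E f)\<^sup>2)"
      using f by (simp add: l ip_scale_right ip_self_eq)
    then have "0 \<le> l * (fnorm E f)\<^sup>2"
      using pos[OF f(1)] by (simp only: nonneg_Reals_of_real_iff)
    moreover have "ip E f (\<lambda>x. f x - ?A f x) = complex_of_real ((1 - l) * (fnorm E f)\<^sup>2)"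
      using f by (simp add: l ip_diff_right ip_scale_right ip_self_eq algebra_simps)
    then have "0 \<le> (1 - l) * (fnorm E f)\<^sup>2"
      using le[OF f(1)] by (simp only: nonneg_Reals_of_real_iff)
    \<comment> \<open>The bounds 0 \<le> A \<le> 1, tested on one nonzero vector, confine the
      constant.\<close>
    ultimately have "0 \<le> l" "l \<le> 1"
      using n by (simp_all add: zero_le_mult_iff)
    then show ?thesis using l by blast
  next
    case False
    \<comment> \<open>On the zero space every constant represents the operator, and the one found
      above may lie outside the unit interval; 0 is taken instead.\<close>
    have "?A f = (\<lambda>x. complex_of_real 0 * f x)" if f: "f \<in> vecs E" for f
    proof -
      have "f = (\<lambda>x. 0)"
        using False f fnorm_eq_zero by blast
      then show ?thesis using l[OF f] by simp
    qed
    then show ?thesis by (intro exI[of _ 0]) auto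
  qed
qed

end

text \<open>In the second condition the constant ranges over the real interval from 0 to 1. With
  arbitrary constants the equivalence would fail for every nonzero irreducible \<open>L\<close>: the
  kernel 2 L is a multiple of \<open>L\<close> in \<open>gpd_kernels\<close>, but it lies below
  \<open>L\<close> only if - L is positive definite as well, that is, if \<open>L\<close>
  vanishes.\<close>

theorem corollary6:
  fixes L :: "('x, 'a::unital_cstar_algebra, 'h::complex_hilbert) op_kernel"
  assumes "L \<in> gpd_kernels"
  shows "(pi_irreducible L \<longleftrightarrow>
            (\<forall>K\<in>gpd_kernels. K \<unlhd> L \<longleftrightarrow>
               (\<exists>r::real. 0 \<le> r \<and> r \<le> 1 \<and> K = kernel_scale (complex_of_real r) L)))
       \<and> (pi_irreducible L \<longleftrightarrow>
            (\<forall>K\<in>gpd_kernels. K \<unlhd> L \<longrightarrow>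
               (\<exists>c::complex. \<forall>f\<in>vecs (kernel_space L).
                  rn_derivative K L f = (\<lambda>x. c * f x))))"
proof -
  interpret gpd_kernel L by standard (rule assms)
  have two: "K \<unlhd> L \<longleftrightarrow> (\<exists>r::real. 0 \<le> r \<and> r \<le> 1 \<and> K = kernel_scale (complex_of_real r) L)"
    if irr: "pi_irreducible L" and K: "K \<in> gpd_kernels" for K
  proof
    assume KL: "K \<unlhd> L"
    obtain r :: real where r: "0 \<le> r" "r \<le> 1"
      "\<And>f. f \<in> vecs (kernel_space L) \<Longrightarrow> rn_derivative K L f = (\<lambda>x. complex_of_real r * f x)"
      using irreducible_rn_derivative_scalar[OF irr K KL] by blast
    have "K = kernel_scale (complex_of_real r) L"
      by (rule kernel_scale_if_op_scalar[OF rn_derivative_is[OF K KL] r(3)])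
    then show "\<exists>r::real. 0 \<le> r \<and> r \<le> 1 \<and> K = kernel_scale (complex_of_real r) L"
      using r by blast
  next
    assume "\<exists>r::real. 0 \<le> r \<and> r \<le> 1 \<and> K = kernel_scale (complex_of_real r) L"
    then show "K \<unlhd> L"
      using kernel_scale_le[OF K] by blast
  qed
  have three: "\<exists>c::complex. \<forall>f\<in>vecs (kernel_space L). rn_derivative K L f = (\<lambda>x. c * f x)"
    if "pi_irreducible L" "K \<in> gpd_kernels" "K \<unlhd> L" for K
    using irreducible_rn_derivative_scalar[OF that] by blast
  have two': "pi_irreducible L"
    if h: "\<forall>K\<in>gpd_kernels. K \<unlhd> L \<longleftrightarrow>
      (\<exists>r::real. 0 \<le> r \<and> r \<le> 1 \<and> K = kernel_scale (complex_of_real r) L)"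
    by (rule irreducible_if_scalar_kernels) (use h in blast)
  have three': "pi_irreducible L"
    if h: "\<forall>K\<in>gpd_kernels. K \<unlhd> L \<longrightarrow>
      (\<exists>c::complex. \<forall>f\<in>vecs (kernel_space L). rn_derivative K L f = (\<lambda>x. c * f x))"
  proof (rule irreducible_if_scalar_kernels)
    fix K assume K: "K \<in> gpd_kernels" "K \<unlhd> L"
    then obtain c where c: "\<And>f. f \<in> vecs (kernel_space L) \<Longrightarrow> rn_derivative K L f = (\<lambda>x. c * f x)"
      using h by blast
    show "\<exists>c. K = kernel_scale c L"
      using kernel_scale_if_op_scalar[OF rn_derivative_is[OF K] c] by blast
  qed
  show ?thesis
    using two three two' three' by blast
qed

end
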